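(* Let $8 < k := k(n)$ be an integer. Then there exist constants $c_1, c_2 > 0$ such that $G \cup \mathbb{G}(n,p)$ asymptotically almost surely satisfies Hadwiger's conjecture, that is, $h(G \cup \mathbb{G}(n,p)) \geq \chi(G \cup \mathbb{G}(n,p))$, whenever $G$ is a vertex-transitive graph on $n$ vertices satisfying $c_1 k^2 \log^3 n \leq \alpha(G) \leq \frac{c_2 n}{k}$, and $p := p(n) = \frac{8}{nk}$.
   Context: $\mathbb{G}(n,p)$ is the binomial random graph on the same $n$-element vertex set as $G$ (each pair is an edge independently with probability $p$), and $G \cup \mathbb{G}(n,p)$ is the random graph $G \cup R$ (union of edge sets) with $R \sim \mathbb{G}(n,p)$. A graph is vertex-transitive if for any pair of vertices $u,v$ there is an automorphism of the graph mapping $u$ to $v$. $\alpha(\cdot)$ and $\chi(\cdot)$ denote the independence number and the chromatic number. A graph $H$ is a minor of a graph $K$ if $H$ can be obtained from a subgraph of $K$ through a series of edge-contractions; the Hadwiger number $h(K)$ is the largest integer $r$ such that $K$ contains $K_r$ as a minor. "Asymptotically almost surely" means with probability tending to $1$ as $n \to \infty$, for every choice of $n$-vertex graphs $G=G_n$ satisfying the hypotheses. $\log$ is the natural logarithm. *)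

theory Defs
  imports "HOL-Probability.Probability" "HOL-Probability.Product_PMF"
begin

section \<open>Finite simple graphs\<close>

record 'a ugraph =
  verts :: "'a set"
  edges :: "'a set set"

definition all_pairs :: "'a set \<Rightarrow> 'a set set" where
  "all_pairs V = {e. e \<subseteq> V \<and> card e = 2}"

text \<open>The graph without vertices is admitted.\<close>

definition simple_graph :: "'a ugraph \<Rightarrow> bool" where
  "simple_graph G \<longleftrightarrow> finite (verts G) \<and> edges G \<subseteq> all_pairs (verts G)"

definition subgraph :: "'a ugraph \<Rightarrow> 'a ugraph \<Rightarrow> bool" where
  "subgraph H G \<longleftrightarrow> simple_graph H \<and> verts H \<subseteq> verts G \<and> edges H \<subseteq> edges G"

definition graph_union :: "'a ugraph \<Rightarrow> 'a ugraph \<Rightarrow> 'a ugraph" where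
  "graph_union G H = \<lparr>verts = verts G \<union> verts H, edges = edges G \<union> edges H\<rparr>"

definition complete_graph :: "nat \<Rightarrow> nat ugraph" where
  "complete_graph r = \<lparr>verts = {..<r}, edges = all_pairs {..<r}\<rparr>"

definition graph_isomorphism :: "('a \<Rightarrow> 'b) \<Rightarrow> 'a ugraph \<Rightarrow> 'b ugraph \<Rightarrow> bool" where
  "graph_isomorphism f G H \<longleftrightarrow> bij_betw f (verts G) (verts H) \<and>
     (\<forall>u\<in>verts G. \<forall>v\<in>verts G. {u, v} \<in> edges G \<longleftrightarrow> {f u, f v} \<in> edges H)"

definition vertex_transitive :: "'a ugraph \<Rightarrow> bool" where
  "vertex_transitive G \<longleftrightarrow>
     (\<forall>u\<in>verts G. \<forall>v\<in>verts G. \<exists>f. graph_isomorphism f G G \<and> f u = v)"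

section \<open>Independence number and chromatic number\<close>

definition independent_set :: "'a ugraph \<Rightarrow> 'a set \<Rightarrow> bool" where
  "independent_set G S \<longleftrightarrow> S \<subseteq> verts G \<and> (\<forall>u\<in>S. \<forall>v\<in>S. {u, v} \<notin> edges G)"

definition independence_number :: "'a ugraph \<Rightarrow> nat" where
  "independence_number G = Max {card S |S. independent_set G S}"

definition proper_colouring :: "'a ugraph \<Rightarrow> nat \<Rightarrow> ('a \<Rightarrow> nat) \<Rightarrow> bool" where
  "proper_colouring G q c \<longleftrightarrow> (\<forall>v\<in>verts G. c v < q) \<and>
     (\<forall>u\<in>verts G. \<forall>v\<in>verts G. {u, v} \<in> edges G \<longrightarrow> c u \<noteq> c v)"

definition chromatic_number :: "'a ugraph \<Rightarrow> nat" where
  "chromatic_number G = (LEAST q. \<exists>c. proper_colouring G q c)"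

section \<open>Minors\<close>

text \<open>Contracting \<open>{u, v}\<close> identifies \<open>v\<close> with \<open>u\<close>. Omitting the edge \<open>{u, v}\<close> avoids the
  loop at \<open>u\<close>, and parallel edges merge because the edges form a set.\<close>

definition contract_edge :: "'a \<Rightarrow> 'a \<Rightarrow> 'a ugraph \<Rightarrow> 'a ugraph" where
  "contract_edge u v G =
     \<lparr>verts = verts G - {v},
      edges = (\<lambda>e. (id(v := u)) ` e) ` (edges G - {{u, v}})\<rparr>"

definition edge_contraction :: "'a ugraph \<Rightarrow> 'a ugraph \<Rightarrow> bool" where
  "edge_contraction G G' \<longleftrightarrow> (\<exists>u v. u \<noteq> v \<and> {u, v} \<in> edges G \<and> G' = contract_edge u v G)"

definition is_minor :: "'b ugraph \<Rightarrow> 'a ugraph \<Rightarrow> bool" where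
  "is_minor H K \<longleftrightarrow>
     (\<exists>K' K''. subgraph K' K \<and> edge_contraction\<^sup>*\<^sup>* K' K'' \<and> (\<exists>f. graph_isomorphism f K'' H))"

definition hadwiger_number :: "'a ugraph \<Rightarrow> nat" where
  "hadwiger_number K = Max {r. is_minor (complete_graph r) K}"

section \<open>The binomial random graph\<close>

definition binomial_random_graph :: "'a set \<Rightarrow> real \<Rightarrow> 'a ugraph pmf" where
  "binomial_random_graph V p =
     map_pmf (\<lambda>b. \<lparr>verts = V, edges = {e \<in> all_pairs V. b e}\<rparr>)
       (Pi_pmf (all_pairs V) False (\<lambda>_. bernoulli_pmf p))"

end

theory Submission
  imports Defs "HOL-Combinatorics.Permutations" "HOL-Real_Asymp.Real_Asymp"
begin

text \<open>Write \<open>\<alpha>\<close> for the independence number and \<open>d\<close> for the degree of \<open>G\<close>, so that \<open>d + 1 \<ge> n / \<alpha>\<close>.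

  Upper bound: translates of a maximum independent set cover \<open>G\<close> greedily, so
  \<open>\<chi>(G) \<le> (n / \<alpha>) ln n + 1\<close>. The random graph has average degree below \<open>8 / 9\<close>, hence with high
  probability it contains no path with two further chords at an end vertex; then it is
  2-degenerate and the union has chromatic number at most \<open>3 \<chi>(G)\<close>.

  Lower bound: \<open>G\<close> contains \<open>N\<close> disjoint stars (cores) of exactly \<open>m = 10 k\<close> vertices that cover a
  constant fraction of all vertices. The random graph between the cores is so dense that any two
  families of \<open>N / 4\<close> cores are joined, so depth-first search finds a path through \<open>N / 2\<close> cores,
  which is cut into segments of about \<open>100 sqrt (\<alpha> ln n)\<close> cores. As all cores have the same size,
  the distribution of the random graph is invariant under permuting them; therefore a segment
  behaves like a random sequence of cores, and two random segments fail to be joined by an edge of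
  \<open>G\<close> with probability at most a large negative power of \<open>n\<close>. The segments are the branch sets of a
  complete minor with more than \<open>3 ((n / \<alpha>) ln n + 1)\<close> vertices.\<close>

section \<open>Branch sets and complete minors\<close>

text \<open>The path found by depth-first search depends on the random edges, so nothing can be said
  directly about how \<open>G\<close> lies between its segments. Permuting equally large cores
  leaves \<open>G\<close> and the law of the random graph unchanged; for each fixed outcome the path
  is then moved by a uniformly random permutation.

  Constants: since N m >= 2n/5, taking m = 10k makes p (N m)^2 / 16, a lower bound for the expected
  number of edges between two families of N/4 cores, at least 2N, which beats the 4^N choices of
  families. Two random segments of t cores miss each other with probability roughly exp(-c t^2 /
  \<alpha>), hence t of order sqrt(\<alpha> ln n). The number N / (2t) of segments, of order n / (k
  sqrt(\<alpha> ln n)), exceeds a multiple of (n / \<alpha>) ln n once \<alpha> is at least a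
  constant times k^2 ln^3 n: this is the lower hypothesis on \<alpha>. The upper one makes the
  degree a large multiple of k, so that stars of 10k vertices exist, and keeps t^2 / N at most of
  order ln n, so that drawing cores without replacement costs only a factor n.\<close>

definition cut_connected :: "'a set set \<Rightarrow> 'a set \<Rightarrow> bool" where
  "cut_connected E B \<longleftrightarrow> (\<forall>X. X \<subseteq> B \<longrightarrow> X \<noteq> {} \<longrightarrow> X \<noteq> B \<longrightarrow> (\<exists>x\<in>X. \<exists>y\<in>B - X. {x, y} \<in> E))"

lemma cut_connectedD:
  "cut_connected E B \<Longrightarrow> X \<subseteq> B \<Longrightarrow> X \<noteq> {} \<Longrightarrow> X \<noteq> B \<Longrightarrow> \<exists>x\<in>X. \<exists>y\<in>B - X. {x, y} \<in> E"
  by (simp add: cut_connected_def)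

lemma cut_connected_mono: "cut_connected E B \<Longrightarrow> E \<subseteq> F \<Longrightarrow> cut_connected F B"
  unfolding cut_connected_def by (meson subsetD)

lemma cut_connected_singleton: "cut_connected E {x}"
  by (auto simp: cut_connected_def)

lemma cut_connected_Un:
  assumes A: "cut_connected E A" and B: "cut_connected E B"
    and e: "a \<in> A" "b \<in> B" "{a, b} \<in> E"
  shows "cut_connected E (A \<union> B)"
  unfolding cut_connected_def
proof (intro allI impI)
  fix X assume X: "X \<subseteq> A \<union> B" "X \<noteq> {}" "X \<noteq> A \<union> B"
  show "\<exists>x\<in>X. \<exists>y\<in>A \<union> B - X. {x, y} \<in> E"
  proof (cases "(X \<inter> A \<noteq> {} \<and> X \<inter> A \<noteq> A) \<or> (X \<inter> B \<noteq> {} \<and> X \<inter> B \<noteq> B)")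
    case True
    then have "(\<exists>x\<in>X \<inter> A. \<exists>y\<in>A - X \<inter> A. {x, y} \<in> E) \<or> (\<exists>x\<in>X \<inter> B. \<exists>y\<in>B - X \<inter> B. {x, y} \<in> E)"
      using cut_connectedD[OF A, of "X \<inter> A"] cut_connectedD[OF B, of "X \<inter> B"] by auto
    then show ?thesis by auto
  next
    case False
    then have "(a \<in> X \<and> b \<notin> X) \<or> (b \<in> X \<and> a \<notin> X)" using X e(1,2) by auto
    then show ?thesis using e by (metis DiffI UnI1 UnI2 insert_commute)
  qed
qed

lemma all_pairsD: "{x, y} \<in> all_pairs V \<Longrightarrow> x \<in> V \<and> y \<in> V \<and> x \<noteq> y"
  by (auto simp: all_pairs_def)

lemma all_pairs_iff: "{x, y} \<in> all_pairs V \<longleftrightarrow> x \<in> V \<and> y \<in> V \<and> x \<noteq> y"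
  by (auto simp: all_pairs_def)

lemma all_pairsE:
  assumes "e \<in> all_pairs V" obtains x y where "e = {x, y}" "x \<in> V" "y \<in> V" "x \<noteq> y"
  using assms by (auto simp: all_pairs_def card_2_iff)

lemma contract_edge_simple:
  assumes "simple_graph K" "{u, v} \<in> edges K"
  shows "simple_graph (contract_edge u v K)"
proof -
  have uv: "u \<in> verts K" "v \<in> verts K" "u \<noteq> v"
    using assms all_pairsD[of u v "verts K"] by (auto simp: simple_graph_def)
  have "(id(v := u)) ` e \<in> all_pairs (verts K - {v})" if e: "e \<in> edges K - {{u, v}}" for e
  proof -
    obtain x y where xy: "e = {x, y}" "x \<in> verts K" "y \<in> verts K" "x \<noteq> y"
      using e assms(1) all_pairsE[of e "verts K"] by (metis DiffD1 simple_graph_def subsetD)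
    then have "(id(v := u)) x \<noteq> (id(v := u)) y" using e by (auto simp: doubleton_eq_iff)
    then show ?thesis using xy uv by (simp add: all_pairs_iff del: fun_upd_apply) auto
  qed
  then show ?thesis using assms(1) by (auto simp: simple_graph_def contract_edge_def)
qed

lemma contract_edge_image:
  assumes "{x, y} \<in> edges K" "{x, y} \<noteq> {u, v}"
  shows "{(id(v := u)) x, (id(v := u)) y} \<in> edges (contract_edge u v K)"
  using assms by (auto simp: contract_edge_def intro!: image_eqI[where x="{x,y}"])

text \<open>Phrasing connectedness by cuts avoids tracking paths: a cut \<open>X\<close> of the
  contracted set is lifted by adding \<open>v\<close> exactly when \<open>u\<close> lies in
  \<open>X\<close>; an edge crossing the lifted cut is not \<open>{u, v}\<close>, and its image
  crosses \<open>X\<close>.\<close>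

lemma cut_connected_contract:
  assumes B: "cut_connected (edges K) B" and "u \<noteq> v" and uv: "{u, v} \<subseteq> B \<or> {u, v} \<inter> B = {}"
  shows "cut_connected (edges (contract_edge u v K)) (B - {v})"
  unfolding cut_connected_def
proof (intro allI impI)
  fix X assume X: "X \<subseteq> B - {v}" "X \<noteq> {}" "X \<noteq> B - {v}"
  define X' where "X' = (if u \<in> X then insert v X else X)"
  have "X' \<subseteq> B" "X' \<noteq> {}" "X' \<noteq> B" using X uv \<open>u \<noteq> v\<close> by (auto simp: X'_def split: if_splits)
  then obtain x y where xy: "x \<in> X'" "y \<in> B - X'" "{x, y} \<in> edges K"
    using cut_connectedD[OF B] by meson
  have "{x, y} \<noteq> {u, v}" using xy X by (auto simp: X'_def doubleton_eq_iff split: if_splits)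
  from contract_edge_image[OF xy(3) this]
  have "{(id(v := u)) x, (id(v := u)) y} \<in> edges (contract_edge u v K)" .
  moreover have "(id(v := u)) x \<in> X" using xy X by (auto simp: X'_def split: if_splits)
  moreover have "(id(v := u)) y \<in> B - {v} - X" using xy X uv \<open>u \<noteq> v\<close> by (auto simp: X'_def split: if_splits)
  ultimately show "\<exists>x\<in>X. \<exists>y\<in>B - {v} - X. {x, y} \<in> edges (contract_edge u v K)" by blast
qed

text \<open>Induction on the number of vertices: while some branch set has two vertices,
  connectedness gives an edge inside it to contract, and every hypothesis survives. Once all branch
  sets are singletons, \<open>K\<close> is itself complete, because they cover its vertices and are
  pairwise joined.\<close>

lemma contract_branch_sets:
  assumes "simple_graph K" "verts K = (\<Union>i<r. B i)"
    and "\<And>i. i < r \<Longrightarrow> B i \<noteq> {}" "\<And>i. i < r \<Longrightarrow> cut_connected (edges K) (B i)"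
    and "\<And>i j. i < r \<Longrightarrow> j < r \<Longrightarrow> i \<noteq> j \<Longrightarrow> B i \<inter> B j = {}"
    and "\<And>i j. i < r \<Longrightarrow> j < r \<Longrightarrow> i \<noteq> j \<Longrightarrow> \<exists>x\<in>B i. \<exists>y\<in>B j. {x, y} \<in> edges K"
  shows "\<exists>K' f. edge_contraction\<^sup>*\<^sup>* K K' \<and> graph_isomorphism f K' (complete_graph r)"
  using assms
proof (induction "card (verts K)" arbitrary: K B rule: less_induct)
  case less
  note sg = less.prems(1) and vK = less.prems(2) and ne = less.prems(3) and cc = less.prems(4)
    and dj = less.prems(5) and ad = less.prems(6)
  have fin: "finite (verts K)" using sg by (simp add: simple_graph_def)
  show ?case
  proof (cases "\<exists>i<r. \<exists>a\<in>B i. \<exists>b\<in>B i. a \<noteq> b")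
    case True
    then obtain i a b where i: "i < r" "a \<in> B i" "b \<in> B i" "a \<noteq> b" by blast
    have "\<exists>x\<in>{a}. \<exists>y\<in>B i - {a}. {x, y} \<in> edges K"
      by (rule cut_connectedD[OF cc[OF i(1)]]) (use i in auto)
    then obtain v where v: "v \<in> B i" "v \<noteq> a" "{a, v} \<in> edges K" by blast
    let ?K = "contract_edge a v K" and ?B = "\<lambda>j. B j - {v}"
    have dj': "v \<notin> B j" "a \<notin> B j" if "j < r" "j \<noteq> i" for j
      using dj[OF i(1) that(1)] that v i by auto
    have "v \<in> verts K" using v i vK by auto
    have "card (verts ?K) < card (verts K)"
      using card_Diff1_less[OF fin \<open>v \<in> verts K\<close>] by (simp add: contract_edge_def)
    moreover have "simple_graph ?K" by (rule contract_edge_simple[OF sg v(3)])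
    moreover have "verts ?K = (\<Union>j<r. ?B j)" using vK by (auto simp: contract_edge_def)
    moreover have "?B j \<noteq> {}" if "j < r" for j
      using ne[OF that] dj'[of j] that v i by (cases "j = i") auto
    moreover have "cut_connected (edges ?K) (?B j)" if "j < r" for j
      by (rule cut_connected_contract[OF cc[OF that]]) (use v i dj'[of j] that in \<open>cases "j = i"; auto\<close>)+
    moreover have "?B j \<inter> ?B l = {}" if "j < r" "l < r" "j \<noteq> l" for j l using dj that by blast
    moreover have "\<exists>x\<in>?B j. \<exists>y\<in>?B l. {x, y} \<in> edges ?K" if jl: "j < r" "l < r" "j \<noteq> l" for j l
    proof -
      obtain x y where xy: "x \<in> B j" "y \<in> B l" "{x, y} \<in> edges K" using ad[OF jl] by blast
      have "{x, y} \<noteq> {a, v}"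
        using xy dj'[of j] dj'[of l] jl by (auto simp: doubleton_eq_iff)
      from contract_edge_image[OF xy(3) this]
      have "{(id(v := a)) x, (id(v := a)) y} \<in> edges ?K" .
      moreover have "(id(v := a)) x \<in> ?B j" "(id(v := a)) y \<in> ?B l"
        using xy v i dj'[of j] dj'[of l] jl by auto
      ultimately show ?thesis by blast
    qed
    ultimately have "\<exists>K' f. edge_contraction\<^sup>*\<^sup>* ?K K' \<and> graph_isomorphism f K' (complete_graph r)"
      by (rule less.hyps)
    then obtain K' f where K': "edge_contraction\<^sup>*\<^sup>* ?K K'" "graph_isomorphism f K' (complete_graph r)"
      by blast
    have "edge_contraction K ?K" unfolding edge_contraction_def using v(2,3) by (intro exI[of _ a] exI[of _ v]) simp
    from converse_rtranclp_into_rtranclp[OF this K'(1)] K'(2) show ?thesis by blast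
  next
    case False
    define b where "b i = (SOME x. x \<in> B i)" for i
    have b: "B i = {b i}" if "i < r" for i
    proof -
      have "b i \<in> B i" unfolding b_def using ne[OF that] by (simp add: some_in_eq)
      then show ?thesis using False that by auto
    qed
    have injb: "inj_on b {..<r}"
    proof (rule inj_onI)
      fix i j assume "i \<in> {..<r}" "j \<in> {..<r}" "b i = b j"
      then show "i = j" using dj[of i j] b[of i] b[of j] by auto
    qed
    have bb: "bij_betw b {..<r} (verts K)" using injb b vK by (auto simp: bij_betw_def)
    let ?f = "inv_into {..<r} b"
    have "graph_isomorphism ?f K (complete_graph r)"
      unfolding graph_isomorphism_def
    proof (intro conjI ballI)
      show "bij_betw ?f (verts K) (verts (complete_graph r))"
        using bij_betw_inv_into[OF bb] by (simp add: complete_graph_def)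
      fix u v assume "u \<in> verts K" "v \<in> verts K"
      then obtain i j where ij: "i < r" "j < r" "u = b i" "v = b j" using b vK by auto
      have f: "?f u = i" "?f v = j" using ij injb by auto
      have "{b i, b j} \<in> edges K \<longleftrightarrow> i \<noteq> j"
      proof
        assume "{b i, b j} \<in> edges K"
        then show "i \<noteq> j" using sg all_pairsD[of "b i" "b j" "verts K"] by (auto simp: simple_graph_def)
      next
        assume "i \<noteq> j" then show "{b i, b j} \<in> edges K" using ad[OF ij(1,2)] b ij by auto
      qed
      then show "({u, v} \<in> edges K) = ({?f u, ?f v} \<in> edges (complete_graph r))"
        using ij f by (simp add: complete_graph_def all_pairs_iff)
    qed
    then show ?thesis by blast
  qed
qed

text \<open>Makes the set under \<open>Max\<close> in \<open>hadwiger_number\<close> finite, as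
  \<open>Max_ge\<close> requires.\<close>

lemma is_minor_complete_card:
  assumes "simple_graph K" "is_minor (complete_graph r) K"
  shows "r \<le> card (verts K)"
proof -
  obtain K' K'' f where K: "subgraph K' K" "edge_contraction\<^sup>*\<^sup>* K' K''" "graph_isomorphism f K'' (complete_graph r)"
    using assms(2) by (auto simp: is_minor_def)
  have "finite (verts K')" using K(1) by (simp add: subgraph_def simple_graph_def)
  with K(2) have "finite (verts K'') \<and> card (verts K'') \<le> card (verts K')"
  proof (induction rule: rtranclp_induct)
    case (step y z)
    then obtain u v where "z = contract_edge u v y" by (auto simp: edge_contraction_def)
    then show ?case using step card_Diff1_le[of "verts y" v] by (auto simp: contract_edge_def)
  qed simp
  moreover have "card (verts K'') = r"
    using K(3) bij_betw_same_card[of f "verts K''" "{..<r}"] by (simp add: graph_isomorphism_def complete_graph_def)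
  moreover have "card (verts K') \<le> card (verts K)"
    using K(1) assms(1) by (auto simp: subgraph_def simple_graph_def card_mono)
  ultimately show ?thesis by simp
qed

lemma hadwiger_number_ge:
  assumes sg: "simple_graph K"
    and sub: "\<And>i. i < r \<Longrightarrow> B i \<subseteq> verts K" and ne: "\<And>i. i < r \<Longrightarrow> B i \<noteq> {}"
    and cc: "\<And>i. i < r \<Longrightarrow> cut_connected (edges K) (B i)"
    and dj: "\<And>i j. i < r \<Longrightarrow> j < r \<Longrightarrow> i \<noteq> j \<Longrightarrow> B i \<inter> B j = {}"
    and ad: "\<And>i j. i < r \<Longrightarrow> j < r \<Longrightarrow> i \<noteq> j \<Longrightarrow> \<exists>x\<in>B i. \<exists>y\<in>B j. {x, y} \<in> edges K"
  shows "r \<le> hadwiger_number K"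
proof -
  define U where "U = (\<Union>i<r. B i)"
  \<comment> \<open>Contractions cannot remove vertices outside all branch sets, so the minor is
    taken in the subgraph induced on their union.\<close>
  define K' where "K' = \<lparr>verts = U, edges = edges K \<inter> all_pairs U\<rparr>"
  have U: "U \<subseteq> verts K" using sub by (auto simp: U_def)
  then have sg': "simple_graph K'"
    using sg finite_subset by (auto simp: simple_graph_def K'_def)
  have sub': "subgraph K' K" using sg' U by (auto simp: subgraph_def K'_def)
  have E: "{x, y} \<in> edges K'" if "{x, y} \<in> edges K" "x \<in> U" "y \<in> U" for x y
  proof -
    have "{x, y} \<in> all_pairs (verts K)" using that(1) sg unfolding simple_graph_def by (meson subsetD)
    note all_pairsD[OF this]
    then have "{x, y} \<in> all_pairs U" using that(2,3) unfolding all_pairs_iff by simp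
    then show ?thesis using that(1) by (simp add: K'_def)
  qed
  have "cut_connected (edges K') (B i)" if "i < r" for i
    unfolding cut_connected_def
  proof (intro allI impI)
    fix X assume X: "X \<subseteq> B i" "X \<noteq> {}" "X \<noteq> B i"
    have "B i \<subseteq> U" using that by (auto simp: U_def)
    then show "\<exists>x\<in>X. \<exists>y\<in>B i - X. {x, y} \<in> edges K'"
      using cut_connectedD[OF cc[OF that] X] X E by blast
  qed
  moreover have "\<exists>x\<in>B i. \<exists>y\<in>B j. {x, y} \<in> edges K'" if "i < r" "j < r" "i \<noteq> j" for i j
    using ad[OF that] E that unfolding U_def by blast
  ultimately have "\<exists>K'' f. edge_contraction\<^sup>*\<^sup>* K' K'' \<and> graph_isomorphism f K'' (complete_graph r)"
    using contract_branch_sets[OF sg', where r = r and B = B] ne dj by (auto simp: K'_def U_def)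
  then have "is_minor (complete_graph r) K" using sub' by (auto simp: is_minor_def)
  moreover have "finite {r. is_minor (complete_graph r) K}"
    by (rule finite_subset[of _ "{..card (verts K)}"]) (use is_minor_complete_card[OF sg] in auto)
  ultimately show ?thesis by (auto simp: hadwiger_number_def intro: Max_ge)
qed

section \<open>Long paths by depth-first search\<close>

lemma long_path:
  assumes fin: "finite A" and sym: "\<And>x y. adj x y \<Longrightarrow> adj y x"
    and exp: "\<And>X Y. X \<subseteq> A \<Longrightarrow> Y \<subseteq> A \<Longrightarrow> X \<inter> Y = {} \<Longrightarrow> card A \<le> 4 * card X \<Longrightarrow> card A \<le> 4 * card Y \<Longrightarrow>
      \<exists>x\<in>X. \<exists>y\<in>Y. adj x y"
  shows "\<exists>xs. distinct xs \<and> set xs \<subseteq> A \<and> successively adj xs \<and> card A \<le> 2 * length xs"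
proof -
  text \<open>Depth-first search: \<open>xs\<close> is the stack, \<open>D\<close> the finished and \<open>T\<close> the unseen elements.
    Every step lowers \<open>card T - card D\<close> by one, so at some moment the two are equal.\<close>
  have "\<exists>D T xs. D \<union> T \<union> set xs = A \<and> D \<inter> T = {} \<and> D \<inter> set xs = {} \<and> T \<inter> set xs = {} \<and> distinct xs \<and>
      successively adj xs \<and> (\<forall>x\<in>D. \<forall>y\<in>T. \<not> adj x y) \<and> card T + j = card D + card A"
    if "j \<le> card A" for j
    using that
  proof (induction j)
    case 0
    show ?case by (rule exI[of _ "{}"], rule exI[of _ A], rule exI[of _ "[]"]) simp
  next
    case (Suc j)
    then obtain D T xs where IH: "D \<union> T \<union> set xs = A" "D \<inter> T = {}" "D \<inter> set xs = {}" "T \<inter> set xs = {}"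
        "distinct xs" "successively adj xs" "\<forall>x\<in>D. \<forall>y\<in>T. \<not> adj x y" "card T + j = card D + card A"
      by auto
    have finDT: "finite D" "finite T" using IH(1) fin by (auto intro: finite_subset)
    have push: ?case if t: "t \<in> T" "xs = [] \<or> adj (hd xs) t" for t
    proof -
      have "Suc (card (T - {t})) = card T" using t(1) finDT by (metis card_Suc_Diff1)
      then have "D \<union> (T - {t}) \<union> set (t # xs) = A \<and> D \<inter> (T - {t}) = {} \<and> D \<inter> set (t # xs) = {} \<and>
          (T - {t}) \<inter> set (t # xs) = {} \<and> distinct (t # xs) \<and> successively adj (t # xs) \<and>
          (\<forall>x\<in>D. \<forall>y\<in>T - {t}. \<not> adj x y) \<and> card (T - {t}) + Suc j = card D + card A"
        using IH t sym by (auto simp: successively_Cons)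
      then show ?thesis by blast
    qed
    show ?case
    proof (cases xs)
      case Nil
      have "card T > 0" using IH(8) Suc.prems by linarith
      then obtain t where "t \<in> T" by (auto simp: card_gt_0_iff)
      then show ?thesis using push Nil by blast
    next
      case (Cons x ys)
      show ?thesis
      proof (cases "\<exists>t\<in>T. adj x t")
        case True then show ?thesis using push Cons by auto
      next
        case False
        have "card (insert x D) = Suc (card D)" using IH(3) Cons finDT by auto
        then have "insert x D \<union> T \<union> set ys = A \<and> insert x D \<inter> T = {} \<and> insert x D \<inter> set ys = {} \<and>
          T \<inter> set ys = {} \<and> distinct ys \<and> successively adj ys \<and>
          (\<forall>x\<in>insert x D. \<forall>y\<in>T. \<not> adj x y) \<and> card T + Suc j = card (insert x D) + card A"
          using IH False Cons by (auto simp: successively_Cons)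
        then show ?thesis by blast
      qed
    qed
  qed
  \<comment> \<open>For \<open>j = card A\<close> the count reads \<open>card T = card D\<close>. No
    edge joins \<open>D\<close> to \<open>T\<close>, so the hypothesis \<open>exp\<close> keeps
    their common size below a quarter of \<open>card A\<close>, and the stack holds at least half of
    \<open>A\<close>.\<close>
  from this[OF order.refl] obtain D T xs where *: "D \<union> T \<union> set xs = A" "D \<inter> T = {}" "D \<inter> set xs = {}"
      "T \<inter> set xs = {}" "distinct xs" "successively adj xs" "\<forall>x\<in>D. \<forall>y\<in>T. \<not> adj x y" "card T = card D"
    by auto
  have finDT: "finite D" "finite T" using *(1) fin by (auto intro: finite_subset)
  have "4 * card T < card A"  if "A \<noteq> {}"
  proof (rule ccontr)
    assume "\<not> ?thesis"
    then have "\<exists>x\<in>D. \<exists>y\<in>T. adj x y" using * by (intro exp) auto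
    then show False using *(7) by blast
  qed
  moreover have "card A = card D + card T + length xs"
    using * finDT by (metis List.finite_set Un_empty_left card_Un_disjoint distinct_card finite_Un inf_sup_distrib2)
  ultimately have "card A \<le> 2 * length xs" using *(8) by (cases "A = {}") auto
  then show ?thesis using * by blast
qed

section \<open>Colouring the random graph\<close>

text \<open>Greedy: delete a vertex with at most \<open>q\<close> neighbours and colour the rest by
  induction; the neighbours block at most \<open>q\<close> of the \<open>q + 1\<close>
  colours.\<close>

lemma degenerate_colouring:
  assumes "finite S" "\<And>v. {v} \<notin> E"
    and "\<And>T. T \<subseteq> S \<Longrightarrow> T \<noteq> {} \<Longrightarrow> \<exists>v\<in>T. card {u \<in> T. {u, v} \<in> E} \<le> q"
  shows "\<exists>c. (\<forall>v\<in>S. c v < Suc q) \<and> (\<forall>u\<in>S. \<forall>v\<in>S. {u, v} \<in> E \<longrightarrow> c u \<noteq> (c v :: nat))"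
  using assms(1,3)
proof (induction S rule: finite_psubset_induct)
  case (psubset S)
  show ?case
  proof (cases "S = {}")
    case False
    then obtain v where v: "v \<in> S" "card {u \<in> S. {u, v} \<in> E} \<le> q" using psubset.prems[of S] by blast
    have "\<exists>c. (\<forall>v\<in>S - {v}. c v < Suc q) \<and> (\<forall>u\<in>S - {v}. \<forall>w\<in>S - {v}. {u, w} \<in> E \<longrightarrow> c u \<noteq> (c w :: nat))"
      by (rule psubset.IH) (use v psubset.prems in auto)
    then obtain c where c: "\<forall>v\<in>S - {v}. c v < Suc q" "\<forall>u\<in>S - {v}. \<forall>w\<in>S - {v}. {u, w} \<in> E \<longrightarrow> c u \<noteq> (c w :: nat)"
      by blast
    let ?N = "{u \<in> S. {u, v} \<in> E}"
    have "card (c ` ?N) < card {..q}"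
      using card_image_le[of ?N c] v(2) psubset.hyps by simp
    moreover have "finite (c ` ?N)" using psubset.hyps by simp
    ultimately have "\<not> {..q} \<subseteq> c ` ?N" using card_mono leD by blast
    then obtain x where x: "x \<le> q" "x \<notin> c ` ?N" by auto
    have nv: "{v} \<notin> E" by (rule assms(2))
    let ?c = "c(v := x)"
    have "\<forall>u\<in>S. \<forall>w\<in>S. {u, w} \<in> E \<longrightarrow> ?c u \<noteq> ?c w"
    proof (intro ballI impI)
      fix u w assume uw: "u \<in> S" "w \<in> S" "{u, w} \<in> E"
      consider "u = v" "w = v" | "u = v" "w \<noteq> v" | "u \<noteq> v" "w = v" | "u \<noteq> v" "w \<noteq> v" by blast
      then show "?c u \<noteq> ?c w"
      proof cases
        case 2 then show ?thesis using x uw by (auto simp: insert_commute)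
      qed (use nv x uw c(2) in auto)
    qed
    moreover have "\<forall>u\<in>S. ?c u < Suc q" using c(1) x(1) by auto
    ultimately show ?thesis by blast
  qed simp
qed

fun path_edges :: "'a list \<Rightarrow> 'a set set" where
  "path_edges (x # y # zs) = insert {x, y} (path_edges (y # zs))"
| "path_edges _ = {}"

lemma path_edges_subset: "e \<in> path_edges xs \<Longrightarrow> e \<subseteq> set xs"
  by (induction xs rule: path_edges.induct) auto

lemma finite_path_edges [simp]: "finite (path_edges xs)"
  by (induction xs rule: path_edges.induct) auto

lemma card_path_edges: "distinct xs \<Longrightarrow> card (path_edges xs) = length xs - 1"
proof (induction xs rule: path_edges.induct)
  case (1 x y zs)
  then have "{x, y} \<notin> path_edges (y # zs)" using path_edges_subset[of "{x, y}" "y # zs"] by auto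
  then show ?case using 1 by simp
qed auto

text \<open>The obstruction to 2-degeneracy that is counted below. When the chords are not edges of
  the path there are \<open>l + 1\<close> edges on \<open>l\<close> vertices, so at most about
  \<open>l^2 * n^l * p^(l + 1)\<close> copies are expected: for \<open>n * p < 1\<close> a factor
  \<open>p\<close> is left over.\<close>

definition lollipop_edges :: "'a list \<Rightarrow> 'a \<Rightarrow> 'a \<Rightarrow> 'a set set" where
  "lollipop_edges xs a b = insert {hd xs, a} (insert {hd xs, b} (path_edges xs))"

lemma card_lollipop_edges:
  assumes "distinct (x # y # zs)" "a \<in> set zs" "b \<in> set zs" "a \<noteq> b"
  shows "card (lollipop_edges (x # y # zs) a b) = length (x # y # zs) + 1"
proof -
  have "{x, a} \<notin> path_edges (x # y # zs)" "{x, b} \<notin> path_edges (x # y # zs)"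
    using assms path_edges_subset[of "{x, _}" "y # zs"] by (auto simp: doubleton_eq_iff)
  then show ?thesis
    using assms card_path_edges[OF assms(1)] by (simp add: lollipop_edges_def doubleton_eq_iff del: path_edges.simps)
qed

text \<open>All neighbours of the first vertex of a longest path lie on the path, for otherwise it
  could be prolonged. There are at least three of them; discarding the second vertex of the path
  leaves the chord ends \<open>a\<close> and \<open>b\<close>.\<close>

lemma path_with_two_chords:
  assumes S: "finite S" "S \<noteq> {}" and loop: "\<And>v. {v} \<notin> E"
    and deg: "\<And>v. v \<in> S \<Longrightarrow> 3 \<le> card {u \<in> S. {u, v} \<in> E}"
  shows "\<exists>x y zs a b. distinct (x # y # zs) \<and> set (x # y # zs) \<subseteq> S \<and> a \<in> set zs \<and> b \<in> set zs \<and> a \<noteq> b \<and>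
           lollipop_edges (x # y # zs) a b \<subseteq> E"
proof -
  let ?P = "\<lambda>xs. xs \<noteq> [] \<and> distinct xs \<and> set xs \<subseteq> S \<and> path_edges xs \<subseteq> E"
  obtain s where "s \<in> S" using S by blast
  then have "?P [s]" by simp
  moreover have "\<forall>xs. ?P xs \<longrightarrow> length xs < Suc (card S)"
    using S(1) by (metis card_mono distinct_card less_Suc_eq_le)
  ultimately obtain xs where xs: "?P xs" and max: "\<And>ys. ?P ys \<Longrightarrow> length ys \<le> length xs"
    using ex_has_greatest_nat[of ?P "[s]" length "Suc (card S)"] by blast
  obtain x ys where x: "xs = x # ys" using xs by (cases xs) auto
  let ?N = "{u \<in> S. {u, x} \<in> E}"
  have "?N \<subseteq> set ys"
  proof
    fix u assume u: "u \<in> ?N"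
    show "u \<in> set ys"
    proof (rule ccontr)
      assume "u \<notin> set ys"
      moreover have "u \<noteq> x" using u loop by auto
      ultimately have "?P (u # xs)" using xs u x by auto
      then show False using max[of "u # xs"] by simp
    qed
  qed
  have N3: "3 \<le> card ?N" using deg xs x by auto
  have "ys \<noteq> []"
  proof
    assume "ys = []"
    then have "?N = {}" using \<open>?N \<subseteq> set ys\<close> by simp
    then show False using N3 by (metis card.empty not_numeral_le_zero)
  qed
  then obtain y zs where y: "ys = y # zs" by (cases ys) auto
  have "card (?N - {y}) \<ge> 2" using N3 diff_card_le_card_Diff[of "{y}" ?N] by simp
  then obtain F where "F \<subseteq> ?N - {y}" "card F = 2" by (rule obtain_subset_with_card_n)
  then obtain a b where "a \<in> ?N - {y}" "b \<in> ?N - {y}" "a \<noteq> b" by (auto simp: card_2_iff)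
  moreover from this have "a \<in> set zs" "b \<in> set zs" using \<open>?N \<subseteq> set ys\<close> y by auto
  ultimately show ?thesis
    using xs x y by (intro exI[of _ x] exI[of _ y] exI[of _ zs] exI[of _ a] exI[of _ b])
      (auto simp: lollipop_edges_def insert_commute)
qed

section \<open>Union bound over paths with two chords\<close>

lemma prob_all_present:
  assumes "finite A" "F \<subseteq> A" "0 \<le> p" "p \<le> 1"
  shows "measure_pmf.prob (Pi_pmf A False (\<lambda>_. bernoulli_pmf p)) {b. \<forall>e\<in>F. b e} = p ^ card F"
proof -
  have "{b. \<forall>e\<in>F. b e} = Pi A (\<lambda>e. if e \<in> F then {True} else UNIV)"
    using assms(2) by (auto simp: Pi_def)
  then have "measure_pmf.prob (Pi_pmf A False (\<lambda>_. bernoulli_pmf p)) {b. \<forall>e\<in>F. b e} =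
      (\<Prod>e\<in>A. measure_pmf.prob (bernoulli_pmf p) (if e \<in> F then {True} else UNIV))"
    using measure_Pi_pmf_Pi[OF assms(1)] by simp
  also have "\<dots> = (\<Prod>e\<in>A. if e \<in> F then p else 1)"
    by (rule prod.cong) (use assms in \<open>auto simp: measure_pmf_single\<close>)
  also have "\<dots> = p ^ card F"
    using assms by (simp add: prod.If_cases Int_absorb1)
  finally show ?thesis .
qed

lemma prob_all_absent:
  assumes "finite A" "F \<subseteq> A" "0 \<le> p" "p \<le> 1"
  shows "measure_pmf.prob (Pi_pmf A False (\<lambda>_. bernoulli_pmf p)) {b. \<forall>e\<in>F. \<not> b e} = (1 - p) ^ card F"
proof -
  have "{b. \<forall>e\<in>F. \<not> b e} = Pi A (\<lambda>e. if e \<in> F then {False} else UNIV)"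
    using assms(2) by (auto simp: Pi_def)
  then have "measure_pmf.prob (Pi_pmf A False (\<lambda>_. bernoulli_pmf p)) {b. \<forall>e\<in>F. \<not> b e} =
      (\<Prod>e\<in>A. measure_pmf.prob (bernoulli_pmf p) (if e \<in> F then {False} else UNIV))"
    using measure_Pi_pmf_Pi[OF assms(1)] by simp
  also have "\<dots> = (\<Prod>e\<in>A. if e \<in> F then 1 - p else 1)"
    by (rule prod.cong) (use assms in \<open>auto simp: measure_pmf_single\<close>)
  also have "\<dots> = (1 - p) ^ card F"
    using assms by (simp add: prod.If_cases Int_absorb1)
  finally show ?thesis .
qed

lemma finite_all_pairs [simp]: "finite V \<Longrightarrow> finite (all_pairs V)"
  by (simp add: all_pairs_def)

definition three_colourable :: "'a set \<Rightarrow> 'a set set \<Rightarrow> bool" where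
  "three_colourable V E \<longleftrightarrow>
     (\<exists>c. (\<forall>v\<in>V. c v < (3 :: nat)) \<and> (\<forall>u\<in>V. \<forall>v\<in>V. {u, v} \<in> E \<longrightarrow> c u \<noteq> c v))"

text \<open>Without a 3-colouring the greedy argument with \<open>q = 2\<close> must fail, on a
  nonempty set \<open>T\<close> inducing minimum degree at least 3; there
  \<open>path_with_two_chords\<close> applies.\<close>

lemma not_three_colourable_lollipop:
  assumes "finite V" "E \<subseteq> all_pairs V" "\<not> three_colourable V E"
  shows "\<exists>x y zs a b. distinct (x # y # zs) \<and> set (x # y # zs) \<subseteq> V \<and> a \<in> set zs \<and> b \<in> set zs \<and> a \<noteq> b \<and>
           lollipop_edges (x # y # zs) a b \<subseteq> E"
proof -
  have loop: "{v} \<notin> E" for v using assms(2) by (auto simp: all_pairs_def)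
  have "\<not> (\<forall>T. T \<subseteq> V \<longrightarrow> T \<noteq> {} \<longrightarrow> (\<exists>v\<in>T. card {u \<in> T. {u, v} \<in> E} \<le> 2))"
    using degenerate_colouring[OF assms(1) loop, of 2] assms(3)
    unfolding three_colourable_def numeral_3_eq_3 numeral_2_eq_2 by blast
  then obtain T where T: "T \<subseteq> V" "T \<noteq> {}" "\<And>v. v \<in> T \<Longrightarrow> \<not> card {u \<in> T. {u, v} \<in> E} \<le> 2" by blast
  have "finite T" using T assms finite_subset by blast
  have "3 \<le> card {u \<in> T. {u, v} \<in> E}" if "v \<in> T" for v using T(3)[OF that] by linarith
  from path_with_two_chords[OF \<open>finite T\<close> T(2) loop this] show ?thesis
    using T(1) by (meson dual_order.trans)
qed

text \<open>Paths with \<open>l\<close> vertices contribute at most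
  \<open>p * l^2 * (n * p)^l\<close> to the union bound, and the series converges because
  \<open>n * p <= 8 / 9\<close>. \<open>K\<close> is the sum of \<open>l^2 * (8 / 9)^l\<close>,
  hence independent of \<open>V\<close> and \<open>p\<close>.\<close>

lemma prob_not_three_colourable:
  "\<exists>K. \<forall>(V :: 'a set) p. finite V \<longrightarrow> 0 \<le> p \<longrightarrow> p \<le> 1 \<longrightarrow> real (card V) * p \<le> 8 / 9 \<longrightarrow>
     measure_pmf.prob (Pi_pmf (all_pairs V) False (\<lambda>_. bernoulli_pmf p))
       {b. \<not> three_colourable V {e \<in> all_pairs V. b e}} \<le> K * p"
proof -
  define K where "K = (\<Sum>l. real l ^ 2 * (8 / 9 :: real) ^ l)"
  have summ: "summable (\<lambda>l. real l ^ 2 * (8 / 9 :: real) ^ l)"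
  proof (rule summable_ratio_test[of "19 / 20" 100])
    fix l :: nat assume l: "l \<ge> 100"
    have "real l * (100 * 11) \<le> real l * (real l * 11)" using l by (intro mult_left_mono) auto
    then have "160 + real l * 320 \<le> real l * (real l * 11)" using l by linarith
    then have "real (Suc l) ^ 2 * 8 / 9 \<le> 19 / 20 * real l ^ 2"
      by (simp add: power2_eq_square algebra_simps)
    then have "(real (Suc l) ^ 2 * 8 / 9) * (8 / 9) ^ l \<le> (19 / 20 * real l ^ 2) * (8 / 9 :: real) ^ l"
      by (rule mult_right_mono) simp
    then show "norm (real (Suc l) ^ 2 * (8 / 9 :: real) ^ Suc l) \<le> 19 / 20 * norm (real l ^ 2 * (8 / 9 :: real) ^ l)"
      by (simp add: algebra_simps norm_mult norm_power)
  qed simp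
  show ?thesis
  proof (rule exI[of _ K], intro allI impI)
    fix V :: "'a set" and p :: real
    assume V: "finite V" and p: "0 \<le> p" "p \<le> 1" and np: "real (card V) * p \<le> 8 / 9"
    let ?n = "card V"
    let ?M = "Pi_pmf (all_pairs V) False (\<lambda>_. bernoulli_pmf p)"
    \<comment> \<open>Chord ends are stored as positions in the list, which leaves
      \<open>l^2\<close> choices instead of \<open>n^2\<close>. Degenerate indices get the empty
      event, so that every index has probability at most \<open>p^(l + 1)\<close>.\<close>
    define ev where "ev z = (case z of (xs, i, j) \<Rightarrow> let F = lollipop_edges xs (xs ! i) (xs ! j) in
        if card F = length xs + 1 \<and> F \<subseteq> all_pairs V then {b. \<forall>e\<in>F. b e} else {})" for z :: "'a list \<times> nat \<times> nat"
    define J where "J l = {xs. set xs \<subseteq> V \<and> length xs = l} \<times> {..<l} \<times> {..<l}" for l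
    have finJ: "finite (J l)" for l using V by (simp add: J_def finite_lists_length_eq)
    have cardJ: "card (J l) = ?n ^ l * l ^ 2" for l
      using V by (simp add: J_def card_cartesian_product card_lists_length_eq power2_eq_square)
    have "{b. \<not> three_colourable V {e \<in> all_pairs V. b e}} \<subseteq> (\<Union>l\<in>{..?n}. \<Union>z\<in>J l. ev z)"
    proof
      fix b :: "'a set \<Rightarrow> bool" assume "b \<in> {b. \<not> three_colourable V {e \<in> all_pairs V. b e}}"
      then have nt: "\<not> three_colourable V {e \<in> all_pairs V. b e}" by simp
      obtain x y zs a c where *: "distinct (x # y # zs)" "set (x # y # zs) \<subseteq> V" "a \<in> set zs" "c \<in> set zs" "a \<noteq> c"
          "lollipop_edges (x # y # zs) a c \<subseteq> {e \<in> all_pairs V. b e}"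
        using not_three_colourable_lollipop[OF V _ nt] by auto
      define xs where "xs = x # y # zs"
      have "a \<in> set xs" "c \<in> set xs" using * by (auto simp: xs_def)
      then obtain i j where ij: "i < length xs" "xs ! i = a" "j < length xs" "xs ! j = c"
        by (auto simp: in_set_conv_nth)
      have "length xs \<le> ?n" using *(1,2) V unfolding xs_def by (metis card_mono distinct_card)
      moreover have "(xs, i, j) \<in> J (length xs)" using ij * by (auto simp: J_def xs_def)
      moreover have "b \<in> ev (xs, i, j)"
        using card_lollipop_edges[OF *(1,3,4,5)] *(6) ij unfolding ev_def xs_def[symmetric] by (auto simp: Let_def)
      ultimately show "b \<in> (\<Union>l\<in>{..?n}. \<Union>z\<in>J l. ev z)" by blast
    qed
    then have "measure_pmf.prob ?M {b. \<not> three_colourable V {e \<in> all_pairs V. b e}}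
        \<le> measure_pmf.prob ?M (\<Union>l\<in>{..?n}. \<Union>z\<in>J l. ev z)"
      by (intro measure_pmf.finite_measure_mono) auto
    also have "\<dots> \<le> (\<Sum>l\<in>{..?n}. measure_pmf.prob ?M (\<Union>z\<in>J l. ev z))"
      by (intro measure_pmf.finite_measure_subadditive_finite) auto
    also have "\<dots> \<le> (\<Sum>l\<in>{..?n}. \<Sum>z\<in>J l. measure_pmf.prob ?M (ev z))"
      by (intro sum_mono measure_pmf.finite_measure_subadditive_finite) (use finJ in auto)
    also have "\<dots> \<le> (\<Sum>l\<in>{..?n}. \<Sum>z\<in>J l. p ^ (l + 1))"
    proof (intro sum_mono)
      fix l z assume z: "z \<in> J l"
      obtain xs i j where zz: "z = (xs, i, j)" by (cases z)
      let ?F = "lollipop_edges xs (xs ! i) (xs ! j)"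
      have l: "length xs = l" using z zz by (simp add: J_def)
      show "measure_pmf.prob ?M (ev z) \<le> p ^ (l + 1)"
      proof (cases "card ?F = length xs + 1 \<and> ?F \<subseteq> all_pairs V")
        case True
        then have "ev z = {b. \<forall>e\<in>?F. b e}" by (simp add: ev_def zz Let_def)
        then show ?thesis using prob_all_present[of "all_pairs V" ?F p] True V p l by simp
      next
        case False
        then have "ev z = {}" by (auto simp: ev_def zz Let_def)
        then show ?thesis using p by simp
      qed
    qed
    also have "\<dots> = (\<Sum>l\<in>{..?n}. p * (real l ^ 2 * (real ?n * p) ^ l))"
      by (simp add: cardJ power_mult_distrib algebra_simps)
    also have "\<dots> \<le> (\<Sum>l\<in>{..?n}. p * (real l ^ 2 * (8 / 9) ^ l))"
      using p np by (intro sum_mono mult_left_mono power_mono) auto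
    also have "\<dots> = p * (\<Sum>l\<in>{..?n}. real l ^ 2 * (8 / 9) ^ l)"
      by (simp add: sum_distrib_left)
    also have "\<dots> \<le> p * K"
      unfolding K_def by (intro mult_left_mono sum_le_suminf[OF summ]) (use p in auto)
    finally show "measure_pmf.prob ?M {b. \<not> three_colourable V {e \<in> all_pairs V. b e}} \<le> K * p"
      by (simp add: mult.commute)
  qed
qed

section \<open>Vertex-transitive graphs\<close>

definition nbr :: "'a set set \<Rightarrow> 'a \<Rightarrow> 'a set" where
  "nbr E v = {u. {u, v} \<in> E}"

lemma nbr_sym: "u \<in> nbr E v \<longleftrightarrow> v \<in> nbr E u"
  by (simp add: nbr_def insert_commute)

lemma nbr_subset: "E \<subseteq> all_pairs V \<Longrightarrow> nbr E v \<subseteq> V"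
  using all_pairsD by (fastforce simp: nbr_def)

lemma not_in_nbr: "E \<subseteq> all_pairs V \<Longrightarrow> v \<notin> nbr E v"
  by (auto simp: nbr_def all_pairs_def)

lemma nbr_double_count:
  assumes "finite A" "finite B"
  shows "(\<Sum>a\<in>A. card (nbr E a \<inter> B)) = (\<Sum>b\<in>B. card (nbr E b \<inter> A))"
proof -
  have "(\<Sum>a\<in>A. card (nbr E a \<inter> B)) = (\<Sum>a\<in>A. \<Sum>b\<in>B. if b \<in> nbr E a then 1 else 0)"
    using assms by (simp add: sum.If_cases Int_commute)
  also have "\<dots> = (\<Sum>b\<in>B. \<Sum>a\<in>A. if a \<in> nbr E b then 1 else 0)"
    by (subst sum.swap) (simp add: nbr_sym)
  also have "\<dots> = (\<Sum>b\<in>B. card (nbr E b \<inter> A))"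
    using assms by (simp add: sum.If_cases Int_commute)
  finally show ?thesis .
qed

lemma graph_isomorphism_bij: "graph_isomorphism f G H \<Longrightarrow> bij_betw f (verts G) (verts H)"
  unfolding graph_isomorphism_def by blast

lemma graph_isomorphism_edge:
  "graph_isomorphism f G H \<Longrightarrow> u \<in> verts G \<Longrightarrow> v \<in> verts G \<Longrightarrow> {u, v} \<in> edges G \<longleftrightarrow> {f u, f v} \<in> edges H"
  unfolding graph_isomorphism_def by blast

lemma vertex_transitive_regular:
  assumes sg: "simple_graph G" and vt: "vertex_transitive G"
  shows "\<exists>d. \<forall>v\<in>verts G. card (nbr (edges G) v) = d"
proof -
  have sub: "nbr (edges G) v \<subseteq> verts G" for v
    using sg by (intro nbr_subset) (simp add: simple_graph_def)
  have le: "card (nbr (edges G) u) \<le> card (nbr (edges G) v)" if uv: "u \<in> verts G" "v \<in> verts G" for u v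
  proof -
    obtain f where f: "graph_isomorphism f G G" "f u = v" using vt uv by (auto simp: vertex_transitive_def)
    have inj: "inj_on f (verts G)" using graph_isomorphism_bij[OF f(1)] by (simp add: bij_betw_def)
    have "f ` nbr (edges G) u \<subseteq> nbr (edges G) v"
    proof
      fix y assume "y \<in> f ` nbr (edges G) u"
      then obtain x where x: "y = f x" "x \<in> nbr (edges G) u" by blast
      then have "x \<in> verts G" "{x, u} \<in> edges G" using sub by (auto simp: nbr_def)
      then show "y \<in> nbr (edges G) v"
        using graph_isomorphism_edge[OF f(1), of x u] f(2) uv(1) x(1) by (simp add: nbr_def)
    qed
    then show ?thesis
      using sub finite_subset[OF sub] sg by (intro card_inj_on_le[OF inj_on_subset[OF inj]]) (auto simp: simple_graph_def)
  qed
  show ?thesis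
  proof (cases "verts G = {}")
    case False
    then obtain u where "u \<in> verts G" by blast
    then show ?thesis using le by (intro exI[of _ "card (nbr (edges G) u)"]) (auto intro: antisym)
  qed simp
qed

lemma finite_independent_cards:
  "simple_graph G \<Longrightarrow> finite {card S |S. independent_set G S}"
  by (rule finite_subset[of _ "card ` Pow (verts G)"]) (auto simp: independent_set_def simple_graph_def)

lemma independence_number_ge:
  "simple_graph G \<Longrightarrow> independent_set G S \<Longrightarrow> card S \<le> independence_number G"
  unfolding independence_number_def by (intro Max_ge finite_independent_cards) auto

lemma independence_number_witness:
  assumes "simple_graph G"
  obtains I where "independent_set G I" "card I = independence_number G"
proof -
  have "independent_set G {}" by (simp add: independent_set_def)
  then have "independence_number G \<in> {card S |S. independent_set G S}"
    unfolding independence_number_def by (intro Max_in finite_independent_cards assms) auto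
  then show ?thesis using that by auto
qed

text \<open>A maximum independent set dominates the graph, so its closed neighbourhoods cover all
  vertices. It is used as a lower bound on the degree: a small independence number forces a large
  degree.\<close>

lemma card_le_independence_number_degree:
  assumes sg: "simple_graph G" and reg: "\<And>v. v \<in> verts G \<Longrightarrow> card (nbr (edges G) v) \<le> d"
  shows "card (verts G) \<le> independence_number G * Suc d"
proof -
  obtain I where I: "independent_set G I" "card I = independence_number G"
    using independence_number_witness[OF sg] by blast
  have IV: "I \<subseteq> verts G" using I(1) by (simp add: independent_set_def)
  have E: "edges G \<subseteq> all_pairs (verts G)" and fin: "finite (verts G)" using sg by (auto simp: simple_graph_def)
  have finI: "finite I" using IV fin finite_subset by blast
  have "verts G \<subseteq> (\<Union>v\<in>I. insert v (nbr (edges G) v))"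
  proof (rule ccontr)
    assume "\<not> ?thesis"
    then obtain x where x: "x \<in> verts G" "x \<notin> I" "\<And>v. v \<in> I \<Longrightarrow> x \<notin> nbr (edges G) v" by blast
    have "{x} \<notin> edges G" using E by (auto simp: all_pairs_def)
    then have "independent_set G (insert x I)"
      using I(1) x by (auto simp: independent_set_def nbr_def insert_commute)
    then have "card (insert x I) \<le> card I" using independence_number_ge[OF sg] I(2) by simp
    then show False using x(2) finI by simp
  qed
  moreover have finN: "finite (nbr (edges G) v)" for v using nbr_subset[OF E] fin finite_subset by blast
  ultimately have "card (verts G) \<le> card (\<Union>v\<in>I. insert v (nbr (edges G) v))"
    using finI by (intro card_mono) auto
  also have "\<dots> \<le> (\<Sum>v\<in>I. card (insert v (nbr (edges G) v)))" using finI by (rule card_UN_le)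
  also have "\<dots> \<le> (\<Sum>v\<in>I. Suc d)"
    using reg IV finN by (intro sum_mono) (metis card_insert_le_m1 card_insert_if Suc_le_mono subsetD le_SucI)
  finally show ?thesis using I(2) by simp
qed

section \<open>Averaging over automorphisms\<close>

lemma graph_isomorphism_comp:
  assumes "graph_isomorphism f G H" "graph_isomorphism g H K"
  shows "graph_isomorphism (g \<circ> f) G K"
  unfolding graph_isomorphism_def
proof (intro conjI ballI)
  show "bij_betw (g \<circ> f) (verts G) (verts K)"
    using assms by (blast intro: bij_betw_trans graph_isomorphism_bij)
  fix u v assume uv: "u \<in> verts G" "v \<in> verts G"
  then have "f u \<in> verts H" "f v \<in> verts H" using graph_isomorphism_bij[OF assms(1)] bij_betw_apply by fast+
  then show "({u, v} \<in> edges G) = ({(g \<circ> f) u, (g \<circ> f) v} \<in> edges K)"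
    using graph_isomorphism_edge[OF assms(1) uv] graph_isomorphism_edge[OF assms(2)] by simp
qed

lemma graph_isomorphism_restrict:
  assumes "graph_isomorphism f G H"
  shows "graph_isomorphism (restrict f (verts G)) G H"
  using assms by (auto simp: graph_isomorphism_def cong: bij_betw_cong)

lemma independent_image:
  assumes "graph_isomorphism f G G" "independent_set G I"
  shows "independent_set G (f ` I)"
proof -
  have I: "I \<subseteq> verts G" "\<And>u v. u \<in> I \<Longrightarrow> v \<in> I \<Longrightarrow> {u, v} \<notin> edges G"
    using assms(2) by (auto simp: independent_set_def)
  have "{f u, f v} \<notin> edges G" if "u \<in> I" "v \<in> I" for u v
    using assms(1) that I unfolding graph_isomorphism_def by blast
  moreover have "f ` I \<subseteq> verts G"
    using assms(1) I(1) unfolding graph_isomorphism_def bij_betw_def by blast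
  ultimately show ?thesis unfolding independent_set_def by blast
qed

text \<open>Average the size of the intersection of \<open>S\<close> with the image of a maximum
  independent set \<open>I\<close> under a random automorphism. By transitivity the number
  \<open>N w s\<close> of automorphisms taking \<open>w\<close> to \<open>s\<close> is the same for
  all pairs, so the mean is \<open>card S * card I / card (verts G)\<close>, and some image reaches
  the mean.\<close>

lemma vertex_transitive_dense_independent:
  assumes sg: "simple_graph G" and vt: "vertex_transitive G" and S: "S \<subseteq> verts G"
  shows "\<exists>J. independent_set G J \<and> card S * independence_number G \<le> card (verts G) * card (S \<inter> J)"
proof (cases "verts G = {}")
  case True
  then show ?thesis using S by (intro exI[of _ "{}"]) (simp add: independent_set_def)
next
  case False
  let ?V = "verts G"
  obtain I where I: "independent_set G I" "card I = independence_number G"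
    using independence_number_witness[OF sg] by blast
  have IV: "I \<subseteq> ?V" using I(1) by (simp add: independent_set_def)
  have fin: "finite ?V" using sg by (simp add: simple_graph_def)
  have finS: "finite S" "finite I" using S IV fin finite_subset by auto
  \<comment> \<open>Automorphisms are taken extensional on \<open>?V\<close>, which makes their set
    finite and lets equality be checked on vertices.\<close>
  define A where "A = {f \<in> ?V \<rightarrow>\<^sub>E ?V. graph_isomorphism f G G}"
  have finA: "finite A" using fin by (simp add: A_def finite_PiE)
  have A_bij: "bij_betw f ?V ?V" if "f \<in> A" for f using that graph_isomorphism_bij[of f G G] by (simp add: A_def)
  define N where "N w s = card {f \<in> A. f w = s}" for w s
  have N_le: "N w s \<le> N w' s'" if mem: "w \<in> ?V" "s \<in> ?V" "w' \<in> ?V" "s' \<in> ?V" for w s w' s'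
  proof -
    obtain g where g: "graph_isomorphism g G G" "g w' = w"
      using vt mem(1,3) unfolding vertex_transitive_def by blast
    obtain h where h: "graph_isomorphism h G G" "h s = s'"
      using vt mem(2,4) unfolding vertex_transitive_def by blast
    \<comment> \<open>Composing with automorphisms that take \<open>w'\<close> to \<open>w\<close>
      and \<open>s\<close> to \<open>s'\<close> maps the automorphisms with \<open>f w = s\<close>
      injectively into those taking \<open>w'\<close> to \<open>s'\<close>; by symmetry all the
      counts agree.\<close>
    define T where "T f = restrict (h \<circ> (f \<circ> g)) ?V" for f :: "'a \<Rightarrow> 'a"
    have gb: "bij_betw g ?V ?V" and hb: "bij_betw h ?V ?V" by (rule graph_isomorphism_bij[OF g(1)], rule graph_isomorphism_bij[OF h(1)])
    have "T f \<in> A" if "f \<in> A" for f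
    proof -
      have f: "graph_isomorphism f G G" using that by (simp add: A_def)
      have "graph_isomorphism (T f) G G" unfolding T_def
        by (rule graph_isomorphism_restrict[OF graph_isomorphism_comp[OF graph_isomorphism_comp[OF g(1) f] h(1)]])
      moreover from graph_isomorphism_bij[OF this] have "T f ` ?V = ?V" by (simp add: bij_betw_def)
      moreover have "T f \<in> extensional ?V" by (simp add: T_def)
      ultimately show ?thesis unfolding A_def PiE_def by blast
    qed
    moreover have "T f w' = s'" if "f w = s" for f
      using g(2) h(2) that \<open>w' \<in> ?V\<close> by (simp add: T_def)
    ultimately have "T ` {f \<in> A. f w = s} \<subseteq> {f \<in> A. f w' = s'}" by blast
    moreover have "inj_on T {f \<in> A. f w = s}"
    proof (rule inj_onI)
      fix f f' assume f: "f \<in> {f \<in> A. f w = s}" "f' \<in> {f \<in> A. f w = s}" and eq: "T f = T f'"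
      show "f = f'"
      proof
        fix x
        show "f x = f' x"
        proof (cases "x \<in> ?V")
          case True
          then obtain y where y: "y \<in> ?V" "g y = x" using gb by (metis bij_betw_iff_bijections)
          have "h (f x) = h (f' x)" using fun_cong[OF eq, of y] y by (simp add: T_def)
          moreover have "f x \<in> ?V" "f' x \<in> ?V" using f True by (auto simp: A_def)
          ultimately show ?thesis using hb by (auto simp: bij_betw_def inj_on_def)
        next
          case False
          then show ?thesis using f by (auto simp: A_def PiE_def extensional_def)
        qed
      qed
    qed
    ultimately show ?thesis unfolding N_def by (intro card_inj_on_le[of T]) (use finA in auto)
  qed
  obtain u where u: "u \<in> ?V" using False by blast
  define c where "c = N u u"
  have N_eq: "N w s = c" if "w \<in> ?V" "s \<in> ?V" for w s
    unfolding c_def using N_le that u by (auto intro: antisym)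
  have idiso: "graph_isomorphism (restrict id ?V) G G"
    by (rule graph_isomorphism_restrict) (simp add: graph_isomorphism_def)
  then have "restrict id ?V \<in> {f \<in> A. f u = u}" using u by (auto simp: A_def)
  then have cpos: "c > 0" unfolding c_def N_def using finA by (auto simp: card_gt_0_iff)
  have cardA: "card A = card ?V * c"
  proof -
    have "card A = card (\<Union>s\<in>?V. {f \<in> A. f u = s})"
      by (rule arg_cong[where f = card]) (use u A_bij bij_betw_apply in fastforce)
    also have "\<dots> = (\<Sum>s\<in>?V. N u s)"
      unfolding N_def using fin finA by (intro card_UN_disjoint) auto
    also have "\<dots> = card ?V * c" using N_eq u by simp
    finally show ?thesis .
  qed
  have cardI: "card (S \<inter> f ` I) = (\<Sum>w\<in>I. \<Sum>s\<in>S. if f w = s then 1 else 0)" if "f \<in> A" for f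
  proof -
    have "inj_on f I" using A_bij[OF that] IV by (meson bij_betw_def inj_on_subset)
    have "card (S \<inter> f ` I) = card (f ` {w \<in> I. f w \<in> S})" by (rule arg_cong[where f = card]) auto
    also have "\<dots> = card {w \<in> I. f w \<in> S}"
      using \<open>inj_on f I\<close> by (intro card_image) (auto simp: inj_on_def)
    also have "\<dots> = (\<Sum>w\<in>I. if f w \<in> S then 1 else 0)"
      using finS by (simp add: sum.If_cases Int_def)
    also have "\<dots> = (\<Sum>w\<in>I. \<Sum>s\<in>S. if f w = s then 1 else 0)"
      using finS by (intro sum.cong refl) simp
    finally show ?thesis .
  qed
  have "(\<Sum>f\<in>A. card (S \<inter> f ` I)) = (\<Sum>f\<in>A. \<Sum>w\<in>I. \<Sum>s\<in>S. if f w = s then 1 else 0)"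
    using cardI by simp
  also have "\<dots> = (\<Sum>w\<in>I. \<Sum>f\<in>A. \<Sum>s\<in>S. if f w = s then 1 else 0)" by (rule sum.swap)
  also have "\<dots> = (\<Sum>w\<in>I. \<Sum>s\<in>S. \<Sum>f\<in>A. if f w = s then 1 else 0)"
    by (intro sum.cong refl) (rule sum.swap)
  also have "\<dots> = (\<Sum>w\<in>I. \<Sum>s\<in>S. N w s)"
    unfolding N_def using finA by (simp add: sum.If_cases Int_def)
  also have "\<dots> = (\<Sum>w\<in>I. \<Sum>s\<in>S. c)"
    using N_eq IV S by (intro sum.cong refl) auto
  also have "\<dots> = card I * card S * c" by simp
  finally have total: "(\<Sum>f\<in>A. card (S \<inter> f ` I)) = card I * card S * c" .
  have "\<exists>f\<in>A. card S * card I \<le> card ?V * card (S \<inter> f ` I)"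
  proof (rule ccontr)
    assume "\<not> ?thesis"
    then have lt: "card ?V * card (S \<inter> f ` I) < card S * card I" if "f \<in> A" for f using that by auto
    have "A \<noteq> {}" using cardA cpos fin False by (metis card.empty card_0_eq mult_is_0 neq0_conv)
    then have "(\<Sum>f\<in>A. card ?V * card (S \<inter> f ` I)) < (\<Sum>f\<in>A. card S * card I)"
      using finA lt by (intro sum_strict_mono) auto
    then have "card ?V * (card I * card S * c) < card A * (card S * card I)"
      using total by (simp add: sum_distrib_left[symmetric])
    then show False using cardA by (simp add: mult_ac)
  qed
  then obtain f where f: "f \<in> A" "card S * card I \<le> card ?V * card (S \<inter> f ` I)" by blast
  have "independent_set G (f ` I)" using f(1) I(1) by (auto simp: A_def intro: independent_image)
  then show ?thesis using f(2) I(2) by auto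
qed

text \<open>Greedy covering: each new colour class is independent and contains at least the fraction
  \<alpha> / n of the uncoloured vertices, so at most n (1 - \<alpha> / n)^q vertices are left after
  q colours.\<close>

lemma vertex_transitive_colouring:
  assumes sg: "simple_graph G" and vt: "vertex_transitive G" and n: "0 < card (verts G)"
  shows "\<exists>q c. proper_colouring G q c \<and>
    real q \<le> card (verts G) / independence_number G * ln (card (verts G)) + 1"
proof -
  let ?V = "verts G" and ?n = "real (card (verts G))" and ?a = "real (independence_number G)"
  have fin: "finite ?V" using sg by (simp add: simple_graph_def)
  obtain v where v: "v \<in> ?V" using n by (auto simp: card_gt_0_iff)
  have "{v} \<notin> edges G" using sg by (auto simp: simple_graph_def all_pairs_def)
  then have "independent_set G {v}" using v by (simp add: independent_set_def)
  from independence_number_ge[OF sg this] have a: "?a \<ge> 1" by simp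
  have an: "?a \<le> ?n"
  proof -
    obtain I where "independent_set G I" "card I = independence_number G"
      using independence_number_witness[OF sg] by blast
    then show ?thesis using fin card_mono[of ?V I] by (auto simp: independent_set_def)
  qed
  have greedy: "\<exists>c U. U \<subseteq> ?V \<and> real (card U) \<le> ?n * (1 - ?a / ?n) ^ q \<and> (\<forall>v\<in>?V - U. c v < q) \<and>
      (\<forall>u\<in>?V - U. \<forall>v\<in>?V - U. {u, v} \<in> edges G \<longrightarrow> c u \<noteq> (c v :: nat))" for q
  proof (induction q)
    case 0
    show ?case by (rule exI[of _ "\<lambda>_. 0"], rule exI[of _ ?V]) simp
  next
    case (Suc q)
    then obtain c U where U: "U \<subseteq> ?V" "real (card U) \<le> ?n * (1 - ?a / ?n) ^ q" "\<forall>v\<in>?V - U. c v < q"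
      "\<forall>u\<in>?V - U. \<forall>v\<in>?V - U. {u, v} \<in> edges G \<longrightarrow> c u \<noteq> (c v :: nat)" by blast
    obtain J where J: "independent_set G J" "card U * independence_number G \<le> card ?V * card (U \<inter> J)"
      using vertex_transitive_dense_independent[OF sg vt U(1)] by blast
    have finU: "finite U" using U(1) fin finite_subset by blast
    \<comment> \<open>On \<open>U - J\<close> the new colour is only a placeholder, since these
      vertices still count as uncoloured.\<close>
    let ?c = "\<lambda>v. if v \<in> U then q else c v"
    have "real (card U) * ?a \<le> ?n * real (card (U \<inter> J))"
      using J(2) by (metis of_nat_le_iff of_nat_mult)
    then have "real (card (U \<inter> J)) \<ge> real (card U) * (?a / ?n)"
      using n by (simp add: field_simps)
    moreover have "real (card (U - J)) = real (card U) - real (card (U \<inter> J))"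
      using card_Diff_subset_Int[of U J] finU card_mono[of U "U \<inter> J"] by (simp add: of_nat_diff)
    ultimately have "real (card (U - J)) \<le> real (card U) * (1 - ?a / ?n)"
      by (simp add: algebra_simps)
    also have "\<dots> \<le> ?n * (1 - ?a / ?n) ^ q * (1 - ?a / ?n)"
      using U(2) an n by (intro mult_right_mono) (auto simp: field_simps)
    finally have "real (card (U - J)) \<le> ?n * (1 - ?a / ?n) ^ Suc q" by (simp add: mult_ac)
    moreover have "\<forall>v\<in>?V - (U - J). ?c v < Suc q" using U(3) by (auto intro: less_SucI)
    moreover have "?c u \<noteq> ?c w" if uw: "u \<in> ?V - (U - J)" "w \<in> ?V - (U - J)" "{u, w} \<in> edges G" for u w
    proof -
      have "\<not> (u \<in> J \<and> w \<in> J)" using J(1) uw(3) by (auto simp: independent_set_def)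
      moreover have "c x < q" if "x \<notin> U" "x \<in> ?V" for x using U(3) that by blast
      moreover have "c u \<noteq> c w" if "u \<notin> U" "w \<notin> U" using U(4) uw that by blast
      ultimately show ?thesis using uw(1,2) by (metis DiffD1 DiffD2 DiffI less_irrefl)
    qed
    moreover have "U - J \<subseteq> ?V" using U(1) by blast
    ultimately show ?case by (intro exI[of _ ?c] exI[of _ "U - J"]) blast
  qed
  \<comment> \<open>The least integer strictly above (n / \<alpha>) ln n. Strictness brings the
    number of uncoloured vertices below 1, hence to 0.\<close>
  define q where "q = nat \<lfloor>?n / ?a * ln ?n\<rfloor> + 1"
  have pos: "?n / ?a * ln ?n \<ge> 0" using n a by simp
  have q1: "real q \<le> ?n / ?a * ln ?n + 1" and q2: "real q > ?n / ?a * ln ?n"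
    unfolding q_def using pos by linarith+
  obtain c U where U: "U \<subseteq> ?V" "real (card U) \<le> ?n * (1 - ?a / ?n) ^ q" "\<forall>v\<in>?V - U. c v < q"
      "\<forall>u\<in>?V - U. \<forall>v\<in>?V - U. {u, v} \<in> edges G \<longrightarrow> c u \<noteq> (c v :: nat)"
    using greedy[of q] by (elim exE conjE)
  have "(1 - ?a / ?n) ^ q \<le> exp (- (?a / ?n)) ^ q"
    using an n exp_ge_add_one_self[of "- (?a / ?n)"] by (intro power_mono) (linarith, simp add: divide_le_eq)
  also have "\<dots> = exp (- (real q * (?a / ?n)))" by (simp add: exp_of_nat_mult[symmetric])
  also have "\<dots> < exp (- ln ?n)"
    using q2 n a by (simp add: field_simps)
  also have "\<dots> = 1 / ?n" using n by (simp add: exp_minus inverse_eq_divide)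
  finally have "?n * (1 - ?a / ?n) ^ q < 1" using n by (simp add: field_simps)
  then have "card U = 0" using U(2) by linarith
  then have "U = {}" using finite_subset[OF U(1) fin] by simp
  then have "proper_colouring G q c" using U by (simp add: proper_colouring_def)
  then show ?thesis using q1 by blast
qed

section \<open>Stars and their extensions\<close>

lemma cut_connected_attach:
  assumes "finite Y" "cut_connected E A" "\<And>y. y \<in> Y \<Longrightarrow> \<exists>a\<in>A. {a, y} \<in> E"
  shows "cut_connected E (A \<union> Y)"
  using assms(1,3)
proof (induction Y)
  case (insert y Y)
  then obtain a where "a \<in> A" "{a, y} \<in> E" by blast
  then have "cut_connected E ((A \<union> Y) \<union> {y})"
    using insert by (intro cut_connected_Un[OF _ cut_connected_singleton, of E "A \<union> Y" a y]) auto
  then show ?case by simp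
qed (simp add: assms(2))

text \<open>Take as many disjoint stars as possible: an uncovered vertex with enough uncovered
  neighbours would be the centre of another one. Cores are rows of an injective array rather than
  sets, so that position \<open>j\<close> of one core can later be matched with position
  \<open>j\<close> of another.\<close>

lemma max_packing:
  assumes V: "finite V" and E: "E \<subseteq> all_pairs V" and m: "1 \<le> m"
  shows "\<exists>(N::nat) c. inj_on (\<lambda>(i, j). c i j) ({..<N} \<times> {..<m}) \<and> (\<forall>i<N. c i ` {..<m} \<subseteq> V) \<and>
    (\<forall>i<N. cut_connected E (c i ` {..<m})) \<and>
    (\<forall>v\<in>V - (\<Union>i<N. c i ` {..<m}). card (nbr E v - (\<Union>i<N. c i ` {..<m})) < m)"
proof -
  define P where "P N \<longleftrightarrow> (\<exists>c. inj_on (\<lambda>(i, j). c i j) ({..<N} \<times> {..<m}) \<and> (\<forall>i<N. c i ` {..<m} \<subseteq> V) \<and>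
    (\<forall>i<N. cut_connected E (c i ` {..<m})))" for N :: nat
  have "P 0" by (simp add: P_def)
  moreover have "\<forall>N. P N \<longrightarrow> N \<le> card V"
  proof (intro allI impI)
    fix N assume "P N"
    then obtain c where c: "inj_on (\<lambda>(i, j). c i j) ({..<N} \<times> {..<m})" "\<forall>i<N. c i ` {..<m} \<subseteq> V" by (auto simp: P_def)
    have "(\<lambda>(i, j). c i j) ` ({..<N} \<times> {..<m}) \<subseteq> V" using c(2) by auto
    then have "card ({..<N} \<times> {..<m}) \<le> card V" by (rule card_inj_on_le[OF c(1) _ V])
    then have "N * m \<le> card V" by (simp add: card_cartesian_product)
    moreover have "N * 1 \<le> N * m" using m by (intro mult_le_mono2)
    ultimately show "N \<le> card V" by linarith
  qed
  ultimately obtain N where N: "P N" "\<And>N'. P N' \<Longrightarrow> N' \<le> N"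
    using Nat.ex_has_greatest_nat[of P 0 "card V"] by blast
  then obtain c where c: "inj_on (\<lambda>(i, j). c i j) ({..<N} \<times> {..<m})" "\<forall>i<N. c i ` {..<m} \<subseteq> V"
    "\<forall>i<N. cut_connected E (c i ` {..<m})" unfolding P_def by blast
  let ?U = "\<Union>i<N. c i ` {..<m}"
  have "card (nbr E v - ?U) < m" if v: "v \<in> V - ?U" for v
  proof (rule ccontr)
    assume "\<not> ?thesis"
    then have "m - 1 \<le> card (nbr E v - ?U)" by simp
    then obtain T where T: "T \<subseteq> nbr E v - ?U" "card T = m - 1" "finite T" by (rule obtain_subset_with_card_n)
    have vT: "v \<notin> T" using T(1) not_in_nbr[OF E] by blast
    then have cvT: "card (insert v T) = m" using T m by simp
    then obtain h where h: "bij_betw h {0..<m} (insert v T)"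
      using ex_bij_betw_nat_finite[of "insert v T"] T(3) by auto
    then have him: "h ` {..<m} = insert v T" and hinj: "inj_on h {..<m}"
      by (auto simp: bij_betw_def atLeast0LessThan)
    have sub: "insert v T \<subseteq> V - ?U" using T(1) v nbr_subset[OF E] by blast
    have "cut_connected E ({v} \<union> T)"
      by (rule cut_connected_attach[OF T(3) cut_connected_singleton]) (use T(1) in \<open>auto simp: nbr_def insert_commute\<close>)
    then have cc: "cut_connected E (h ` {..<m})" using him by simp
    let ?c = "c(N := h)"
    have "inj_on (\<lambda>(i, j). ?c i j) ({..<Suc N} \<times> {..<m})"
    proof (rule inj_onI)
      fix x y assume "x \<in> {..<Suc N} \<times> {..<m}" "y \<in> {..<Suc N} \<times> {..<m}"
        "(case x of (i, j) \<Rightarrow> ?c i j) = (case y of (i, j) \<Rightarrow> ?c i j)"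
      then obtain i j i' j' where xy: "x = (i, j)" "y = (i', j')"
        and *: "i \<in> {..<Suc N}" "i' \<in> {..<Suc N}" "j \<in> {..<m}" "j' \<in> {..<m}" "?c i j = ?c i' j'"
        by (cases x, cases y) auto
      have hU: "h l \<notin> ?U" if "l < m" for l using him sub that by blast
      consider "i < N" "i' < N" | "i = N" "i' = N" | "i = N" "i' < N" | "i < N" "i' = N"
        using * by (auto simp: less_Suc_eq)
      then have "i = i' \<and> j = j'"
      proof cases
        case 1 then show ?thesis using inj_onD[OF c(1), of "(i, j)" "(i', j')"] * by simp
      next
        case 2 then show ?thesis using inj_onD[OF hinj, of j j'] * by simp
      next
        case 3 then show ?thesis using hU[of j] * by auto
      next
        case 4
        then have "c i j = h j'" using * by simp
        then have "h j' \<in> ?U" using 4 * by (metis UN_I imageI lessThan_iff)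
        then show ?thesis using hU[of j'] * by simp
      qed
      then show "x = y" using xy by simp
    qed
    moreover have "\<forall>i<Suc N. ?c i ` {..<m} \<subseteq> V" using c(2) him sub by (auto simp: less_Suc_eq)
    moreover have "\<forall>i<Suc N. cut_connected E (?c i ` {..<m})" using c(3) cc by (auto simp: less_Suc_eq)
    ultimately have "P (Suc N)" unfolding P_def by blast
    then show False using N(2)[of "Suc N"] by simp
  qed
  then show ?thesis using c by blast
qed

text \<open>Choose a family with the largest union: an omitted \<open>w\<close> could be added to
  any related \<open>X i\<close> that has room. It serves to hang uncovered vertices on adjacent
  cores, at most \<open>m\<close> on each.\<close>

lemma max_extension:
  assumes W: "finite W"
  obtains X where "\<And>i. i < (N::nat) \<Longrightarrow> X i \<subseteq> W \<and> card (X i) \<le> m"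
    "\<And>i j. i < N \<Longrightarrow> j < N \<Longrightarrow> i \<noteq> j \<Longrightarrow> X i \<inter> X j = {}"
    "\<And>i x. i < N \<Longrightarrow> x \<in> X i \<Longrightarrow> R x i"
    "\<And>w i. w \<in> W - (\<Union>i<N. X i) \<Longrightarrow> i < N \<Longrightarrow> R w i \<Longrightarrow> card (X i) = (m :: nat)"
proof -
  define Q where "Q X \<longleftrightarrow> (\<forall>i<N. X i \<subseteq> W \<and> card (X i) \<le> m) \<and>
    (\<forall>i<N. \<forall>j<N. i \<noteq> j \<longrightarrow> X i \<inter> X j = {}) \<and> (\<forall>i<N. \<forall>x\<in>X i. R x i)" for X
  have "Q (\<lambda>_. {})" by (simp add: Q_def)
  moreover have "\<forall>X. Q X \<longrightarrow> card (\<Union>i<N. X i) < Suc (card W)"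
  proof (intro allI impI)
    fix X assume "Q X"
    then have "(\<Union>i<N. X i) \<subseteq> W" by (auto simp: Q_def)
    then show "card (\<Union>i<N. X i) < Suc (card W)" using card_mono[OF W] by (simp add: less_Suc_eq_le)
  qed
  ultimately obtain X where X: "Q X" and max: "\<And>Y. Q Y \<Longrightarrow> card (\<Union>i<N. Y i) \<le> card (\<Union>i<N. X i)"
    using ex_has_greatest_nat[of Q "\<lambda>_. {}" "\<lambda>X. card (\<Union>i<N. X i)" "Suc (card W)"] by blast
  have "card (X i) = m" if w: "w \<in> W - (\<Union>i<N. X i)" and i: "i < N" "R w i" for w i
  proof (rule ccontr)
    assume ne: "card (X i) \<noteq> m"
    let ?Y = "X(i := insert w (X i))"
    have XW: "(\<Union>i<N. X i) \<subseteq> W" using X by (auto simp: Q_def)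
    have "card (insert w (X i)) \<le> m"
      using ne X i(1) finite_subset[OF _ W, of "X i"] by (auto simp: Q_def card_insert_if)
    then have "Q ?Y" using X w i by (auto simp: Q_def)
    moreover have "(\<Union>j<N. ?Y j) = insert w (\<Union>j<N. X j)" using i(1) by (auto split: if_splits)
    moreover have "card (insert w (\<Union>j<N. X j)) = Suc (card (\<Union>j<N. X j))"
      using w finite_subset[OF XW W] by simp
    ultimately show False using max[of ?Y] by simp
  qed
  then show ?thesis using X by (intro that[of X]) (auto simp: Q_def)
qed

text \<open>Joining segments through \<open>G\<close> needs a large set \<open>\<Gamma>\<close> of
  vertices that lie in the pieces and have many neighbours in the cores. Core vertices alone may
  fail this, because most of their neighbours may be uncovered; therefore the pieces
  \<open>Q i\<close> may enlarge the cores by uncovered vertices. Which kind of vertex forms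
  \<open>\<Gamma>\<close> depends on how many vertices are uncovered.\<close>

lemma piece_structure:
  assumes V: "finite V" and E: "E \<subseteq> all_pairs V" and reg: "\<And>v. v \<in> V \<Longrightarrow> card (nbr E v) = d"
    and m: "1 \<le> m" "3 * m \<le> d"
  obtains N c Q \<Gamma> where
    "inj_on (\<lambda>(i, j). c i j) ({..<N} \<times> {..<m})" "2 * card V \<le> 5 * (N * m)" "N * m \<le> card V"
    "\<And>i. i < N \<Longrightarrow> c i ` {..<m} \<subseteq> Q i \<and> Q i \<subseteq> V \<and> card (Q i) \<le> 2 * m \<and> cut_connected E (Q i)"
    "\<And>i j. i < N \<Longrightarrow> j < N \<Longrightarrow> i \<noteq> j \<Longrightarrow> Q i \<inter> Q j = {}"
    "\<Gamma> \<subseteq> (\<Union>i<N. Q i)" "card V \<le> 25 * card \<Gamma>"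
    "\<And>v. v \<in> \<Gamma> \<Longrightarrow> d \<le> 2 * card (nbr E v \<inter> (\<Union>i<N. c i ` {..<m}))"
proof -
  obtain N :: nat and c where c: "inj_on (\<lambda>(i, j). c i j) ({..<N} \<times> {..<m})" "\<And>i. i < N \<Longrightarrow> c i ` {..<m} \<subseteq> V"
    "\<And>i. i < N \<Longrightarrow> cut_connected E (c i ` {..<m})"
    "\<And>v. v \<in> V - (\<Union>i<N. c i ` {..<m}) \<Longrightarrow> card (nbr E v - (\<Union>i<N. c i ` {..<m})) < m"
    using max_packing[OF V E m(1)] by blast
  define U where "U = (\<Union>i<N. c i ` {..<m})"
  define W where "W = V - U"
  have UV: "U \<subseteq> V" using c(2) by (auto simp: U_def)
  have fin: "finite U" "finite W" using UV V finite_subset by (auto simp: W_def)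
  have finN: "finite (nbr E v)" for v using nbr_subset[OF E] V finite_subset by blast
  have cdisj: "c i ` {..<m} \<inter> c j ` {..<m} = {}" if "i < N" "j < N" "i \<noteq> j" for i j
    using inj_onD[OF c(1), of "(i, _)" "(j, _)"] that by fastforce
  have ccard: "card (c i ` {..<m}) = m" if "i < N" for i
  proof -
    have "inj_on (c i) {..<m}" using inj_onD[OF c(1), of "(i, _)" "(i, _)"] that by (intro inj_onI) force
    then show ?thesis by (simp add: card_image)
  qed
  have cardUF: "card (\<Union>i\<in>F. c i ` {..<m}) = card F * m" if "F \<subseteq> {..<N}" for F
  proof -
    have "card (\<Union>i\<in>F. c i ` {..<m}) = (\<Sum>i\<in>F. card (c i ` {..<m}))"
      using that cdisj finite_subset[OF that] by (intro card_UN_disjoint) (auto simp: subset_iff)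
    also have "\<dots> = (\<Sum>i\<in>F. m)" using that ccard by (intro sum.cong) auto
    finally show ?thesis by simp
  qed
  have cardU: "card U = N * m" using cardUF[of "{..<N}"] by (simp add: U_def)
  have cardV: "card V = card U + card W"
    using V UV fin by (metis W_def add.commute card_Diff_subset card_mono le_add_diff_inverse2)
  \<comment> \<open>By maximality of the packing an uncovered vertex has fewer than
    \<open>m <= d / 3\<close> uncovered neighbours. Counting the edges between \<open>W\<close> and
    \<open>U\<close> from both sides then gives \<open>2 * card W <= 3 * card U\<close>, the origin
    of the factor 5 / 2.\<close>
  have Wdeg: "2 * d \<le> 3 * card (nbr E w \<inter> U)" if w: "w \<in> W" for w
  proof -
    have "card (nbr E w) = card (nbr E w \<inter> U) + card (nbr E w - U)"
      using card_Int_Diff[OF finN[of w]] by simp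
    moreover have "card (nbr E w - U) < m" using c(4)[of w] w by (simp add: W_def U_def)
    ultimately show ?thesis using reg[of w] w m(2) by (simp add: W_def)
  qed
  have degle: "card (nbr E v \<inter> A) \<le> d" if "v \<in> V" for v A
    using reg[OF that] finN[of v] card_mono[of "nbr E v" "nbr E v \<inter> A"] by auto
  have dpos: "0 < d" using m by linarith
  have "2 * d * card W \<le> (\<Sum>w\<in>W. 3 * card (nbr E w \<inter> U))"
    using sum_mono[of W "\<lambda>_. 2 * d" "\<lambda>w. 3 * card (nbr E w \<inter> U)"] Wdeg by (simp add: mult.commute)
  also have "\<dots> = 3 * (\<Sum>u\<in>U. card (nbr E u \<inter> W))"
    by (subst sum_distrib_left[symmetric], subst nbr_double_count[OF fin(2,1)]) simp
  also have "\<dots> \<le> 3 * (\<Sum>u\<in>U. d)" using degle UV by (intro mult_le_mono2 sum_mono) auto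
  finally have "d * (2 * card W) \<le> d * (3 * card U)" by (simp add: mult_ac)
  then have "2 * card W \<le> 3 * card U" using dpos by simp
  then have N1: "2 * card V \<le> 5 * (N * m)" using cardV cardU by linarith
  have N2: "N * m \<le> card V" using cardV cardU by linarith
  show ?thesis
  proof (cases "10 * card W < card V")
    case True
    \<comment> \<open>Few uncovered vertices: each core vertex outside \<open>\<Gamma>\<close> has
      at least \<open>d / 2\<close> neighbours in \<open>W\<close>, so there are at most
      \<open>2 * card W\<close> of them, and \<open>\<Gamma>\<close> keeps more than 7 / 10 of all
      vertices.\<close>
    define \<Gamma> where "\<Gamma> = {u \<in> U. d \<le> 2 * card (nbr E u \<inter> U)}"
    have "d * card (U - \<Gamma>) \<le> (\<Sum>u\<in>U - \<Gamma>. 2 * card (nbr E u \<inter> W))"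
    proof -
      have "d \<le> 2 * card (nbr E u \<inter> W)" if u: "u \<in> U - \<Gamma>" for u
      proof -
        have uV: "u \<in> V" using u UV by blast
        have "nbr E u - U = nbr E u \<inter> W" using nbr_subset[OF E] by (auto simp: W_def)
        then have "card (nbr E u) = card (nbr E u \<inter> U) + card (nbr E u \<inter> W)"
          using card_Int_Diff[OF finN[of u], of U] by simp
        then show ?thesis using reg[OF uV] u by (auto simp: \<Gamma>_def)
      qed
      then show ?thesis using sum_mono[of "U - \<Gamma>" "\<lambda>_. d" "\<lambda>u. 2 * card (nbr E u \<inter> W)"] by (simp add: mult.commute)
    qed
    also have "\<dots> = 2 * (\<Sum>w\<in>W. card (nbr E w \<inter> (U - \<Gamma>)))"
      using fin by (subst sum_distrib_left[symmetric], subst nbr_double_count) auto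
    also have "\<dots> \<le> 2 * (\<Sum>w\<in>W. d)" using degle by (intro mult_le_mono2 sum_mono) (auto simp: W_def)
    finally have "d * card (U - \<Gamma>) \<le> d * (2 * card W)" by (simp add: mult_ac)
    then have "card (U - \<Gamma>) \<le> 2 * card W" using dpos by simp
    moreover have "card U = card \<Gamma> + card (U - \<Gamma>)"
      using fin(1) card_Int_Diff[OF fin(1), of \<Gamma>] by (simp add: \<Gamma>_def Int_def)
    ultimately have G: "card V \<le> 25 * card \<Gamma>" using True cardV by linarith
    show ?thesis
      by (rule that[of c N "\<lambda>i. c i ` {..<m}" \<Gamma>])
        (use c N1 N2 G cdisj ccard in \<open>auto simp: \<Gamma>_def U_def\<close>)
  next
    case False
    show ?thesis
    proof (rule max_extension[OF fin(2), of N m "\<lambda>x i. \<exists>u\<in>c i ` {..<m}. {u, x} \<in> E"])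
      fix X assume X: "\<And>i. i < N \<Longrightarrow> X i \<subseteq> W \<and> card (X i) \<le> m" "\<And>i j. i < N \<Longrightarrow> j < N \<Longrightarrow> i \<noteq> j \<Longrightarrow> X i \<inter> X j = {}"
        "\<And>i x. i < N \<Longrightarrow> x \<in> X i \<Longrightarrow> \<exists>u\<in>c i ` {..<m}. {u, x} \<in> E"
        "\<And>w i. w \<in> W - (\<Union>i<N. X i) \<Longrightarrow> i < N \<Longrightarrow> \<exists>u\<in>c i ` {..<m}. {u, w} \<in> E \<Longrightarrow> card (X i) = m"
      \<comment> \<open>Many uncovered vertices: \<open>\<Gamma>\<close> consists of the attached
        ones. The core neighbours of an unattached vertex lie in full cores, and these have at most
        \<open>card \<Gamma>\<close> vertices together, so double counting gives
        \<open>2 * card (W - \<Gamma>) <= 3 * card \<Gamma>\<close>. With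
        \<open>card V <= 10 * card W\<close> this yields the constant 25.\<close>
      define \<Gamma> where "\<Gamma> = (\<Union>i<N. X i)"
      define F where "F = {i. i < N \<and> card (X i) = m}"
      define UF where "UF = (\<Union>i\<in>F. c i ` {..<m})"
      have \<Gamma>W: "\<Gamma> \<subseteq> W" using X(1) by (auto simp: \<Gamma>_def)
      have finX: "finite (X i)" if "i < N" for i using X(1)[OF that] fin(2) finite_subset by blast
      have UFU: "UF \<subseteq> U" by (auto simp: UF_def U_def F_def)
      have finUF: "finite UF" using UFU fin(1) finite_subset by blast
      have cF: "card UF \<le> card \<Gamma>"
      proof -
        have "card UF = card F * m" unfolding UF_def by (rule cardUF) (auto simp: F_def)
        also have "\<dots> = (\<Sum>i\<in>F. card (X i))" by (simp add: F_def)
        also have "\<dots> = card (\<Union>i\<in>F. X i)"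
          using X(2) finX by (intro card_UN_disjoint[symmetric]) (auto simp: F_def)
        also have "\<dots> \<le> card \<Gamma>" using finite_subset[OF \<Gamma>W fin(2)] by (intro card_mono) (auto simp: \<Gamma>_def F_def)
        finally show ?thesis .
      qed
      have "2 * d \<le> 3 * card (nbr E w \<inter> UF)" if w: "w \<in> W - \<Gamma>" for w
      proof -
        have "nbr E w \<inter> U \<subseteq> UF"
        proof
          fix u assume u: "u \<in> nbr E w \<inter> U"
          then obtain i where i: "i < N" "u \<in> c i ` {..<m}" by (auto simp: U_def)
          have "card (X i) = m" using X(4)[of w i] w i u by (auto simp: \<Gamma>_def nbr_def)
          then show "u \<in> UF" using i by (auto simp: UF_def F_def)
        qed
        then have "nbr E w \<inter> U = nbr E w \<inter> UF" using UFU by blast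
        then show ?thesis using Wdeg[of w] w by simp
      qed
      then have "2 * d * card (W - \<Gamma>) \<le> (\<Sum>w\<in>W - \<Gamma>. 3 * card (nbr E w \<inter> UF))"
        using sum_mono[of "W - \<Gamma>" "\<lambda>_. 2 * d" "\<lambda>w. 3 * card (nbr E w \<inter> UF)"] by (simp add: mult.commute)
      also have "\<dots> = 3 * (\<Sum>u\<in>UF. card (nbr E u \<inter> (W - \<Gamma>)))"
        using fin finUF by (subst sum_distrib_left[symmetric], subst nbr_double_count) auto
      also have "\<dots> \<le> 3 * (\<Sum>u\<in>UF. d)" using degle UV UFU by (intro mult_le_mono2 sum_mono) auto
      finally have "d * (2 * card (W - \<Gamma>)) \<le> d * (3 * card UF)" by (simp add: mult_ac)
      then have "2 * card (W - \<Gamma>) \<le> 3 * card UF" using dpos by simp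
      moreover have "card W = card \<Gamma> + card (W - \<Gamma>)"
        using card_Int_Diff[OF fin(2), of \<Gamma>] \<Gamma>W by (simp add: Int_absorb1)
      ultimately have G: "card V \<le> 25 * card \<Gamma>" using cF False by linarith
      have WU: "W \<inter> U = {}" by (auto simp: W_def)
      show ?thesis
      proof (rule that[of c N "\<lambda>i. c i ` {..<m} \<union> X i" \<Gamma>])
        fix i assume i: "i < N"
        have "card (c i ` {..<m} \<union> X i) \<le> 2 * m"
          using card_Un_le[of "c i ` {..<m}" "X i"] ccard[OF i] X(1)[OF i] by linarith
        moreover have "cut_connected E (c i ` {..<m} \<union> X i)"
          by (rule cut_connected_attach[OF finX[OF i] c(3)[OF i] X(3)[OF i]])
        moreover have "X i \<subseteq> V" using X(1)[OF i] by (auto simp: W_def)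
        ultimately show "c i ` {..<m} \<subseteq> c i ` {..<m} \<union> X i \<and> c i ` {..<m} \<union> X i \<subseteq> V \<and>
            card (c i ` {..<m} \<union> X i) \<le> 2 * m \<and> cut_connected E (c i ` {..<m} \<union> X i)"
          using c(2)[OF i] by blast
      next
        fix i j assume ij: "i < N" "j < N" "i \<noteq> j"
        have "c l ` {..<m} \<subseteq> U" "X l \<subseteq> W" if "l < N" for l using that X(1) by (auto simp: U_def)
        then have "c i ` {..<m} \<inter> X j = {}" "X i \<inter> c j ` {..<m} = {}" using WU ij by blast+
        then show "(c i ` {..<m} \<union> X i) \<inter> (c j ` {..<m} \<union> X j) = {}"
          using cdisj[OF ij] X(2)[OF ij] by blast
      next
        fix v assume "v \<in> \<Gamma>"
        then have "2 * d \<le> 3 * card (nbr E v \<inter> U)" using Wdeg \<Gamma>W by blast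
        then show "d \<le> 2 * card (nbr E v \<inter> (\<Union>i<N. c i ` {..<m}))" unfolding U_def by linarith
      qed (use c N1 N2 G in \<open>auto simp: \<Gamma>_def\<close>)
    qed
  qed
qed

section \<open>Expansion of the random graph\<close>

text \<open>Union bound over at most \<open>4 ^ N\<close> pairs of families; for each pair at least
  \<open>(N * m / 4)^2\<close> distinct edges have to be absent.\<close>

lemma prob_no_expansion:
  fixes c :: "nat \<Rightarrow> nat \<Rightarrow> 'a"
  assumes V: "finite V" and inj: "inj_on (\<lambda>(i, j). c i j) ({..<N} \<times> {..<m})"
    and sub: "\<And>i. i < N \<Longrightarrow> c i ` {..<m} \<subseteq> V" and p: "0 \<le> p" "p \<le> 1"
  shows "measure_pmf.prob (Pi_pmf (all_pairs V) False (\<lambda>_. bernoulli_pmf p))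
    {b. \<exists>X Y. X \<subseteq> {..<N} \<and> Y \<subseteq> {..<N} \<and> X \<inter> Y = {} \<and> N \<le> 4 * card X \<and> N \<le> 4 * card Y \<and>
       (\<forall>x\<in>X. \<forall>y\<in>Y. \<forall>i<m. \<forall>j<m. \<not> b {c x i, c y j})}
    \<le> 4 ^ N * exp (- (p * (real N * real m)\<^sup>2 / 16))"
proof -
  let ?M = "Pi_pmf (all_pairs V) False (\<lambda>_. bernoulli_pmf p)"
  define P where "P = {(X, Y). X \<subseteq> {..<N} \<and> Y \<subseteq> {..<N} \<and> X \<inter> Y = {} \<and> N \<le> 4 * card X \<and> N \<le> 4 * card Y}"
  define F where "F z = (\<lambda>(x, i, y, j). {c x i, c y j}) ` (fst z \<times> {..<m} \<times> snd z \<times> {..<m})" for z :: "nat set \<times> nat set"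
  have Psub: "P \<subseteq> Pow {..<N} \<times> Pow {..<N}" by (auto simp: P_def)
  then have finP: "finite P" using finite_subset by (metis finite_Pow_iff finite_SigmaI finite_lessThan)
  have "card P \<le> card (Pow {..<N} \<times> Pow {..<N})" using Psub by (intro card_mono) auto
  also have "\<dots> = 4 ^ N" by (simp add: card_cartesian_product card_Pow power_mult_distrib[symmetric])
  finally have cardP: "real (card P) \<le> 4 ^ N" by (metis of_nat_le_iff of_nat_numeral of_nat_power)
  have inj': "x = x' \<and> i = i'" if "c x i = c x' i'" "x < N" "x' < N" "i < m" "i' < m" for x x' i i'
    using inj_onD[OF inj, of "(x, i)" "(x', i')"] that by simp
  have one: "measure_pmf.prob ?M {b. \<forall>e\<in>F z. \<not> b e} \<le> exp (- (p * (real N * real m)\<^sup>2 / 16))" if z: "z \<in> P" for z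
  proof -
    obtain X Y where zz: "z = (X, Y)" by (cases z)
    have XY: "X \<subseteq> {..<N}" "Y \<subseteq> {..<N}" "X \<inter> Y = {}" "N \<le> 4 * card X" "N \<le> 4 * card Y"
      using z by (auto simp: P_def zz)
    have fin: "finite X" "finite Y" using XY(1,2) finite_subset by auto
    have "inj_on (\<lambda>(x, i, y, j). {c x i, c y j}) (X \<times> {..<m} \<times> Y \<times> {..<m})"
    proof (rule inj_onI)
      fix s s' assume s: "s \<in> X \<times> {..<m} \<times> Y \<times> {..<m}" "s' \<in> X \<times> {..<m} \<times> Y \<times> {..<m}"
        and eq: "(\<lambda>(x, i, y, j). {c x i, c y j}) s = (\<lambda>(x, i, y, j). {c x i, c y j}) s'"
      obtain x i y j x' i' y' j' where ss: "s = (x, i, y, j)" "s' = (x', i', y', j')" by (cases s, cases s')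
      have mem: "x \<in> X" "x' \<in> X" "y \<in> Y" "y' \<in> Y" "i < m" "i' < m" "j < m" "j' < m" using s ss by auto
      have lt: "x < N" "x' < N" "y < N" "y' < N" using mem XY by auto
      have "c x i \<noteq> c y' j'" using inj'[of x i y' j'] mem lt XY(3) by blast
      then have "c x i = c x' i'" "c y j = c y' j'" using eq by (auto simp: ss doubleton_eq_iff)
      then show "s = s'" using inj'[of x i x' i'] inj'[of y j y' j'] mem lt ss by simp
    qed
    then have "card (F z) = card X * m * (card Y * m)"
      unfolding F_def by (subst card_image) (simp_all add: zz card_cartesian_product)
    moreover have "F z \<subseteq> all_pairs V"
    proof
      fix e assume "e \<in> F z"
      then obtain x i y j where e: "e = {c x i, c y j}" "x \<in> X" "y \<in> Y" "i < m" "j < m"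
        by (auto simp: F_def zz)
      then have "c x i \<noteq> c y j" using inj'[of x i y j] XY by blast
      moreover have "c x i \<in> V" "c y j \<in> V" using e XY sub[of x] sub[of y] by auto
      ultimately show "e \<in> all_pairs V" using e by (simp add: all_pairs_iff)
    qed
    ultimately have "measure_pmf.prob ?M {b. \<forall>e\<in>F z. \<not> b e} = (1 - p) ^ (card X * m * (card Y * m))"
      using prob_all_absent[of "all_pairs V" "F z" p] V p by simp
    also have "\<dots> \<le> exp (- p) ^ (card X * m * (card Y * m))"
      using p exp_ge_add_one_self[of "- p"] by (intro power_mono) auto
    also have "\<dots> = exp (- (p * (real (card X * m) * real (card Y * m))))"
      by (simp add: exp_of_nat_mult[symmetric] mult_ac)
    also have "\<dots> \<le> exp (- (p * (real N * real m)\<^sup>2 / 16))"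
    proof -
      have "real N * real m / 4 \<le> real (card X * m)" "real N * real m / 4 \<le> real (card Y * m)"
        using XY(4,5) mult_right_mono[of "real N" "4 * real (card X)" "real m"]
          mult_right_mono[of "real N" "4 * real (card Y)" "real m"] by simp_all
      then have "(real N * real m / 4) * (real N * real m / 4) \<le> real (card X * m) * real (card Y * m)"
        by (intro mult_mono) auto
      then have "p * ((real N * real m / 4) * (real N * real m / 4)) \<le> p * (real (card X * m) * real (card Y * m))"
        using p by (intro mult_left_mono) auto
      then show ?thesis by (simp add: power2_eq_square)
    qed
    finally show ?thesis .
  qed
  have "{b. \<exists>X Y. X \<subseteq> {..<N} \<and> Y \<subseteq> {..<N} \<and> X \<inter> Y = {} \<and> N \<le> 4 * card X \<and> N \<le> 4 * card Y \<and>
       (\<forall>x\<in>X. \<forall>y\<in>Y. \<forall>i<m. \<forall>j<m. \<not> b {c x i, c y j})} \<subseteq> (\<Union>z\<in>P. {b. \<forall>e\<in>F z. \<not> b e})" (is "?A \<subseteq> _")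
  proof
    fix b assume "b \<in> ?A"
    then obtain X Y where *: "X \<subseteq> {..<N}" "Y \<subseteq> {..<N}" "X \<inter> Y = {}" "N \<le> 4 * card X" "N \<le> 4 * card Y"
       "\<forall>x\<in>X. \<forall>y\<in>Y. \<forall>i<m. \<forall>j<m. \<not> b {c x i, c y j}" by auto
    then have "(X, Y) \<in> P" "\<forall>e\<in>F (X, Y). \<not> b e" by (auto simp: P_def F_def)
    then show "b \<in> (\<Union>z\<in>P. {b. \<forall>e\<in>F z. \<not> b e})" by (intro UN_I[of "(X, Y)"]) auto
  qed
  then have "measure_pmf.prob ?M ?A \<le> measure_pmf.prob ?M (\<Union>z\<in>P. {b. \<forall>e\<in>F z. \<not> b e})"
    by (intro measure_pmf.finite_measure_mono) auto
  also have "\<dots> \<le> (\<Sum>z\<in>P. measure_pmf.prob ?M {b. \<forall>e\<in>F z. \<not> b e})"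
    using finP by (intro measure_pmf.finite_measure_subadditive_finite) auto
  also have "\<dots> \<le> (\<Sum>z\<in>P. exp (- (p * (real N * real m)\<^sup>2 / 16)))" by (intro sum_mono one)
  also have "\<dots> = real (card P) * exp (- (p * (real N * real m)\<^sup>2 / 16))" by simp
  also have "\<dots> \<le> 4 ^ N * exp (- (p * (real N * real m)\<^sup>2 / 16))" using cardP by (intro mult_right_mono) auto
  finally show ?thesis .
qed

section \<open>Counting sequences of cores\<close>

text \<open>One step of an exponential-moment argument for the neighbourhood of a random sequence of
  cores. While at most half of \<open>\<Gamma>\<close> is covered, a new core adds on average at
  least \<open>f * card \<Gamma> / (2 * card I)\<close> vertices, and never more than
  \<open>D\<close>. For \<open>0 <= z <= lam * D\<close> the bound
  \<open>exp (- z) <= 1 / (1 + z) <= 1 - z / (1 + lam * D)\<close> turns this mean into a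
  contraction factor.\<close>

lemma sum_exp_union_step:
  fixes nb :: "'i \<Rightarrow> 'v set" and lam f D :: real
  assumes I: "finite I" and G: "finite \<Gamma>" and nb: "\<And>i. i \<in> I \<Longrightarrow> nb i \<subseteq> \<Gamma>"
    and D: "\<And>i. i \<in> I \<Longrightarrow> real (card (nb i)) \<le> D"
    and f: "\<And>v. v \<in> \<Gamma> \<Longrightarrow> f \<le> real (card {i \<in> I. v \<in> nb i})" and lam: "0 \<le> lam" and f0: "0 \<le> f" and D0: "0 \<le> D"
    and Y: "Y \<subseteq> \<Gamma>" "2 * card Y \<le> card \<Gamma>"
  shows "(\<Sum>i\<in>I. exp (- (lam * real (card (nb i \<union> Y))))) \<le>
    exp (- (lam * real (card Y))) * (real (card I) * exp (- (lam * f * real (card \<Gamma>) / (2 * real (card I) * (1 + lam * D)))))"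
proof (cases "I = {}")
  case False
  then have N: "real (card I) > 0" using I by (simp add: card_gt_0_iff)
  let ?N = "real (card I)"
  let ?\<delta> = "\<lambda>i. real (card (nb i - Y))"
  let ?\<mu> = "lam * f * real (card \<Gamma>) / (2 * ?N * (1 + lam * D))"
  have finY: "finite Y" using Y(1) G finite_subset by blast
  have lamD: "1 + lam * D > 0" using lam D0 by (simp add: add_pos_nonneg)
  have "(\<Sum>i\<in>I. exp (- (lam * real (card (nb i \<union> Y))))) = (\<Sum>i\<in>I. exp (- (lam * real (card Y))) * exp (- (lam * ?\<delta> i)))"
  proof (intro sum.cong refl)
    fix i assume i: "i \<in> I"
    have "finite (nb i)" using nb[OF i] G finite_subset by blast
    then have "card (nb i \<union> Y) = card Y + card (nb i - Y)"
      using finY by (metis Un_commute Un_Diff_cancel card_Un_disjoint Diff_disjoint finite_Diff)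
    then show "exp (- (lam * real (card (nb i \<union> Y)))) = exp (- (lam * real (card Y))) * exp (- (lam * ?\<delta> i))"
      by (simp add: exp_add[symmetric] algebra_simps)
  qed
  also have "\<dots> = exp (- (lam * real (card Y))) * (\<Sum>i\<in>I. exp (- (lam * ?\<delta> i)))"
    by (simp add: sum_distrib_left)
  also have "(\<Sum>i\<in>I. exp (- (lam * ?\<delta> i))) \<le> (\<Sum>i\<in>I. 1 - lam * ?\<delta> i / (1 + lam * D))"
  proof (intro sum_mono)
    fix i assume i: "i \<in> I"
    have z: "0 \<le> lam * ?\<delta> i" using lam by simp
    have "?\<delta> i \<le> real (card (nb i))"
      using nb[OF i] G finite_subset card_mono[of "nb i" "nb i - Y"] by (metis Diff_subset of_nat_le_iff)
    then have zD: "lam * ?\<delta> i \<le> lam * D" using D[OF i] lam by (intro mult_left_mono) auto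
    have "exp (- (lam * ?\<delta> i)) \<le> 1 / (1 + lam * ?\<delta> i)"
      using exp_ge_add_one_self[of "lam * ?\<delta> i"] z by (simp add: exp_minus inverse_eq_divide frac_le)
    also have "\<dots> = 1 - lam * ?\<delta> i / (1 + lam * ?\<delta> i)" using z by (simp add: field_simps)
    also have "\<dots> \<le> 1 - lam * ?\<delta> i / (1 + lam * D)"
      using z zD divide_left_mono[of "1 + lam * ?\<delta> i" "1 + lam * D" "lam * ?\<delta> i"] lamD by simp
    finally show "exp (- (lam * ?\<delta> i)) \<le> 1 - lam * ?\<delta> i / (1 + lam * D)" .
  qed
  also have "\<dots> = ?N - lam / (1 + lam * D) * (\<Sum>i\<in>I. ?\<delta> i)"
    by (simp add: sum_subtractf sum_distrib_left)
  also have "\<dots> \<le> ?N - lam / (1 + lam * D) * (f * (real (card \<Gamma>) / 2))"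
  proof -
    have "(\<Sum>i\<in>I. card (nb i - Y)) = (\<Sum>i\<in>I. \<Sum>v\<in>\<Gamma> - Y. if v \<in> nb i then 1 else 0)"
    proof (intro sum.cong refl)
      fix i assume i: "i \<in> I"
      have "nb i - Y = (\<Gamma> - Y) \<inter> nb i" using nb[OF i] by blast
      then show "card (nb i - Y) = (\<Sum>v\<in>\<Gamma> - Y. if v \<in> nb i then 1 else 0)" using G by (simp add: sum.If_cases)
    qed
    also have "\<dots> = (\<Sum>v\<in>\<Gamma> - Y. card {i \<in> I. v \<in> nb i})"
      using I by (subst sum.swap) (simp add: sum.If_cases Int_def)
    finally have "real (\<Sum>i\<in>I. card (nb i - Y)) = real (\<Sum>v\<in>\<Gamma> - Y. card {i \<in> I. v \<in> nb i})"
      by (rule arg_cong)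
    then have "(\<Sum>i\<in>I. ?\<delta> i) = (\<Sum>v\<in>\<Gamma> - Y. real (card {i \<in> I. v \<in> nb i}))" by simp
    also have "\<dots> \<ge> (\<Sum>v\<in>\<Gamma> - Y. f)" using f by (intro sum_mono) auto
    finally have 1: "(\<Sum>i\<in>I. ?\<delta> i) \<ge> f * real (card (\<Gamma> - Y))" by (simp add: mult.commute)
    have "card (\<Gamma> - Y) = card \<Gamma> - card Y" using Y(1) finY by (simp add: card_Diff_subset)
    then have "real (card \<Gamma>) / 2 \<le> real (card (\<Gamma> - Y))" using Y(2) by linarith
    then have "f * (real (card \<Gamma>) / 2) \<le> f * real (card (\<Gamma> - Y))" using f0 by (rule mult_left_mono)
    then have "lam / (1 + lam * D) * (f * (real (card \<Gamma>) / 2)) \<le> lam / (1 + lam * D) * (\<Sum>i\<in>I. ?\<delta> i)"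
      using 1 lam lamD by (intro mult_left_mono) auto
    then show ?thesis by simp
  qed
  also have "\<dots> = ?N * (1 - ?\<mu>)"
  proof -
    have "?N - lam / K * (f * (g / 2)) = ?N * (1 - lam * f * g / (2 * ?N * K))" if "K > 0" for K g :: real
      using N that by (simp add: field_simps)
    then show ?thesis using lamD by blast
  qed
  also have "\<dots> \<le> ?N * exp (- ?\<mu>)" using N exp_ge_add_one_self[of "- ?\<mu>"] by (intro mult_left_mono) auto
  finally show ?thesis by simp
qed simp

text \<open>Iterates the step. Once a neighbourhood exceeds half of \<open>\<Gamma>\<close>, the
  weight of every extension is at most \<open>exp (- (lam * card \<Gamma> / 2))\<close>; this
  accounts for the additive term, once for each of the \<open>t\<close> positions.\<close>

lemma sum_exp_union_lists:
  fixes nb :: "'i \<Rightarrow> 'v set" and lam f D :: real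
  assumes I: "finite I" and G: "finite \<Gamma>" and nb: "\<And>i. i \<in> I \<Longrightarrow> nb i \<subseteq> \<Gamma>"
    and D: "\<And>i. i \<in> I \<Longrightarrow> real (card (nb i)) \<le> D"
    and f: "\<And>v. v \<in> \<Gamma> \<Longrightarrow> f \<le> real (card {i \<in> I. v \<in> nb i})" and lam: "0 \<le> lam" and f0: "0 \<le> f" and D0: "0 \<le> D"
  shows "(\<Sum>xs | set xs \<subseteq> I \<and> length xs = t. exp (- (lam * real (card (\<Union>i\<in>set xs. nb i))))) \<le>
    real (card I) ^ t * (exp (- (real t * (lam * f * real (card \<Gamma>) / (2 * real (card I) * (1 + lam * D))))) +
      real t * exp (- (lam * real (card \<Gamma>) / 2)))"
proof (induction t)
  case 0
  have "{xs. set xs \<subseteq> I \<and> length xs = 0} = {[]}" by auto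
  then show ?case by simp
next
  case (Suc t)
  let ?N = "real (card I)"
  define \<mu> where "\<mu> = lam * f * real (card \<Gamma>) / (2 * ?N * (1 + lam * D))"
  define L where "L t = {xs. set xs \<subseteq> I \<and> length xs = t}" for t
  define w where "w xs = exp (- (lam * real (card (\<Union>i\<in>set xs. nb i))))" for xs
  define \<epsilon> where "\<epsilon> = exp (- (lam * real (card \<Gamma>) / 2))"
  have finL: "finite (L t)" for t unfolding L_def by (rule finite_lists_length_eq[OF I])
  have cardL: "real (card (L t)) = ?N ^ t" for t unfolding L_def using card_lists_length_eq[OF I] by simp
  have mu0: "0 \<le> \<mu>" unfolding \<mu>_def using lam f0 D0 by simp
  have step: "(\<Sum>x\<in>I. w (x # xs)) \<le> ?N * exp (- \<mu>) * w xs + ?N * \<epsilon>" if xs: "xs \<in> L t" for xs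
  proof -
    let ?Y = "\<Union>i\<in>set xs. nb i"
    have Y: "?Y \<subseteq> \<Gamma>" using xs nb by (auto simp: L_def)
    show ?thesis
    proof (cases "2 * card ?Y \<le> card \<Gamma>")
      case True
      have "(\<Sum>x\<in>I. w (x # xs)) \<le> w xs * (?N * exp (- \<mu>))"
        using sum_exp_union_step[OF I G nb D f lam f0 D0 Y True] by (simp add: w_def \<mu>_def)
      moreover have "0 \<le> ?N * \<epsilon>" by (simp add: \<epsilon>_def)
      ultimately show ?thesis by (simp add: mult_ac)
    next
      case False
      have "w (x # xs) \<le> \<epsilon>" if "x \<in> I" for x
      proof -
        have "card ?Y \<le> card (nb x \<union> ?Y)"
          using nb[OF that] Y G by (intro card_mono) (auto intro: finite_subset)
        then have "real (card \<Gamma>) / 2 \<le> real (card (nb x \<union> ?Y))" using False by linarith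
        then have "lam * (real (card \<Gamma>) / 2) \<le> lam * real (card (nb x \<union> ?Y))" using lam by (rule mult_left_mono)
        then show ?thesis by (simp add: w_def \<epsilon>_def)
      qed
      then have "(\<Sum>x\<in>I. w (x # xs)) \<le> (\<Sum>x\<in>I. \<epsilon>)" by (intro sum_mono)
      moreover have "0 \<le> ?N * exp (- \<mu>) * w xs" by (simp add: w_def)
      ultimately show ?thesis by simp
    qed
  qed
  have "L (Suc t) = (\<lambda>(xs, x). x # xs) ` (L t \<times> I)" unfolding L_def by (rule lists_length_Suc_eq)
  moreover have "inj_on (\<lambda>(xs, x). x # xs) (L t \<times> I)" by (auto simp: inj_on_def)
  ultimately have "(\<Sum>xs\<in>L (Suc t). w xs) = (\<Sum>(xs, x)\<in>L t \<times> I. w (x # xs))"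
    by (simp add: sum.reindex case_prod_unfold)
  also have "\<dots> = (\<Sum>xs\<in>L t. \<Sum>x\<in>I. w (x # xs))" by (simp add: sum.cartesian_product)
  also have "\<dots> \<le> (\<Sum>xs\<in>L t. ?N * exp (- \<mu>) * w xs + ?N * \<epsilon>)" by (intro sum_mono step)
  also have "\<dots> = ?N * exp (- \<mu>) * (\<Sum>xs\<in>L t. w xs) + ?N ^ t * (?N * \<epsilon>)"
    by (simp add: sum.distrib sum_distrib_left cardL)
  also have "\<dots> \<le> ?N * exp (- \<mu>) * (?N ^ t * (exp (- (real t * \<mu>)) + real t * \<epsilon>)) + ?N ^ t * (?N * \<epsilon>)"
    using Suc.IH by (intro add_right_mono mult_left_mono) (auto simp: L_def w_def \<mu>_def \<epsilon>_def)
  also have "\<dots> = ?N ^ Suc t * (exp (- \<mu>) * exp (- (real t * \<mu>)) + exp (- \<mu>) * (real t * \<epsilon>) + \<epsilon>)"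
    by (simp add: algebra_simps)
  also have "\<dots> \<le> ?N ^ Suc t * (exp (- \<mu>) * exp (- (real t * \<mu>)) + 1 * (real t * \<epsilon>) + \<epsilon>)"
    using mu0 by (intro mult_left_mono add_mono mult_right_mono) (auto simp: \<epsilon>_def)
  also have "\<dots> = ?N ^ Suc t * (exp (- (real (Suc t) * \<mu>)) + real (Suc t) * \<epsilon>)"
    by (simp add: exp_add[symmetric] algebra_simps)
  finally show ?case by (simp add: L_def w_def \<mu>_def \<epsilon>_def)
qed

text \<open>Fix \<open>xs\<close> with neighbourhood \<open>Y\<close>. The pieces cover
  \<open>\<Gamma>\<close> and have at most \<open>q\<close> elements, so at least
  \<open>card Y / q\<close> of them meet \<open>Y\<close>, and at most the fraction
  \<open>exp (- (t * card Y / (q * card I)))\<close> of all sequences \<open>ys\<close> avoids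
  these. This dictates \<open>lam\<close>; the sum over \<open>xs\<close> is then the exponential
  moment bounded before.\<close>

lemma card_non_hitting_pairs:
  fixes nb Q :: "'i \<Rightarrow> 'v set" and q f D :: real
  assumes I: "finite I" and G: "finite \<Gamma>" and nb: "\<And>i. i \<in> I \<Longrightarrow> nb i \<subseteq> \<Gamma>"
    and D: "\<And>i. i \<in> I \<Longrightarrow> real (card (nb i)) \<le> D"
    and f: "\<And>v. v \<in> \<Gamma> \<Longrightarrow> f \<le> real (card {i \<in> I. v \<in> nb i})" and f0: "0 \<le> f" and D0: "0 \<le> D"
    and Q: "\<And>i. i \<in> I \<Longrightarrow> real (card (Q i)) \<le> q" "\<And>i. i \<in> I \<Longrightarrow> finite (Q i)" "\<Gamma> \<subseteq> (\<Union>i\<in>I. Q i)" and q: "0 < q"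
    and lam: "lam = real t / (q * real (card I))"
  shows "real (card {(xs, ys). set xs \<subseteq> I \<and> length xs = t \<and> set ys \<subseteq> I \<and> length ys = t \<and>
      (\<forall>j\<in>set ys. Q j \<inter> (\<Union>i\<in>set xs. nb i) = {})}) \<le>
    real (card I) ^ (2 * t) * (exp (- (real t * (lam * f * real (card \<Gamma>) / (2 * real (card I) * (1 + lam * D))))) +
      real t * exp (- (lam * real (card \<Gamma>) / 2)))"
proof -
  let ?N = "real (card I)"
  define L where "L = {xs. set xs \<subseteq> I \<and> length xs = t}"
  define Y where "Y xs = (\<Union>i\<in>set xs. nb i)" for xs
  define Z where "Z xs = {j \<in> I. Q j \<inter> Y xs = {}}" for xs
  have finL: "finite L" unfolding L_def by (rule finite_lists_length_eq[OF I])
  have lam0: "0 \<le> lam" using lam q by simp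
  have one: "real (card (Z xs) ^ t) \<le> ?N ^ t * exp (- (lam * real (card (Y xs))))" if xs: "xs \<in> L" for xs
  proof (cases "I = {}")
    case True
    then show ?thesis using lam by (simp add: Z_def)
  next
    case False
    then have N: "?N > 0" using I by (simp add: card_gt_0_iff)
    have YG: "Y xs \<subseteq> \<Gamma>" using xs nb by (auto simp: L_def Y_def)
    have "Y xs \<subseteq> (\<Union>j\<in>I - Z xs. Q j)" using YG Q(3) unfolding Z_def by blast
    then have "card (Y xs) \<le> card (\<Union>j\<in>I - Z xs. Q j)" using I Q(2) by (intro card_mono) auto
    also have "\<dots> \<le> (\<Sum>j\<in>I - Z xs. card (Q j))" using I by (intro card_UN_le) auto
    finally have "real (card (Y xs)) \<le> real (\<Sum>j\<in>I - Z xs. card (Q j))" by (simp only: of_nat_le_iff)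
    then have "real (card (Y xs)) \<le> (\<Sum>j\<in>I - Z xs. real (card (Q j)))" by simp
    also have "\<dots> \<le> (\<Sum>j\<in>I - Z xs. q)" using Q(1) by (intro sum_mono) auto
    finally have "real (card (Y xs)) \<le> q * real (card (I - Z xs))" by (simp add: mult.commute)
    moreover have "real (card (I - Z xs)) = ?N - real (card (Z xs))"
    proof -
      have "Z xs \<subseteq> I" by (auto simp: Z_def)
      then show ?thesis using I by (simp add: card_Diff_subset card_mono finite_subset of_nat_diff)
    qed
    ultimately have "real (card (Z xs)) \<le> ?N * (1 - real (card (Y xs)) / (q * ?N))"
    proof -
      assume "real (card (Y xs)) \<le> q * real (card (I - Z xs))" "real (card (I - Z xs)) = ?N - real (card (Z xs))"
      then have "real (card (Z xs)) \<le> ?N - real (card (Y xs)) / q" using q by (simp add: field_simps)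
      also have "\<dots> = ?N * (1 - real (card (Y xs)) / (q * ?N))" using q N by (simp add: right_diff_distrib)
      finally show ?thesis .
    qed
    also have "\<dots> \<le> ?N * exp (- (real (card (Y xs)) / (q * ?N)))"
      using N exp_ge_add_one_self[of "- (real (card (Y xs)) / (q * ?N))"] by (intro mult_left_mono) auto
    finally have "real (card (Z xs)) ^ t \<le> (?N * exp (- (real (card (Y xs)) / (q * ?N)))) ^ t"
      by (intro power_mono) auto
    also have "\<dots> = ?N ^ t * exp (- (lam * real (card (Y xs))))"
      by (simp add: power_mult_distrib exp_of_nat_mult[symmetric] lam)
    finally show ?thesis by simp
  qed
  have "{(xs, ys). set xs \<subseteq> I \<and> length xs = t \<and> set ys \<subseteq> I \<and> length ys = t \<and>
      (\<forall>j\<in>set ys. Q j \<inter> (\<Union>i\<in>set xs. nb i) = {})} = (SIGMA xs:L. {ys. set ys \<subseteq> Z xs \<and> length ys = t})" (is "?B = _")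
    by (intro set_eqI iffI; clarsimp simp: L_def Z_def Y_def; blast)
  moreover have "finite (Z xs)" for xs using I by (simp add: Z_def)
  ultimately have "card ?B = (\<Sum>xs\<in>L. card (Z xs) ^ t)"
    using finL by (simp add: card_SigmaI finite_lists_length_eq card_lists_length_eq)
  then have "real (card ?B) = (\<Sum>xs\<in>L. real (card (Z xs) ^ t))" by simp
  also have "\<dots> \<le> (\<Sum>xs\<in>L. ?N ^ t * exp (- (lam * real (card (Y xs)))))" by (intro sum_mono one)
  also have "\<dots> = ?N ^ t * (\<Sum>xs\<in>L. exp (- (lam * real (card (Y xs)))))" by (simp add: sum_distrib_left)
  also have "\<dots> \<le> ?N ^ t * (?N ^ t * (exp (- (real t * (lam * f * real (card \<Gamma>) / (2 * ?N * (1 + lam * D))))) +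
      real t * exp (- (lam * real (card \<Gamma>) / 2))))"
    using sum_exp_union_lists[OF I G nb D f lam0 f0 D0, of t]
    by (intro mult_left_mono) (auto simp: L_def Y_def)
  also have "\<dots> = ?N ^ (2 * t) * (exp (- (real t * (lam * f * real (card \<Gamma>) / (2 * ?N * (1 + lam * D))))) +
      real t * exp (- (lam * real (card \<Gamma>) / 2)))"
    unfolding mult_2 power_add by (rule mult.assoc[symmetric])
  finally show ?thesis .
qed

section \<open>Permuting the cores\<close>

text \<open>Any two of the permutations counted differ by one that fixes \<open>set zs\<close>
  pointwise.\<close>

lemma card_permutes_prefix:
  assumes I: "finite I" and zs: "distinct zs" "set zs \<subseteq> I"
  shows "card {\<pi>. \<pi> permutes I \<and> map \<pi> zs = ws} \<le> fact (card I - length zs)"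
proof (cases "{\<pi>. \<pi> permutes I \<and> map \<pi> zs = ws} = {}")
  case False
  then obtain \<rho> where \<rho>: "\<rho> permutes I" "map \<rho> zs = ws" by blast
  let ?S = "{\<sigma>. \<sigma> permutes (I - set zs)}"
  have "card {\<pi>. \<pi> permutes I \<and> map \<pi> zs = ws} \<le> card ?S"
  proof (rule card_inj_on_le[of "\<lambda>\<pi>. inv \<rho> \<circ> \<pi>"])
    show "inj_on (\<lambda>\<pi>. inv \<rho> \<circ> \<pi>) {\<pi>. \<pi> permutes I \<and> map \<pi> zs = ws}"
    proof (rule inj_onI)
      fix \<pi> \<pi>' assume "inv \<rho> \<circ> \<pi> = inv \<rho> \<circ> \<pi>'"
      then have "\<rho> \<circ> (inv \<rho> \<circ> \<pi>) = \<rho> \<circ> (inv \<rho> \<circ> \<pi>')" by simp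
      then show "\<pi> = \<pi>'" using permutes_inv_o(1)[OF \<rho>(1)] by (simp add: comp_assoc[symmetric])
    qed
    show "(\<lambda>\<pi>. inv \<rho> \<circ> \<pi>) ` {\<pi>. \<pi> permutes I \<and> map \<pi> zs = ws} \<subseteq> ?S"
    proof clarify
      fix \<pi> assume \<pi>: "\<pi> permutes I" "ws = map \<pi> zs"
      have "inv \<rho> \<circ> \<pi> permutes I" by (rule permutes_compose[OF \<pi>(1) permutes_inv[OF \<rho>(1)]])
      moreover have "(inv \<rho> \<circ> \<pi>) x = x" if "x \<in> I - (I - set zs)" for x
      proof -
        have "\<pi> x = \<rho> x" using that \<pi>(2) \<rho>(2) by auto
        then show ?thesis using permutes_inverses(2)[OF \<rho>(1)] by simp
      qed
      ultimately show "inv \<rho> \<circ> \<pi> permutes (I - set zs)" by (rule permutes_superset)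
    qed
    show "finite ?S" using I by (intro finite_permutations) auto
  qed
  also have "\<dots> = fact (card (I - set zs))" using I by (intro card_permutations) auto
  also have "card (I - set zs) = card I - length zs"
    using zs by (simp add: card_Diff_subset distinct_card)
  finally show ?thesis .
next
  case True
  show ?thesis unfolding True by simp
qed

lemma fact_falling_ge: "K ^ L * fact K \<le> (fact (K + L) :: nat)"
proof (induction L)
  case (Suc L)
  have "K ^ Suc L * fact K = K * (K ^ L * fact K)" by (simp add: mult_ac)
  also have "\<dots> \<le> Suc (K + L) * fact (K + L)" using Suc.IH by (intro mult_le_mono) auto
  finally show ?case by simp
qed simp

text \<open>By invariance of \<open>M\<close>, \<open>b\<close> may be replaced by
  \<open>h \<pi> b\<close> with \<open>\<pi>\<close> uniform in \<open>P\<close>. After exchanging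
  the two averages it suffices to bound the fraction of bad \<open>\<pi>\<close> for each fixed
  \<open>b\<close> outside \<open>B0\<close>; whatever was chosen in dependence on \<open>b\<close>
  is then deterministic.\<close>

lemma prob_average_bound:
  fixes M :: "'b pmf" and h :: "'c \<Rightarrow> 'b \<Rightarrow> 'b"
  assumes P: "finite P" "P \<noteq> {}" and inv: "\<And>\<pi>. \<pi> \<in> P \<Longrightarrow> map_pmf (h \<pi>) M = M"
    and bad: "\<And>b. b \<notin> B0 \<Longrightarrow> real (card {\<pi> \<in> P. h \<pi> b \<in> A}) \<le> \<epsilon> * real (card P)" and e0: "0 \<le> \<epsilon>"
  shows "measure_pmf.prob M A \<le> measure_pmf.prob M B0 + \<epsilon>"
proof -
  let ?p = "real (card P)"
  have pp: "?p > 0" using P by (simp add: card_gt_0_iff)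
  have "?p * measure_pmf.prob M A = (\<Sum>\<pi>\<in>P. measure_pmf.prob M A)" by simp
  also have "\<dots> = (\<Sum>\<pi>\<in>P. measure_pmf.prob M (h \<pi> -` A))"
    by (intro sum.cong refl) (metis inv measure_map_pmf)
  also have "\<dots> = (\<Sum>\<pi>\<in>P. measure_pmf.expectation M (indicator (h \<pi> -` A)))" by simp
  also have "\<dots> = measure_pmf.expectation M (\<lambda>b. \<Sum>\<pi>\<in>P. indicator (h \<pi> -` A) b)"
    by (rule Bochner_Integration.integral_sum[symmetric])
      (auto intro!: measure_pmf.integrable_const_bound[where B = 1] simp: indicator_def)
  also have "\<dots> \<le> measure_pmf.expectation M (\<lambda>b. ?p * indicator B0 b + \<epsilon> * ?p)"
  proof (rule integral_mono)
    show "integrable (measure_pmf M) (\<lambda>b. \<Sum>\<pi>\<in>P. indicator (h \<pi> -` A) b :: real)"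
      by (intro Bochner_Integration.integrable_sum)
        (auto intro!: measure_pmf.integrable_const_bound[where B = 1] simp: indicator_def)
    show "integrable (measure_pmf M) (\<lambda>b. ?p * indicator B0 b + \<epsilon> * ?p)"
      by (rule measure_pmf.integrable_const_bound[where B = "?p + \<epsilon> * ?p"]) (use e0 in \<open>auto simp: indicator_def\<close>)
    fix b
    have "(\<Sum>\<pi>\<in>P. indicator (h \<pi> -` A) b :: real) = real (card {\<pi> \<in> P. h \<pi> b \<in> A})"
      using P(1) by (simp add: indicator_def sum.If_cases Int_def)
    moreover have "card {\<pi> \<in> P. h \<pi> b \<in> A} \<le> card P" using P(1) by (intro card_mono) auto
    ultimately show "(\<Sum>\<pi>\<in>P. indicator (h \<pi> -` A) b) \<le> ?p * indicator B0 b + \<epsilon> * ?p"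
      using bad[of b] e0 by (cases "b \<in> B0") (auto intro: add_increasing2)
  qed
  also have "\<dots> = ?p * measure_pmf.prob M B0 + \<epsilon> * ?p"
  proof -
    have "integrable (measure_pmf M) (\<lambda>b. ?p * indicator B0 b)"
      by (rule measure_pmf.integrable_const_bound[where B = ?p]) (auto simp: indicator_def)
    then show ?thesis by (simp add: Bochner_Integration.integral_add)
  qed
  also have "\<dots> = ?p * (measure_pmf.prob M B0 + \<epsilon>)" by (simp add: algebra_simps)
  finally show ?thesis using pp by simp
qed

lemma Pi_pmf_all_pairs_relabel:
  assumes V: "finite V" and s: "\<sigma> permutes V"
  shows "map_pmf (\<lambda>b. b \<circ> image \<sigma>) (Pi_pmf (all_pairs V) d (\<lambda>_. f)) = Pi_pmf (all_pairs V) d (\<lambda>_. f)"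
proof (rule Pi_pmf_bij_betw[symmetric])
  have inj: "inj \<sigma>" using permutes_inj[OF s] .
  have iff: "\<sigma> ` e \<in> all_pairs V \<longleftrightarrow> e \<in> all_pairs V" for e
  proof -
    have "\<sigma> ` e \<subseteq> V \<longleftrightarrow> e \<subseteq> V" using permutes_in_image[OF s] by auto
    moreover have "card (\<sigma> ` e) = card e" using inj by (intro card_image) (auto simp: inj_on_def)
    ultimately show ?thesis by (simp add: all_pairs_def)
  qed
  show "finite (all_pairs V)" using V by simp
  show "\<sigma> ` x \<notin> all_pairs V" if "x \<notin> all_pairs V" for x using that iff by simp
  show "bij_betw (image \<sigma>) (all_pairs V) (all_pairs V)"
  proof (rule bij_betw_imageI)
    show "inj_on (image \<sigma>) (all_pairs V)" using inj by (meson inj_image_eq_iff inj_onI)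
    show "image \<sigma> ` all_pairs V = all_pairs V"
    proof
      show "image \<sigma> ` all_pairs V \<subseteq> all_pairs V" using iff by auto
      show "all_pairs V \<subseteq> image \<sigma> ` all_pairs V"
      proof
        fix e assume e: "e \<in> all_pairs V"
        have "\<sigma> ` (inv \<sigma> ` e) = e" using permutes_surj[OF s] by (simp add: image_image surj_f_inv_f)
        then show "e \<in> image \<sigma> ` all_pairs V" using iff[of "inv \<sigma> ` e"] e by (metis image_eqI)
      qed
    qed
  qed
qed

text \<open>Core \<open>i\<close> goes onto core \<open>\<pi> i\<close> position by position.
  \<open>SOME\<close> recovers the index pair of \<open>v\<close>, which is unique when
  \<open>c\<close> is injective. In general this is no automorphism of \<open>G\<close>; only the
  law of the random graph is invariant under it.\<close>

definition relabel :: "(nat \<Rightarrow> nat \<Rightarrow> 'a) \<Rightarrow> nat \<Rightarrow> nat \<Rightarrow> (nat \<Rightarrow> nat) \<Rightarrow> 'a \<Rightarrow> 'a" where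
  "relabel c N m \<pi> v = (if \<exists>i<N. \<exists>j<m. v = c i j
     then case (SOME ij. fst ij < N \<and> snd ij < m \<and> v = c (fst ij) (snd ij)) of (i, j) \<Rightarrow> c (\<pi> i) j else v)"

lemma relabel_core:
  assumes inj: "inj_on (\<lambda>(i, j). c i j) ({..<N} \<times> {..<m})" and "i < N" "j < m"
  shows "relabel c N m \<pi> (c i j) = c (\<pi> i) j"
proof -
  let ?R = "\<lambda>ij. fst ij < N \<and> snd ij < m \<and> c i j = c (fst ij) (snd ij)"
  have "?R (i, j)" using assms by simp
  then have "?R (SOME ij. ?R ij)" by (rule someI)
  then have "(SOME ij. ?R ij) = (i, j)"
    using inj_onD[OF inj, of "SOME ij. ?R ij" "(i, j)"] assms(2,3)
    by (auto simp: case_prod_unfold mem_Times_iff)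
  then show ?thesis using assms(2,3) unfolding relabel_def by auto
qed

lemma relabel_outside: "\<not> (\<exists>i<N. \<exists>j<m. v = c i j) \<Longrightarrow> relabel c N m \<pi> v = v"
  unfolding relabel_def by (rule if_not_P)

lemma relabel_inverse:
  assumes inj: "inj_on (\<lambda>(i, j). c i j) ({..<N} \<times> {..<m})" and p: "\<pi> permutes {..<N}"
    and inv: "\<And>i. \<rho> (\<pi> i) = i"
  shows "relabel c N m \<rho> (relabel c N m \<pi> v) = v"
proof (cases "\<exists>i<N. \<exists>j<m. v = c i j")
  case True
  then obtain i j where ij: "i < N" "j < m" "v = c i j" by blast
  have "\<pi> i < N" using permutes_in_image[OF p, of i] ij(1) by simp
  then show ?thesis using ij inv by (simp add: relabel_core[OF inj])
next
  case False
  then show ?thesis by (simp add: relabel_outside)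
qed

lemma relabel_permutes:
  assumes inj: "inj_on (\<lambda>(i, j). c i j) ({..<N} \<times> {..<m})" and p: "\<pi> permutes {..<N}"
    and sub: "\<And>i. i < N \<Longrightarrow> c i ` {..<m} \<subseteq> V"
  shows "relabel c N m \<pi> permutes V"
proof -
  have "relabel c N m (inv \<pi>) (relabel c N m \<pi> v) = v" for v
    using permutes_inverses(2)[OF p] by (intro relabel_inverse[OF inj p]) simp
  moreover have "relabel c N m \<pi> (relabel c N m (inv \<pi>) v) = v" for v
    using permutes_inverses(1)[OF p] by (intro relabel_inverse[OF inj permutes_inv[OF p]]) simp
  ultimately have "bij (relabel c N m \<pi>)"
    by (intro o_bij[of "relabel c N m (inv \<pi>)"]) (auto simp: fun_eq_iff)
  moreover have "relabel c N m \<pi> v = v" if "v \<notin> V" for v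
    using that sub by (intro relabel_outside) auto
  ultimately show ?thesis by (simp add: permutes_def bij_iff)
qed

section \<open>Cutting a path of cores into segments\<close>

lemma cut_connected_chain:
  assumes "successively (\<lambda>i j. \<exists>x\<in>Q i. \<exists>y\<in>Q j. {x, y} \<in> E) xs" "\<And>i. i \<in> set xs \<Longrightarrow> cut_connected E (Q i)"
  shows "cut_connected E (\<Union>i\<in>set xs. Q i)"
  using assms
proof (induction xs rule: induct_list012)
  case (3 x y zs)
  from 3(3) obtain a b where ab: "a \<in> Q x" "b \<in> Q y" "{a, b} \<in> E" by auto
  have "cut_connected E (\<Union>i\<in>set (y # zs). Q i)"
    by (rule 3(2)) (use 3(3,4) in \<open>simp_all\<close>)
  moreover have "cut_connected E (Q x)" using 3(4) by simp
  ultimately have "cut_connected E (Q x \<union> (\<Union>i\<in>set (y # zs). Q i))"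
    by (intro cut_connected_Un[OF _ _ ab(1) _ ab(3)]) (use ab(2) in simp_all)
  then show ?case by simp
qed (auto simp: cut_connected_def)

definition segment :: "nat \<Rightarrow> 'b list \<Rightarrow> nat \<Rightarrow> 'b list" where
  "segment t ps a = map (\<lambda>i. ps ! (a * t + i)) [0..<t]"

lemma segment_index:
  assumes "r * t \<le> length ps" "a < r" "i < t" shows "a * t + i < length ps"
proof -
  have "a * t + i < Suc a * t" using assms(3) by simp
  also have "\<dots> \<le> r * t" using assms(2) by (intro mult_le_mono1) simp
  finally show ?thesis using assms(1) by simp
qed

lemma length_segment [simp]: "length (segment t ps a) = t"
  by (simp add: segment_def)

lemma segment_map:
  "r * t \<le> length ps \<Longrightarrow> a < r \<Longrightarrow> segment t (map f ps) a = map f (segment t ps a)"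
  using segment_index[of r t ps a] by (simp add: segment_def)

lemma set_segment_subset: "r * t \<le> length ps \<Longrightarrow> a < r \<Longrightarrow> set (segment t ps a) \<subseteq> set ps"
  using segment_index[of r t ps a] by (auto simp: segment_def)

lemma successively_segment:
  assumes "r * t \<le> length ps" "a < r" "successively R ps"
  shows "successively R (segment t ps a)"
  unfolding successively_conv_nth
proof (intro allI impI)
  fix i assume "Suc i < length (segment t ps a)"
  then have i: "Suc i < t" by simp
  then have "Suc (a * t + i) < length ps" using segment_index[OF assms(1,2), of "Suc i"] by simp
  then show "R (segment t ps a ! i) (segment t ps a ! Suc i)"
    using successively_nth[OF assms(3)] i by (simp add: segment_def)
qed

lemma distinct_segments:
  assumes "r * t \<le> length ps" "a < r" "b < r" "a \<noteq> b" "distinct ps"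
  shows "distinct (segment t ps a @ segment t ps b)"
proof -
  have eq: "a' * t + i = b' * t + j \<longleftrightarrow> a' = b' \<and> i = j" if "i < t" "j < t" for a' b' i j
  proof
    assume e: "a' * t + i = b' * t + j"
    have "a' = (a' * t + i) div t" "b' = (b' * t + j) div t" using that by simp_all
    then have "a' = b'" using e by simp
    then show "a' = b' \<and> i = j" using e by simp
  qed simp
  have nth: "ps ! (a' * t + i) = ps ! (b' * t + j) \<longleftrightarrow> a' = b' \<and> i = j" if "i < t" "j < t" "a' < r" "b' < r" for a' b' i j
    using nth_eq_iff_index_eq[OF assms(5)] segment_index[OF assms(1)] that eq by simp
  show ?thesis using nth assms(2-4) by (auto simp: segment_def distinct_map inj_on_def)
qed

text \<open>The branch set of a segment is the union of its pieces: consecutive pieces are joined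
  along the path, and \<open>hit\<close> joins different segments.\<close>

lemma hadwiger_number_ge_segments:
  assumes sg: "simple_graph K" and t: "1 \<le> t"
    and Q: "\<And>i. i < N \<Longrightarrow> Q i \<noteq> {}" "\<And>i. i < N \<Longrightarrow> Q i \<subseteq> verts K" "\<And>i. i < N \<Longrightarrow> cut_connected (edges K) (Q i)"
      "\<And>i j. i < N \<Longrightarrow> j < N \<Longrightarrow> i \<noteq> j \<Longrightarrow> Q i \<inter> Q j = {}"
    and ps: "distinct ps" "set ps \<subseteq> {..<N}" "successively (\<lambda>i j. \<exists>x\<in>Q i. \<exists>y\<in>Q j. {x, y} \<in> edges K) ps"
    and len: "r * t \<le> length ps"
    and hit: "\<And>a b. a < r \<Longrightarrow> b < r \<Longrightarrow> a < b \<Longrightarrow>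
      \<exists>i\<in>set (segment t ps a). \<exists>j\<in>set (segment t ps b). \<exists>u\<in>Q i. \<exists>v\<in>Q j. {u, v} \<in> edges K"
  shows "r \<le> hadwiger_number K"
proof (rule hadwiger_number_ge[OF sg, where B = "\<lambda>a. \<Union>i\<in>set (segment t ps a). Q i"])
  have lt: "i < N" if "a < r" "i \<in> set (segment t ps a)" for a i
    using set_segment_subset[OF len that(1)] ps(2) that(2) by auto
  fix a assume a: "a < r"
  show "(\<Union>i\<in>set (segment t ps a). Q i) \<subseteq> verts K" using Q(2) lt[OF a] by blast
  have "segment t ps a \<noteq> []" using t by (metis length_segment list.size(3) not_one_le_zero)
  then obtain i where i: "i \<in> set (segment t ps a)" using hd_in_set by blast
  show "(\<Union>i\<in>set (segment t ps a). Q i) \<noteq> {}" using Q(1)[OF lt[OF a i]] i by blast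
  show "cut_connected (edges K) (\<Union>i\<in>set (segment t ps a). Q i)"
    by (rule cut_connected_chain[OF successively_segment[OF len a ps(3)]]) (use Q(3) lt[OF a] in blast)
  fix b assume b: "b < r" and ab: "a \<noteq> b"
  have "set (segment t ps a) \<inter> set (segment t ps b) = {}" using distinct_segments[OF len a b ab ps(1)] by simp
  then have "Q i \<inter> Q j = {}" if "i \<in> set (segment t ps a)" "j \<in> set (segment t ps b)" for i j
    using Q(4)[OF lt[OF a that(1)] lt[OF b that(2)]] that by blast
  then show "(\<Union>i\<in>set (segment t ps a). Q i) \<inter> (\<Union>i\<in>set (segment t ps b). Q i) = {}" by blast
  show "\<exists>x\<in>\<Union>i\<in>set (segment t ps a). Q i. \<exists>y\<in>\<Union>i\<in>set (segment t ps b). Q i. {x, y} \<in> edges K"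
  proof (cases "a < b")
    case True
    then show ?thesis using hit[OF a b True] by blast
  next
    case False
    then have "b < a" using ab by simp
    then obtain i j u v where "i \<in> set (segment t ps b)" "j \<in> set (segment t ps a)" "u \<in> Q i" "v \<in> Q j" "{u, v} \<in> edges K"
      using hit[OF b a \<open>b < a\<close>] by blast
    moreover from this have "{v, u} \<in> edges K" by (simp add: insert_commute)
    ultimately show ?thesis by blast
  qed
qed

section \<open>Large complete minors in the randomly perturbed graph\<close>

text \<open>For a fixed outcome \<open>b\<close> outside \<open>B0\<close> there is a long path
  \<open>ps\<close> of cores, which \<open>h \<pi>\<close> turns into \<open>map \<pi> ps\<close>.
  For uniform \<open>\<pi>\<close> a pair of segments is a uniform sequence of \<open>2 * t\<close>
  distinct cores, so it lands in \<open>Bad\<close> with probability at most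
  \<open>card Bad * fact (N - 2 * t) / fact N\<close>; the factor \<open>r ^ 2\<close> bounds the
  number of pairs.\<close>

lemma prob_hadwiger_lt:
  fixes G :: "'a ugraph" and c :: "nat \<Rightarrow> nat \<Rightarrow> 'a"
  assumes sg: "simple_graph G" and inj: "inj_on (\<lambda>(i, j). c i j) ({..<N} \<times> {..<m})" and m: "1 \<le> m"
    and Q: "\<And>i. i < N \<Longrightarrow> c i ` {..<m} \<subseteq> Q i \<and> Q i \<subseteq> verts G \<and> cut_connected (edges G) (Q i)"
    and dj: "\<And>i j. i < N \<Longrightarrow> j < N \<Longrightarrow> i \<noteq> j \<Longrightarrow> Q i \<inter> Q j = {}"
    and p: "0 \<le> p" "p \<le> 1" and t: "1 \<le> t" "2 * (r * t) \<le> N"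
    and Bad: "Bad = {(xs, ys). set xs \<subseteq> {..<N} \<and> length xs = t \<and> set ys \<subseteq> {..<N} \<and> length ys = t \<and>
      (\<forall>j\<in>set ys. Q j \<inter> (\<Union>i\<in>set xs. {v \<in> \<Gamma>. nbr (edges G) v \<inter> c i ` {..<m} \<noteq> {}}) = {})}"
  shows "measure_pmf.prob (Pi_pmf (all_pairs (verts G)) False (\<lambda>_. bernoulli_pmf p))
      {b. hadwiger_number (graph_union G \<lparr>verts = verts G, edges = {e \<in> all_pairs (verts G). b e}\<rparr>) < r}
    \<le> 4 ^ N * exp (- (p * (real N * real m)\<^sup>2 / 16)) +
      real (r ^ 2) * (real (card Bad) * fact (N - 2 * t) / fact N)"
proof -
  let ?V = "verts G"
  let ?M = "Pi_pmf (all_pairs ?V) False (\<lambda>_. bernoulli_pmf p)"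
  define K where "K b = graph_union G \<lparr>verts = ?V, edges = {e \<in> all_pairs ?V. b e}\<rparr>" for b
  define P where "P = {\<pi>. \<pi> permutes {..<N}}"
  \<comment> \<open>The inverse makes \<open>h \<pi> b\<close> hold at
    \<open>{c (\<pi> i) x, c (\<pi> j) y}\<close> iff \<open>b\<close> holds at
    \<open>{c i x, c j y}\<close>, so paths are carried along by \<open>\<pi>\<close>
    itself.\<close>
  define h where "h \<pi> b = b \<circ> image (relabel c N m (inv \<pi>))" for \<pi> :: "nat \<Rightarrow> nat" and b :: "'a set \<Rightarrow> bool"
  define A where "A = {b. hadwiger_number (K b) < r}"
  define B0 where "B0 = {b. \<exists>X Y. X \<subseteq> {..<N} \<and> Y \<subseteq> {..<N} \<and> X \<inter> Y = {} \<and> N \<le> 4 * card X \<and> N \<le> 4 * card Y \<and>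
       (\<forall>x\<in>X. \<forall>y\<in>Y. \<forall>i<m. \<forall>j<m. \<not> b {c x i, c y j})}"
  have V: "finite ?V" using sg by (simp add: simple_graph_def)
  have sub: "c i ` {..<m} \<subseteq> ?V" if "i < N" for i using Q[OF that] by blast
  have finP: "finite P" unfolding P_def by (intro finite_permutations) simp
  have cardP: "card P = fact N" unfolding P_def by (simp add: card_permutations)
  have Pne: "P \<noteq> {}" unfolding P_def using permutes_id by blast
  have finBad: "finite Bad"
  proof (rule finite_subset)
    show "Bad \<subseteq> {xs. set xs \<subseteq> {..<N} \<and> length xs = t} \<times> {xs. set xs \<subseteq> {..<N} \<and> length xs = t}"
      unfolding Bad by auto
  qed (auto intro: finite_lists_length_eq)
  have vK: "verts (K b) = ?V" for b by (simp add: K_def graph_union_def)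
  have eK: "edges (K b) = edges G \<union> {e \<in> all_pairs ?V. b e}" for b by (simp add: K_def graph_union_def)
  have sgK: "simple_graph (K b)" for b using sg by (auto simp: simple_graph_def vK eK)
  have bad: "real (card {\<pi> \<in> P. h \<pi> b \<in> A}) \<le> real (r ^ 2) * (real (card Bad) * fact (N - 2 * t) / fact N) * real (card P)"
    if b: "b \<notin> B0" for b
  proof -
    \<comment> \<open>\<open>b\<close> is an arbitrary function on sets of vertices;
      \<open>i \<noteq> j\<close> ensures that the two witnesses are distinct and form an element of
      \<open>all_pairs\<close>.\<close>
    let ?adj = "\<lambda>i j. i \<noteq> j \<and> (\<exists>x<m. \<exists>y<m. b {c i x, c j y})"
    have "\<exists>ps. distinct ps \<and> set ps \<subseteq> {..<N} \<and> successively ?adj ps \<and> card {..<N} \<le> 2 * length ps"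
    proof (rule long_path)
      show "?adj y x" if "?adj x y" for x y using that by (auto simp: insert_commute)
      fix X Y assume *: "X \<subseteq> {..<N}" "Y \<subseteq> {..<N}" "X \<inter> Y = {}" "card {..<N} \<le> 4 * card X" "card {..<N} \<le> 4 * card Y"
      have "\<not> (\<forall>x\<in>X. \<forall>y\<in>Y. \<forall>i<m. \<forall>j<m. \<not> b {c x i, c y j})"
        using b * unfolding B0_def by simp
      then obtain x y i j where xy: "x \<in> X" "y \<in> Y" "i < m" "j < m" "b {c x i, c y j}" by auto
      moreover have "x \<noteq> y" using xy(1,2) *(3) by auto
      ultimately show "\<exists>x\<in>X. \<exists>y\<in>Y. ?adj x y" by auto
    qed simp
    then obtain ps where ps: "distinct ps" "set ps \<subseteq> {..<N}" "successively ?adj ps" "N \<le> 2 * length ps" by auto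
    have len: "r * t \<le> length ps" using t(2) ps(4) by linarith
    define R where "R = {(a, a'). a < a' \<and> a' < r}"
    have Rsub: "R \<subseteq> {..<r} \<times> {..<r}" by (auto simp: R_def)
    then have finR: "finite R" by (rule finite_subset) simp
    have cardR: "card R \<le> r ^ 2"
      using card_mono[OF _ Rsub] by (simp add: card_cartesian_product power2_eq_square)
    define S where "S z w = {\<pi>. \<pi> permutes {..<N} \<and>
        map \<pi> (segment t ps (fst z) @ segment t ps (snd z)) = fst w @ snd w}"
      for z :: "nat \<times> nat" and w :: "nat list \<times> nat list"
    \<comment> \<open>Random edges only supply the path, and different segments are to be joined by
      edges of \<open>G\<close>. Hence a failure for \<open>\<pi>\<close> means that some pair of
      mapped segments lies in \<open>Bad\<close>.\<close>
    have "{\<pi> \<in> P. h \<pi> b \<in> A} \<subseteq> (\<Union>z\<in>R. \<Union>w\<in>Bad. S z w)"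
    proof
      fix \<pi> assume "\<pi> \<in> {\<pi> \<in> P. h \<pi> b \<in> A}"
      then have \<pi>: "\<pi> permutes {..<N}" and lt: "hadwiger_number (K (h \<pi> b)) < r" by (auto simp: P_def A_def)
      have \<pi>N: "\<pi> i < N" if "i < N" for i using permutes_in_image[OF \<pi>, of i] that by simp
      have "\<exists>z\<in>R. (map \<pi> (segment t ps (fst z)), map \<pi> (segment t ps (snd z))) \<in> Bad"
      proof (rule ccontr)
        assume no: "\<not> ?thesis"
        let ?ps = "map \<pi> ps"
        have lenp: "r * t \<le> length ?ps" using len by simp
        have setp: "set ?ps \<subseteq> {..<N}" using ps(2) \<pi>N by auto
        have "r \<le> hadwiger_number (K (h \<pi> b))"
        proof (rule hadwiger_number_ge_segments[OF sgK t(1), where ps = ?ps and N = N and Q = Q])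
          show "Q i \<noteq> {}" if "i < N" for i
          proof -
            have "c i 0 \<in> c i ` {..<m}" using m by (intro imageI) simp
            then show ?thesis using Q[OF that] by blast
          qed
          show "Q i \<subseteq> verts (K (h \<pi> b))" if "i < N" for i using Q[OF that] by (simp add: vK)
          show "cut_connected (edges (K (h \<pi> b))) (Q i)" if "i < N" for i
            by (rule cut_connected_mono[of "edges G"]) (use Q[OF that] in \<open>simp_all add: eK\<close>)
          show "Q i \<inter> Q j = {}" if "i < N" "j < N" "i \<noteq> j" for i j by (rule dj[OF that])
          show "distinct ?ps" using ps(1) permutes_inj[OF \<pi>] by (simp add: distinct_map inj_on_def)
          show "set ?ps \<subseteq> {..<N}" by (rule setp)
          show "r * t \<le> length ?ps" by (rule lenp)
          show "successively (\<lambda>i j. \<exists>x\<in>Q i. \<exists>y\<in>Q j. {x, y} \<in> edges (K (h \<pi> b))) ?ps"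
            unfolding successively_map
          proof (rule successively_mono[OF ps(3)])
            fix i j assume ij: "i \<in> set ps" "j \<in> set ps" "?adj i j"
            then obtain x y where xy: "x < m" "y < m" "b {c i x, c j y}" and "i \<noteq> j" by blast
            have lt: "i < N" "j < N" using ij ps(2) by auto
            have mem: "c (\<pi> i) x \<in> Q (\<pi> i)" "c (\<pi> j) y \<in> Q (\<pi> j)"
              using Q[OF \<pi>N[OF lt(1)]] Q[OF \<pi>N[OF lt(2)]] xy by auto
            have "\<pi> i \<noteq> \<pi> j" using permutes_inj[OF \<pi>] \<open>i \<noteq> j\<close> by (auto simp: inj_def)
            then have "c (\<pi> i) x \<noteq> c (\<pi> j) y" using dj[OF \<pi>N[OF lt(1)] \<pi>N[OF lt(2)]] mem by auto
            moreover have "c (\<pi> i) x \<in> ?V" "c (\<pi> j) y \<in> ?V" using mem Q \<pi>N lt by blast+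
            moreover have "h \<pi> b {c (\<pi> i) x, c (\<pi> j) y}"
              using xy lt \<pi>N permutes_inverses(2)[OF \<pi>] by (simp add: h_def relabel_core[OF inj])
            ultimately have "{c (\<pi> i) x, c (\<pi> j) y} \<in> edges (K (h \<pi> b))" by (simp add: eK all_pairs_iff)
            then show "\<exists>x\<in>Q (\<pi> i). \<exists>y\<in>Q (\<pi> j). {x, y} \<in> edges (K (h \<pi> b))" using mem by blast
          qed
          fix a a' assume a: "a < r" "a' < r" "a < a'"
          let ?xs = "segment t ?ps a" and ?ys = "segment t ?ps a'"
          have "(a, a') \<in> R" using a by (simp add: R_def)
          then have "(map \<pi> (segment t ps a), map \<pi> (segment t ps a')) \<notin> Bad" using no by auto
          then have "(?xs, ?ys) \<notin> Bad" using segment_map[OF len a(1), of \<pi>] segment_map[OF len a(2), of \<pi>] by simp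
          moreover have xs: "set ?xs \<subseteq> {..<N}" and ys: "set ?ys \<subseteq> {..<N}"
            using set_segment_subset[OF lenp a(1)] set_segment_subset[OF lenp a(2)] setp by auto
          ultimately have "\<not> (\<forall>j\<in>set ?ys. Q j \<inter> (\<Union>i\<in>set ?xs. {v \<in> \<Gamma>. nbr (edges G) v \<inter> c i ` {..<m} \<noteq> {}}) = {})"
            unfolding Bad by (simp only: mem_Collect_eq case_prod_conv length_segment simp_thms)
          then obtain j v i u where j: "j \<in> set ?ys"
            and v: "v \<in> Q j" "i \<in> set ?xs" "u \<in> nbr (edges G) v" "u \<in> c i ` {..<m}" by blast
          have "i < N" using v(2) xs by auto
          then have "u \<in> Q i" using Q[of i] v(4) by auto
          moreover have "{u, v} \<in> edges (K (h \<pi> b))" using v(3) by (simp add: eK nbr_def)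
          ultimately show "\<exists>i\<in>set ?xs. \<exists>j\<in>set ?ys. \<exists>u\<in>Q i. \<exists>v\<in>Q j. {u, v} \<in> edges (K (h \<pi> b))"
            using j(1) v(1,2) by blast
        qed
        then show False using lt by simp
      qed
      then obtain z where "z \<in> R" "(map \<pi> (segment t ps (fst z)), map \<pi> (segment t ps (snd z))) \<in> Bad" by blast
      then show "\<pi> \<in> (\<Union>z\<in>R. \<Union>w\<in>Bad. S z w)"
        using \<pi> by (intro UN_I) (auto simp: S_def)
    qed
    moreover have finS: "finite (S z w)" for z w
      by (rule finite_subset[OF _ finP]) (auto simp: S_def P_def)
    ultimately have "card {\<pi> \<in> P. h \<pi> b \<in> A} \<le> card (\<Union>z\<in>R. \<Union>w\<in>Bad. S z w)"
      using finR finBad by (intro card_mono) auto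
    also have "\<dots> \<le> (\<Sum>z\<in>R. card (\<Union>w\<in>Bad. S z w))" by (rule card_UN_le[OF finR])
    also have "\<dots> \<le> (\<Sum>z\<in>R. \<Sum>w\<in>Bad. card (S z w))" by (intro sum_mono card_UN_le[OF finBad])
    also have "\<dots> \<le> (\<Sum>z\<in>R. \<Sum>w\<in>Bad. fact (N - 2 * t))"
    proof (intro sum_mono)
      fix z w assume z: "z \<in> R"
      let ?zs = "segment t ps (fst z) @ segment t ps (snd z)"
      have z': "fst z < r" "snd z < r" "fst z \<noteq> snd z" using z by (auto simp: R_def)
      have "set ?zs \<subseteq> {..<N}"
        using set_segment_subset[OF len z'(1)] set_segment_subset[OF len z'(2)] ps(2) by auto
      then have "card (S z w) \<le> fact (card {..<N} - length ?zs)"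
        unfolding S_def by (rule card_permutes_prefix[OF finite_lessThan distinct_segments[OF len z' ps(1)]])
      then show "card (S z w) \<le> fact (N - 2 * t)" by (simp add: mult_2)
    qed
    also have "\<dots> = card R * (card Bad * fact (N - 2 * t))" by simp
    also have "\<dots> \<le> r ^ 2 * (card Bad * fact (N - 2 * t))" using cardR by (intro mult_le_mono1)
    finally have "real (card {\<pi> \<in> P. h \<pi> b \<in> A}) \<le> real (r ^ 2 * (card Bad * fact (N - 2 * t)))"
      by (simp only: of_nat_le_iff)
    then show ?thesis by (simp add: cardP)
  qed
  have "measure_pmf.prob ?M A \<le> measure_pmf.prob ?M B0 + real (r ^ 2) * (real (card Bad) * fact (N - 2 * t) / fact N)"
  proof (rule prob_average_bound[OF finP Pne _ bad])
    fix \<pi> assume "\<pi> \<in> P"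
    then have "inv \<pi> permutes {..<N}" by (auto simp: P_def intro: permutes_inv)
    then have "relabel c N m (inv \<pi>) permutes ?V" by (rule relabel_permutes[OF inj _ sub])
    then show "map_pmf (h \<pi>) ?M = ?M" unfolding h_def by (rule Pi_pmf_all_pairs_relabel[OF V])
  qed simp_all
  also have "measure_pmf.prob ?M B0 \<le> 4 ^ N * exp (- (p * (real N * real m)\<^sup>2 / 16))"
    unfolding B0_def by (rule prob_no_expansion[OF V inj sub p])
  finally show ?thesis by (simp add: A_def K_def)
qed

text \<open>The price of counting bad sequences with repetition although a permutation yields
  distinct cores. Each of the \<open>2 * t\<close> factors of the falling factorial is at least
  \<open>N * (1 - x)\<close> with \<open>x = 2 * t / N <= 1 / 2\<close>, and
  \<open>1 / (1 - x) <= 1 + 2 * x <= exp (2 * x)\<close>.\<close>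

lemma falling_ratio:
  assumes "4 * t \<le> N" "0 < N"
  shows "real N ^ (2 * t) * fact (N - 2 * t) / fact N \<le> exp (8 * real t ^ 2 / real N)"
proof -
  let ?x = "2 * real t / real N"
  have x: "0 \<le> ?x" "?x \<le> 1 / 2" using assms by (auto simp: field_simps)
  have K: "real (N - 2 * t) = real N * (1 - ?x)" using assms by (simp add: of_nat_diff field_simps)
  have "real ((N - 2 * t) ^ (2 * t) * fact (N - 2 * t)) \<le> real (fact (N - 2 * t + 2 * t))"
    using fact_falling_ge of_nat_le_iff by blast
  then have 1: "real (N - 2 * t) ^ (2 * t) * fact (N - 2 * t) \<le> fact N" using assms by simp
  have "1 \<le> (1 - ?x) * (1 + 2 * ?x)"
    using x mult_nonneg_nonneg[of ?x "1 - 2 * ?x"] by (simp add: algebra_simps)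
  also have "\<dots> \<le> (1 - ?x) * exp (2 * ?x)"
    using x exp_ge_add_one_self[of "2 * ?x"] by (intro mult_left_mono) auto
  finally have "real N * 1 \<le> real N * ((1 - ?x) * exp (2 * ?x))" by (rule mult_left_mono) simp
  then have "real N \<le> real (N - 2 * t) * exp (2 * ?x)" unfolding K by (simp add: mult.assoc)
  then have "real N ^ (2 * t) \<le> (real (N - 2 * t) * exp (2 * ?x)) ^ (2 * t)" by (rule power_mono) simp
  also have "\<dots> = real (N - 2 * t) ^ (2 * t) * exp (8 * real t ^ 2 / real N)"
    by (simp add: power_mult_distrib exp_of_nat_mult[symmetric] power2_eq_square)
  finally have "real N ^ (2 * t) * fact (N - 2 * t) \<le>
      real (N - 2 * t) ^ (2 * t) * exp (8 * real t ^ 2 / real N) * fact (N - 2 * t)"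
    by (rule mult_right_mono) simp
  also have "\<dots> = (real (N - 2 * t) ^ (2 * t) * fact (N - 2 * t)) * exp (8 * real t ^ 2 / real N)" by simp
  also have "\<dots> \<le> fact N * exp (8 * real t ^ 2 / real N)" using 1 by (rule mult_right_mono) simp
  finally show ?thesis by (simp add: divide_le_eq mult.commute)
qed

text \<open>The left-hand side is the exponent in \<open>card_non_hitting_pairs\<close> for cores of size \<open>10 k\<close> and pieces
  of size at most \<open>20 k\<close>.\<close>

lemma decay_rate_bound:
  fixes n k a L d N t g lam :: real
  assumes k: "1 \<le> k" and L: "1 \<le> L" and a: "0 < a" and d: "1 \<le> d" "n \<le> a * (d + 1)"
    and N: "0 < N" "10 * k * N \<le> n" and g: "n \<le> 25 * g"
    and t: "10000 * (a * L) \<le> t ^ 2" "10000 * (k * L) \<le> t" and lam: "lam = t / (20 * k * N)"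
  shows "5 * L \<le> t * (lam * (d / (2 * (10 * k))) * g / (2 * N * (1 + lam * (10 * k * d))))"
proof -
  have k0: "k > 0" using k by linarith
  have "k * L > 0" using k0 L by simp
  then have t0: "t > 0" using t(2) by linarith
  have n0: "n > 0" using N k0 by (smt (verit) mult_pos_pos)
  \<comment> \<open>\<open>X\<close> is the factor \<open>1 + lam * D\<close> from the exponential
    moment. Its summand 1 is controlled by \<open>10000 * (a * L) <= t ^ 2\<close>, its summand
    \<open>t * d / (2 * N)\<close> by \<open>10000 * (k * L) <= t\<close>.\<close>
  define X where "X = 1 + t * d / (2 * N)"
  have X0: "X > 0" using t0 d N by (simp add: X_def add_pos_nonneg)
  have lamX: "1 + lam * (10 * k * d) = X" using k0 N by (simp add: lam X_def field_simps)
  have eq: "t * (lam * (d / (2 * (10 * k))) * g / (2 * N * (1 + lam * (10 * k * d)))) =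
      t ^ 2 * d * g / (8 * (10 * k * N) ^ 2 * X)"
    unfolding lamX unfolding lam using k0 N X0 by (simp add: field_simps power2_eq_square)
  have "2 * n \<le> a * (2 * d + 2)" using d(2) by (simp add: algebra_simps)
  also have "\<dots> \<le> a * (4 * d)" using a d by (intro mult_left_mono) auto
  finally have "n \<le> 2 * (a * d)" by simp
  then have "L * n \<le> L * (2 * (a * d))" using L by (intro mult_left_mono) auto
  moreover have "10000 * (a * L) * d \<le> t ^ 2 * d" using t(1) d by (intro mult_right_mono) auto
  moreover have "0 \<le> L * (a * d)" using L a d by simp
  ultimately have 1: "2000 * (L * n) \<le> t ^ 2 * d" by (simp add: mult_ac)
  have 2: "10000 * (k * L) * (t * d) \<le> t ^ 2 * d"
  proof -
    have "10000 * (k * L) * (t * d) \<le> t * (t * d)" using t(2) t0 d by (intro mult_right_mono) auto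
    then show ?thesis by (simp add: power2_eq_square)
  qed
  have 3: "(10 * k * N) * X = 10 * k * N + 5 * k * (t * d)" using N by (simp add: X_def field_simps)
  have "1000 * L * ((10 * k * N) * X) \<le> t ^ 2 * d"
  proof -
    have "1000 * L * (10 * k * N) \<le> 1000 * L * n" using N L by (intro mult_left_mono) auto
    then show ?thesis using 1 2 unfolding 3 by (simp add: algebra_simps)
  qed
  then have 4: "(1000 * L * ((10 * k * N) * X)) * g \<le> t ^ 2 * d * g"
    using g n0 by (intro mult_right_mono) auto
  have "5 * L * (8 * (10 * k * N) ^ 2 * X) = 40 * L * ((10 * k * N) * X) * (10 * k * N)"
    by (simp add: power2_eq_square)
  also have "\<dots> \<le> 40 * L * ((10 * k * N) * X) * (25 * g)"
  proof (rule mult_left_mono)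
    show "10 * k * N \<le> 25 * g" using N(2) g by linarith
  qed (use N L k0 X0 in simp)
  also have "\<dots> \<le> t ^ 2 * d * g" using 4 by (simp add: mult_ac)
  finally have "5 * L * (8 * (10 * k * N) ^ 2 * X) \<le> t ^ 2 * d * g" .
  then show ?thesis unfolding eq using k0 N X0 by (subst pos_le_divide_eq) auto
qed

section \<open>Hadwiger number against chromatic number\<close>

lemma card_core_nbrs_le:
  assumes "finite V" "E \<subseteq> all_pairs V" "\<And>v. v \<in> V \<Longrightarrow> card (nbr E v) = d" "C \<subseteq> V" "card C \<le> m"
  shows "card {v \<in> \<Gamma>. nbr E v \<inter> C \<noteq> {}} \<le> m * d"
proof -
  have finC: "finite C" using assms(1,4) finite_subset by blast
  have finN: "finite (nbr E u)" for u using nbr_subset[OF assms(2)] assms(1) finite_subset by blast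
  have "{v \<in> \<Gamma>. nbr E v \<inter> C \<noteq> {}} \<subseteq> (\<Union>u\<in>C. nbr E u)" by (auto simp: nbr_sym)
  then have "card {v \<in> \<Gamma>. nbr E v \<inter> C \<noteq> {}} \<le> card (\<Union>u\<in>C. nbr E u)"
    using finC finN by (intro card_mono) auto
  also have "\<dots> \<le> (\<Sum>u\<in>C. card (nbr E u))" using finC by (rule card_UN_le)
  also have "\<dots> = (\<Sum>u\<in>C. d)" using assms(3,4) by (intro sum.cong) auto
  also have "\<dots> \<le> m * d" using assms(5) by (simp add: mult_le_mono1)
  finally show ?thesis .
qed

lemma card_le_cores_hit:
  fixes N :: nat
  assumes "\<And>i. i < N \<Longrightarrow> finite (C i) \<and> card (C i) \<le> m"
  shows "card (A \<inter> (\<Union>i<N. C i)) \<le> m * card {i \<in> {..<N}. A \<inter> C i \<noteq> {}}"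
proof -
  let ?H = "{i \<in> {..<N}. A \<inter> C i \<noteq> {}}"
  have "A \<inter> (\<Union>i<N. C i) \<subseteq> (\<Union>i\<in>?H. C i)" by auto
  moreover have "finite ?H" by (rule finite_subset[of _ "{..<N}"]) auto
  ultimately have "card (A \<inter> (\<Union>i<N. C i)) \<le> card (\<Union>i\<in>?H. C i)"
    using assms by (intro card_mono finite_UN_I) simp_all
  also have "\<dots> \<le> (\<Sum>i\<in>?H. card (C i))" by (rule card_UN_le) simp
  also have "\<dots> \<le> (\<Sum>i\<in>?H. m)" using assms by (intro sum_mono) auto
  finally show ?thesis by (simp add: mult.commute)
qed

text \<open>Rests on \<open>4 <= exp (3 / 2)\<close>: the Taylor bound
  \<open>13 / 8 = 1 + 1 / 2 + 1 / 8\<close> for \<open>exp (1 / 2)\<close> has a cube above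
  4.\<close>

lemma four_power_exp_bound:
  assumes "0 < N" shows "4 ^ N * exp (- (2 * real N)) \<le> 2 / real N"
proof -
  have "(13 / 8 :: real) ^ 3 \<le> exp (1 / 2) ^ 3"
    using exp_lower_Taylor_quadratic[of "1 / 2 :: real"] by (intro power_mono) (auto simp: power2_eq_square)
  also have "\<dots> = exp (3 / 2)" by (simp add: exp_of_nat_mult[symmetric])
  finally have "(4 :: real) \<le> exp (3 / 2)" by (simp add: power3_eq_cube)
  then have "4 ^ N * exp (- (2 * real N)) \<le> exp (3 / 2) ^ N * exp (- (2 * real N))"
    by (intro mult_right_mono power_mono) auto
  also have "\<dots> = exp (- (real N / 2))" by (simp add: exp_of_nat_mult[symmetric] exp_add[symmetric])
  also have "\<dots> \<le> 1 / (1 + real N / 2)"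
    using exp_ge_add_one_self[of "real N / 2"] by (simp add: exp_minus inverse_eq_divide frac_le)
  also have "\<dots> \<le> 1 / (real N / 2)" using assms by (intro divide_left_mono) auto
  finally show ?thesis by simp
qed

text \<open>Here all parameters are fixed. The target \<open>3 * (n / a * L + 1)\<close> is three
  times the colour bound of \<open>vertex_transitive_colouring\<close>; \<open>1 / L\<close> covers
  missing expansion and \<open>2 / n ^ 2\<close> unjoined segments.\<close>

lemma prob_hadwiger_small:
  fixes G :: "'a ugraph" and k :: nat and n a L :: real
  defines "n \<equiv> real (card (verts G))" and "a \<equiv> real (independence_number G)"
  defines "L \<equiv> ln n"
  assumes sg: "simple_graph G" and vt: "vertex_transitive G" and k: "8 < k" and L: "1 \<le> L"
    and lower: "1000000000000 * real k ^ 2 * L ^ 3 \<le> a" and upper: "a \<le> n / (100000000 * real k)"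
  shows "\<exists>r. 3 * (n / a * L + 1) \<le> real r \<and>
    measure_pmf.prob (Pi_pmf (all_pairs (verts G)) False (\<lambda>_. bernoulli_pmf (8 / (n * real k))))
      {b. hadwiger_number (graph_union G \<lparr>verts = verts G, edges = {e \<in> all_pairs (verts G). b e}\<rparr>) < r}
    \<le> 1 / L + 2 / n ^ 2"
proof -
  let ?k = "real k"
  let ?V = "verts G" and ?E = "edges G"
  have k1: "?k \<ge> 9" using k by simp
  have L0: "L > 0" using L by simp
  have Lp: "1 \<le> L ^ 2" "1 \<le> L ^ 3" "L \<le> L ^ 3" "L \<le> L ^ 2"
    using L one_le_power[of L] self_le_power[of L 3] self_le_power[of L 2] by auto
  have kk: "?k \<le> ?k ^ 2" using k1 self_le_power[of ?k 2] by simp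
  have a_kL: "1000000000000 * (?k * L) \<le> a"
  proof -
    have "?k * L \<le> ?k ^ 2 * L ^ 3" using kk Lp L0 by (intro mult_mono) auto
    then show ?thesis using lower by linarith
  qed
  have a1: "a \<ge> 1000000000000"
  proof -
    have "1 * 1 \<le> ?k * L" using k1 L by (intro mult_mono) auto
    then show ?thesis using a_kL by linarith
  qed
  have ak: "100000000 * (a * ?k) \<le> n" using upper k1 by (simp add: field_simps)
  have na: "100000000 * ?k \<le> n / a" using ak a1 by (simp add: field_simps)
  have n0: "n > 0" using ak a1 k1 mult_pos_pos[of a ?k] by linarith
  have n1: "n \<ge> 1" using n0 by (simp add: n_def)
  have V: "finite ?V" and E: "?E \<subseteq> all_pairs ?V" using sg by (auto simp: simple_graph_def)
  obtain d where d: "\<And>v. v \<in> ?V \<Longrightarrow> card (nbr ?E v) = d" using vertex_transitive_regular[OF sg vt] by blast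
  have "card ?V \<le> independence_number G * Suc d" using d by (intro card_le_independence_number_degree[OF sg]) auto
  then have "n \<le> real (independence_number G * Suc d)" unfolding n_def by (simp only: of_nat_le_iff)
  then have nd: "n \<le> a * (real d + 1)" by (simp add: a_def algebra_simps)
  then have "n / a \<le> real d + 1" using a1 by (simp add: field_simps)
  then have dk: "100000000 * ?k \<le> real d + 1" using na by linarith
  then have d3: "3 * (10 * k) \<le> d" using k1 by linarith
  define m where "m = 10 * k"
  have m1: "1 \<le> m" using k by (simp add: m_def)
  show ?thesis
  proof (rule piece_structure[OF V E d m1 d3[folded m_def]])
    fix N c Q \<Gamma>
    assume inj: "inj_on (\<lambda>(i, j). c i j) ({..<N} \<times> {..<m})"
      and N: "2 * card ?V \<le> 5 * (N * m)" "N * m \<le> card ?V"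
      and Q: "\<And>i. i < N \<Longrightarrow> c i ` {..<m} \<subseteq> Q i \<and> Q i \<subseteq> ?V \<and> card (Q i) \<le> 2 * m \<and> cut_connected ?E (Q i)"
      and dj: "\<And>i j. i < N \<Longrightarrow> j < N \<Longrightarrow> i \<noteq> j \<Longrightarrow> Q i \<inter> Q j = {}"
      and \<Gamma>: "\<Gamma> \<subseteq> (\<Union>i<N. Q i)" "card ?V \<le> 25 * card \<Gamma>"
        "\<And>v. v \<in> \<Gamma> \<Longrightarrow> d \<le> 2 * card (nbr ?E v \<inter> (\<Union>i<N. c i ` {..<m}))"
    have N25: "n \<le> 25 * (?k * real N)"
    proof -
      have "real (2 * card ?V) \<le> real (5 * (N * m))" using N(1) by (simp only: of_nat_le_iff)
      then show ?thesis by (simp add: n_def m_def mult_ac)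
    qed
    have Nn: "10 * ?k * real N \<le> n"
    proof -
      have "real (N * m) \<le> real (card ?V)" using N(2) by (simp only: of_nat_le_iff)
      then show ?thesis by (simp add: n_def m_def mult_ac)
    qed
    have N0: "0 < N"
    proof (rule ccontr)
      assume "\<not> 0 < N"
      then show False using N25 n0 by simp
    qed
    have Nn': "real N \<le> n"
    proof -
      have "1 * real N \<le> 10 * ?k * real N" using k1 by (intro mult_right_mono) auto
      then show ?thesis using Nn by linarith
    qed
    define s where "s = sqrt (a * L)"
    have s2: "s ^ 2 = a * L" using a1 L0 by (simp add: s_def)
    \<comment> \<open>The square root of \<open>lower\<close> multiplied by \<open>L\<close>; this
      is where the powers \<open>k ^ 2\<close> and \<open>L ^ 3\<close> of the hypothesis are
      spent.\<close>
    have s_kL: "1000000 * (?k * L ^ 2) \<le> s"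
    proof -
      have "(1000000 * (?k * L ^ 2)) ^ 2 = 1000000000000 * ?k ^ 2 * L ^ 3 * L" by (simp add: power_mult_distrib power2_eq_square power3_eq_cube)
      also have "\<dots> \<le> a * L" using lower L0 by (intro mult_right_mono) auto
      finally show ?thesis unfolding s_def by (rule real_le_rsqrt)
    qed
    have s_L: "1000000 * L \<le> s"
    proof -
      have "1 * L \<le> ?k * L ^ 2" using k1 Lp L0 by (intro mult_mono) auto
      then show ?thesis using s_kL by linarith
    qed
    define t where "t = nat \<lceil>100 * s\<rceil>"
    have s1: "s \<ge> 1" using s_L L by linarith
    have t1: "100 * s \<le> real t" and t2: "real t \<le> 101 * s" unfolding t_def using s1 by linarith+
    have t0: "real t > 0" using t1 s1 by linarith
    have tsq_low: "10000 * (a * L) \<le> real t ^ 2"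
    proof -
      have "10000 * (a * L) = (100 * s) ^ 2" unfolding power_mult_distrib s2 by simp
      also have "\<dots> \<le> real t ^ 2" using t1 s1 by (intro power_mono) auto
      finally show ?thesis .
    qed
    have tsq_up: "real t ^ 2 \<le> 10201 * (a * L)"
    proof -
      have "real t ^ 2 \<le> (101 * s) ^ 2" using t2 by (intro power_mono) auto
      also have "\<dots> = 10201 * (a * L)" unfolding power_mult_distrib s2 by simp
      finally show ?thesis .
    qed
    have t_kL: "10000 * (?k * L) \<le> real t"
    proof -
      have "?k * L \<le> ?k * L ^ 2" using Lp k1 by (intro mult_left_mono) auto
      then show ?thesis using s_kL t1 by linarith
    qed
    \<comment> \<open>\<open>upper\<close> gives \<open>N >= 4000000 * a\<close>, so
      \<open>t ^ 2 / N\<close> is a small multiple of \<open>L\<close>, and the loss in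
      \<open>falling_ratio\<close> is at most \<open>exp L = n\<close>.\<close>
    have ratio: "8 * real t ^ 2 / real N \<le> L"
    proof -
      have "8 * real t ^ 2 \<le> 81608 * (a * L)" using tsq_up by linarith
      also have "\<dots> = 81608 * a * L" by simp
      also have "\<dots> \<le> real N * L"
      proof (rule mult_right_mono)
        have "100000000 * (a * ?k) \<le> 25 * real N * ?k" using ak N25 by (simp add: mult_ac)
        then have "(100000000 * a) * ?k \<le> (25 * real N) * ?k" by (simp add: mult_ac)
        then have "100000000 * a \<le> 25 * real N" using k1 by (simp only: mult_le_cancel_right_pos) 
        then show "81608 * a \<le> real N" using a1 by simp
      qed (use L0 in simp)
      finally show ?thesis using N0 by (simp add: field_simps)
    qed
    have t4N: "4 * t \<le> N"
    proof -
      have "8 * real t * real t \<le> L * real N" using ratio N0 by (simp add: field_simps power2_eq_square)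
      moreover have "L * real N \<le> real t * real N / 2"
      proof -
        have "L \<le> real t / 2" using t1 s_L L by linarith
        then have "L * real N \<le> real t / 2 * real N" by (intro mult_right_mono) auto
        then show ?thesis by simp
      qed
      ultimately have "real t * (8 * real t) \<le> real t * (real N / 2)" by (simp add: mult_ac)
      then have "8 * real t \<le> real N / 2" using t0 by (simp only: mult_le_cancel_left_pos)
      then show ?thesis by linarith
    qed
    \<comment> \<open>The path has at least \<open>N / 2\<close> cores, which leaves room for
      \<open>N div (2 * t)\<close> disjoint segments of length \<open>t\<close>.\<close>
    define r where "r = N div (2 * t)"
    have rt: "2 * (r * t) \<le> N" unfolding r_def using div_times_less_eq_dividend[of N "2 * t"] by (simp add: mult_ac)
    have rN: "r \<le> N" unfolding r_def by (rule div_le_dividend)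
    have tn0: "t > 0" using t0 by simp
    \<comment> \<open>The starting point is \<open>r + 1 >= n / (5050 * k * s)\<close>. Expanding by
      \<open>s\<close> and using \<open>s ^ 2 = a * L\<close> and \<open>s_kL\<close> gives
      \<open>r + 1 >= 198 * (n / a * L)\<close>; the surplus over the factor 3 absorbs the additive
      terms.\<close>
    have r_low: "3 * (n / a * L + 1) \<le> real r"
    proof -
      have "N < (r + 1) * (2 * t)" unfolding r_def using tn0 by (simp add: dividend_less_div_times)
      then have "real N < real ((r + 1) * (2 * t))" by (simp only: of_nat_less_iff)
      then have "real N < (real r + 1) * (2 * real t)" by (simp add: algebra_simps)
      also have "\<dots> \<le> (real r + 1) * (202 * s)" using t2 by (intro mult_left_mono) auto
      finally have "?k * real N \<le> ?k * ((real r + 1) * (202 * s))" using k1 by (intro mult_left_mono) auto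
      also have "\<dots> = 202 * (?k * s * (real r + 1))" by simp
      finally have "n \<le> 5050 * (?k * s * (real r + 1))" using N25 by linarith
      then have "n * L * s \<le> 5050 * (?k * s * (real r + 1)) * L * s" using L0 s1 by (intro mult_right_mono) auto
      also have "\<dots> = 5050 * ((?k * L) * s ^ 2 * (real r + 1))" by (simp add: power2_eq_square mult_ac)
      also have "\<dots> = 5050 * (a * (?k * L ^ 2) * (real r + 1))" unfolding s2 by (simp add: power2_eq_square mult_ac)
      finally have 1: "n * L * s \<le> 5050 * (a * (?k * L ^ 2) * (real r + 1))" .
      have "(?k * L ^ 2) * (1000000 * (n * L)) = n * L * (1000000 * (?k * L ^ 2))" by simp
      also have "\<dots> \<le> n * L * s" using s_kL n0 L0 by (intro mult_left_mono) auto
      also note 1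
      also have "5050 * (a * (?k * L ^ 2) * (real r + 1)) = (?k * L ^ 2) * (5050 * (a * (real r + 1)))" by simp
      finally have "(?k * L ^ 2) * (1000000 * (n * L)) \<le> (?k * L ^ 2) * (5050 * (a * (real r + 1)))" .
      then have "1000000 * (n * L) \<le> 5050 * (a * (real r + 1))"
        by (rule mult_left_le_imp_le) (use k1 L0 in simp)
      moreover have "5050 * (198 * (n * L)) \<le> 1000000 * (n * L)" using n0 L0 by simp
      ultimately have "198 * (n * L) \<le> a * (real r + 1)" by linarith
      then have "198 * (n * L) / a \<le> real r + 1" using a1 by (simp add: divide_le_eq mult.commute)
      then have "198 * (n / a * L) \<le> real r + 1" by simp
      moreover have "1 * 1 \<le> n / a * L" using na k1 L by (intro mult_mono) auto
      ultimately have "3 * (n / a * L) + 3 \<le> real r" by linarith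
      then show ?thesis by (simp only: distrib_left mult_1_right)
    qed
    define nb where "nb i = {v \<in> \<Gamma>. nbr ?E v \<inter> c i ` {..<m} \<noteq> {}}" for i
    define Bad where "Bad = {(xs, ys). set xs \<subseteq> {..<N} \<and> length xs = t \<and> set ys \<subseteq> {..<N} \<and> length ys = t \<and>
        (\<forall>j\<in>set ys. Q j \<inter> (\<Union>i\<in>set xs. nb i) = {})}"
    define lam where "lam = real t / (20 * ?k * real N)"
    \<comment> \<open>A core of \<open>10 * k\<close> vertices has at most \<open>D\<close>
      neighbours. A vertex of \<open>\<Gamma>\<close> has at least \<open>d / 2\<close> neighbours
      in the cores, at most \<open>10 * k\<close> of them in each, so it sees at least
      \<open>f\<close> cores.\<close>
    define D where "D = 10 * ?k * real d"
    define f where "f = real d / (2 * (10 * ?k))"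
    define g where "g = real (card \<Gamma>)"
    have g25: "n \<le> 25 * g"
    proof -
      have "real (card ?V) \<le> real (25 * card \<Gamma>)" using \<Gamma>(2) by (simp only: of_nat_le_iff)
      then show ?thesis by (simp add: n_def g_def)
    qed
    have \<Gamma>V: "\<Gamma> \<subseteq> ?V" using \<Gamma>(1) Q by blast
    have fin\<Gamma>: "finite \<Gamma>" using \<Gamma>V V finite_subset by blast
    have card_core: "card (c i ` {..<m}) \<le> m" for i using card_image_le[of "{..<m}" "c i"] by simp
    have badcount: "real (card Bad) \<le> real (card {..<N}) ^ (2 * t) *
        (exp (- (real t * (lam * f * real (card \<Gamma>) / (2 * real (card {..<N}) * (1 + lam * D))))) +
        real t * exp (- (lam * real (card \<Gamma>) / 2)))"
      unfolding Bad_def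
    proof (rule card_non_hitting_pairs[where q = "20 * ?k"])
      show "nb i \<subseteq> \<Gamma>" for i by (auto simp: nb_def)
      show "real (card (nb i)) \<le> D" if "i \<in> {..<N}" for i
      proof -
        have cV: "c i ` {..<m} \<subseteq> ?V" using Q[of i] that by auto
        have "card (nb i) \<le> m * d"
          unfolding nb_def by (rule card_core_nbrs_le[OF V E d cV card_core])
        then have "real (card (nb i)) \<le> real (m * d)" by (simp only: of_nat_le_iff)
        then show ?thesis by (simp add: D_def m_def)
      qed
      show "f \<le> real (card {i \<in> {..<N}. v \<in> nb i})" if v: "v \<in> \<Gamma>" for v
      proof -
        have "card (nbr ?E v \<inter> (\<Union>i<N. c i ` {..<m})) \<le> m * card {i \<in> {..<N}. nbr ?E v \<inter> c i ` {..<m} \<noteq> {}}"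
          by (rule card_le_cores_hit) (use card_core in auto)
        also have "{i \<in> {..<N}. nbr ?E v \<inter> c i ` {..<m} \<noteq> {}} = {i \<in> {..<N}. v \<in> nb i}" using v by (simp add: nb_def)
        finally have "d \<le> 2 * (m * card {i \<in> {..<N}. v \<in> nb i})" using \<Gamma>(3)[OF v] by linarith
        then have "real d \<le> real (2 * (m * card {i \<in> {..<N}. v \<in> nb i}))" by (simp only: of_nat_le_iff)
        then show ?thesis using k1 by (simp add: f_def m_def field_simps)
      qed
      show "real (card (Q i)) \<le> 20 * ?k" if "i \<in> {..<N}" for i
      proof -
        have "card (Q i) \<le> 20 * k" using Q[of i] that by (simp add: m_def)
        then have "real (card (Q i)) \<le> real (20 * k)" by (simp only: of_nat_le_iff)
        then show ?thesis by simp
      qed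
      show "finite (Q i)" if "i \<in> {..<N}" for i using Q[of i] that V finite_subset by blast
      show "\<Gamma> \<subseteq> (\<Union>i\<in>{..<N}. Q i)" by (rule \<Gamma>(1))
      show "lam = real t / (20 * ?k * real (card {..<N}))" by (simp add: lam_def)
    qed (use fin\<Gamma> k1 in \<open>auto simp: f_def D_def\<close>)
    have decay1: "5 * L \<le> real t * (lam * f * g / (2 * real N * (1 + lam * D)))"
      unfolding f_def D_def
    proof (rule decay_rate_bound[OF _ L _ _ nd _ Nn g25 tsq_low t_kL lam_def])
      show "1 \<le> real d" using dk k1 by linarith
    qed (use k1 a1 N0 in auto)
    have decay2: "6 * L \<le> lam * g / 2"
    proof -
      have kN: "0 < 10 * ?k * real N" using k1 N0 by simp
      have "10 * ?k * real N \<le> 25 * g" using Nn g25 by linarith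
      then have "1 \<le> 25 * g / (10 * ?k * real N)" using kN by (subst le_divide_eq_1_pos)
      then have "real t / 100 * 1 \<le> real t / 100 * (25 * g / (10 * ?k * real N))" by (rule mult_left_mono) simp
      also have "\<dots> = lam * g / 2" by (simp add: lam_def mult_ac)
      finally have "real t / 100 \<le> lam * g / 2" by simp
      then show ?thesis using t1 s_L L0 by linarith
    qed
    have tn: "real t \<le> n" using t4N Nn' by linarith
    have expL: "exp (- (real j * L)) = 1 / n ^ j" for j
      using n0 by (simp add: L_def exp_minus exp_of_nat_mult inverse_eq_divide)
    \<comment> \<open>Of the power 5, one factor \<open>n\<close> pays for
      \<open>falling_ratio\<close> and two pay for the at most \<open>r ^ 2 <= n ^ 2\<close> pairs
      of segments, which leaves \<open>2 / n ^ 2\<close>.\<close>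
    have bracket: "exp (- (real t * (lam * f * g / (2 * real N * (1 + lam * D))))) + real t * exp (- (lam * g / 2)) \<le> 2 / n ^ 5"
    proof -
      have "exp (- (real t * (lam * f * g / (2 * real N * (1 + lam * D))))) \<le> exp (- (real 5 * L))"
        using decay1 by simp
      moreover have "real t * exp (- (lam * g / 2)) \<le> n * exp (- (real 6 * L))"
        using tn decay2 n0 by (intro mult_mono) auto
      moreover have "n * (1 / n ^ 6) = 1 / n ^ 5" using n0 by (simp add: power_numeral_reduce field_simps)
      ultimately show ?thesis unfolding expL by simp
    qed
    have fall: "real N ^ (2 * t) * fact (N - 2 * t) / fact N \<le> n"
    proof -
      have "real N ^ (2 * t) * fact (N - 2 * t) / fact N \<le> exp L"
        using falling_ratio[OF t4N N0] ratio by (meson exp_le_cancel_iff order_trans)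
      then show ?thesis using n0 by (simp add: L_def)
    qed
    have second: "real (r ^ 2) * (real (card Bad) * fact (N - 2 * t) / fact N) \<le> 2 / n ^ 2"
    proof -
      have "real (card Bad) \<le> real N ^ (2 * t) * (2 / n ^ 5)"
      proof -
        have "real (card Bad) \<le> real N ^ (2 * t) * (exp (- (real t * (lam * f * g / (2 * real N * (1 + lam * D))))) +
            real t * exp (- (lam * g / 2)))"
          using badcount by (simp add: g_def)
        also have "\<dots> \<le> real N ^ (2 * t) * (2 / n ^ 5)" using bracket by (intro mult_left_mono) auto
        finally show ?thesis .
      qed
      then have "real (card Bad) * (fact (N - 2 * t) / fact N) \<le> real N ^ (2 * t) * (2 / n ^ 5) * (fact (N - 2 * t) / fact N)"
        by (intro mult_right_mono) auto
      also have "\<dots> = real N ^ (2 * t) * fact (N - 2 * t) / fact N * (2 / n ^ 5)" by (simp add: mult_ac)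
      also have "\<dots> \<le> n * (2 / n ^ 5)" using fall n0 by (intro mult_right_mono) auto
      finally have 1: "real (card Bad) * fact (N - 2 * t) / fact N \<le> n * (2 / n ^ 5)" by simp
      have "real r ^ 2 \<le> n ^ 2" using rN Nn' by (intro power_mono) auto
      then have "real (r ^ 2) * (real (card Bad) * fact (N - 2 * t) / fact N) \<le> n ^ 2 * (n * (2 / n ^ 5))"
        using 1 n0 by (intro mult_mono) auto
      also have "\<dots> = 2 / n ^ 2" using n0 by (simp add: power_numeral_reduce field_simps)
      finally show ?thesis .
    qed
    let ?p = "8 / (n * ?k)"
    have nk: "n * ?k \<ge> 9" using n1 k1 mult_mono[of 1 n 9 ?k] by simp
    have p: "0 \<le> ?p" "?p \<le> 1" using nk by (auto simp: divide_le_eq)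
    have first: "4 ^ N * exp (- (?p * (real N * real m)\<^sup>2 / 16)) \<le> 1 / L"
    proof -
      have "?p * (real N * real m)\<^sup>2 / 16 = 2 * real N * (25 * (?k * real N)) / n"
        using n0 k1 by (simp add: m_def power2_eq_square field_simps)
      also have "\<dots> \<ge> 2 * real N * n / n" using N25 n0 by (intro divide_right_mono mult_left_mono) auto
      finally have "2 * real N \<le> ?p * (real N * real m)\<^sup>2 / 16" using n0 by simp
      then have "4 ^ N * exp (- (?p * (real N * real m)\<^sup>2 / 16)) \<le> 4 ^ N * exp (- (2 * real N))" by simp
      also have "\<dots> \<le> 2 / real N" by (rule four_power_exp_bound[OF N0])
      also have "\<dots> \<le> 1 / L"
      proof -
        have "8 * real t ^ 2 \<le> L * real N" using ratio N0 by (simp add: field_simps)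
        moreover have "2 * L * L \<le> 8 * real t ^ 2"
        proof -
          have "L \<le> real t" using t1 s_L L by linarith
          then have "L ^ 2 \<le> real t ^ 2" using L0 by (intro power_mono) auto
          then show ?thesis using zero_le_square[of "real t"] unfolding power2_eq_square by linarith
        qed
        ultimately have "L * (2 * L) \<le> L * real N" by (simp add: mult_ac)
        then have "2 * L \<le> real N" using L0 by (simp only: mult_le_cancel_left_pos)
        then show ?thesis using L0 N0 by (simp add: field_simps)
      qed
      finally show ?thesis .
    qed
    have "measure_pmf.prob (Pi_pmf (all_pairs ?V) False (\<lambda>_. bernoulli_pmf ?p))
        {b. hadwiger_number (graph_union G \<lparr>verts = ?V, edges = {e \<in> all_pairs ?V. b e}\<rparr>) < r}
      \<le> 4 ^ N * exp (- (?p * (real N * real m)\<^sup>2 / 16)) + real (r ^ 2) * (real (card Bad) * fact (N - 2 * t) / fact N)"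
    proof (rule prob_hadwiger_lt[OF sg inj m1 _ dj p _ rt])
      show "Bad = {(xs, ys). set xs \<subseteq> {..<N} \<and> length xs = t \<and> set ys \<subseteq> {..<N} \<and> length ys = t \<and>
        (\<forall>j\<in>set ys. Q j \<inter> (\<Union>i\<in>set xs. {v \<in> \<Gamma>. nbr ?E v \<inter> c i ` {..<m} \<noteq> {}}) = {})}"
        unfolding Bad_def nb_def ..
    qed (use Q tn0 in auto)
    also have "\<dots> \<le> 1 / L + 2 / n ^ 2" by (intro add_mono first second)
    finally show ?thesis using r_low by blast
  qed
qed

text \<open>Product colouring, the pair of colours being encoded as
  \<open>3 * c v + c' v\<close>.\<close>

lemma chromatic_number_union_le:
  assumes c: "proper_colouring G q c" and R: "three_colourable (verts G) E"
  shows "chromatic_number (graph_union G \<lparr>verts = verts G, edges = E\<rparr>) \<le> 3 * q"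
proof -
  let ?K = "graph_union G \<lparr>verts = verts G, edges = E\<rparr>"
  obtain c' where c': "\<And>v. v \<in> verts G \<Longrightarrow> c' v < (3 :: nat)"
      "\<And>u v. u \<in> verts G \<Longrightarrow> v \<in> verts G \<Longrightarrow> {u, v} \<in> E \<Longrightarrow> c' u \<noteq> c' v"
    using R unfolding three_colourable_def by blast
  have cq: "c v < q" if "v \<in> verts G" for v using c that by (simp add: proper_colouring_def)
  have cE: "c u \<noteq> c v" if "u \<in> verts G" "v \<in> verts G" "{u, v} \<in> edges G" for u v
    using c that unfolding proper_colouring_def by blast
  have "proper_colouring ?K (3 * q) (\<lambda>v. 3 * c v + c' v)"
    unfolding proper_colouring_def
  proof (intro conjI ballI impI)
    fix v assume "v \<in> verts ?K"
    then have v: "v \<in> verts G" by (simp add: graph_union_def)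
    show "3 * c v + c' v < 3 * q" using cq[OF v] c'(1)[OF v] by linarith
    fix u assume "u \<in> verts ?K" and e: "{v, u} \<in> edges ?K"
    then have u: "u \<in> verts G" by (simp add: graph_union_def)
    have "c v \<noteq> c u \<or> c' v \<noteq> c' u" using e cE[OF v u] c'(2)[OF v u] by (auto simp: graph_union_def)
    moreover have "3 * x + y \<noteq> 3 * x' + y'" if "x \<noteq> x' \<or> y \<noteq> y'" "y < 3" "y' < 3" for x y x' y' :: nat
      using that by presburger
    ultimately show "3 * c v + c' v \<noteq> 3 * c u + c' u" using c'(1)[OF v] c'(1)[OF u] by blast
  qed
  then show ?thesis unfolding chromatic_number_def by (intro Least_le) blast
qed

text \<open>\<open>K\<close> is chosen before \<open>G\<close> and \<open>k\<close>, so the error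
  depends on the number of vertices only. Its terms stem from missing expansion, from unjoined
  segments and from random graphs that are not 3-colourable.\<close>

lemma prob_hadwiger_ge_chromatic:
  obtains K where "\<And>(G :: 'a ugraph) k. simple_graph G \<Longrightarrow> vertex_transitive G \<Longrightarrow> 8 < k \<Longrightarrow> 1 \<le> ln (real (card (verts G))) \<Longrightarrow>
    1000000000000 * real k ^ 2 * ln (real (card (verts G))) ^ 3 \<le> real (independence_number G) \<Longrightarrow>
    real (independence_number G) \<le> 1 / 100000000 * real (card (verts G)) / real k \<Longrightarrow>
    1 - (1 / ln (real (card (verts G))) + 2 / real (card (verts G)) ^ 2 + K / real (card (verts G))) \<le>
    measure_pmf.prob (binomial_random_graph (verts G) (8 / (real (card (verts G)) * real k)))
      {R. hadwiger_number (graph_union G R) \<ge> chromatic_number (graph_union G R)}"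
proof -
  obtain K where K: "\<And>(V :: 'a set) p. finite V \<Longrightarrow> 0 \<le> p \<Longrightarrow> p \<le> 1 \<Longrightarrow> real (card V) * p \<le> 8 / 9 \<Longrightarrow>
     measure_pmf.prob (Pi_pmf (all_pairs V) False (\<lambda>_. bernoulli_pmf p))
       {b. \<not> three_colourable V {e \<in> all_pairs V. b e}} \<le> K * p"
    using prob_not_three_colourable by blast
  show ?thesis
  proof (rule that[of "\<bar>K\<bar>"])
    fix G :: "'a ugraph" and k :: nat
    let ?V = "verts G" and ?n = "real (card (verts G))" and ?a = "real (independence_number G)"
    assume sg: "simple_graph G" and vt: "vertex_transitive G" and k: "8 < k" and L: "1 \<le> ln ?n"
      and lower: "1000000000000 * real k ^ 2 * ln ?n ^ 3 \<le> ?a" and upper: "?a \<le> 1 / 100000000 * ?n / real k"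
    let ?p = "8 / (?n * real k)"
    let ?M = "Pi_pmf (all_pairs ?V) False (\<lambda>_. bernoulli_pmf ?p)"
    let ?R = "\<lambda>b. \<lparr>verts = ?V, edges = {e \<in> all_pairs ?V. b e}\<rparr>"
    let ?good = "{R. hadwiger_number (graph_union G R) \<ge> chromatic_number (graph_union G R)}"
    have n0: "card ?V > 0" using L by (cases "card ?V = 0") auto
    then have n1: "?n \<ge> 1" by linarith
    have V: "finite ?V" using sg by (simp add: simple_graph_def)
    have k9: "real k \<ge> 9" using k by simp
    have nk: "?n * real k \<ge> 9 * ?n" using k9 n1 by (simp add: mult.commute)
    have p0: "0 \<le> ?p" using n1 k9 by simp
    have pn: "?p \<le> 1 / ?n" using nk n1 k9 by (simp add: field_simps)
    then have p1: "?p \<le> 1" using n1 by (smt (verit) divide_le_eq_1)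
    \<comment> \<open>\<open>8 < k\<close> means \<open>k >= 9\<close>, hence
      \<open>n * p <= 8 / 9\<close>: the random graph stays below the threshold
      \<open>n * p = 1\<close> by a margin uniform in \<open>n\<close>.\<close>
    have np: "?n * ?p \<le> 8 / 9" using nk n1 k9 by (simp add: field_simps)
    obtain q c where c: "proper_colouring G q c" and q: "real q \<le> ?n / ?a * ln ?n + 1"
      using vertex_transitive_colouring[OF sg vt n0] by blast
    obtain r where r: "3 * (?n / ?a * ln ?n + 1) \<le> real r" and
      pr: "measure_pmf.prob ?M {b. hadwiger_number (graph_union G (?R b)) < r} \<le> 1 / ln ?n + 2 / ?n ^ 2"
      using prob_hadwiger_small[OF sg vt k L lower] upper by auto
    have "3 * real q \<le> 3 * (?n / ?a * ln ?n + 1)" using q by (rule mult_left_mono) simp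
    then have "real (3 * q) \<le> real r" using r by simp
    then have qr: "3 * q \<le> r" by (simp only: of_nat_le_iff)
    have "- {b. ?R b \<in> ?good} \<subseteq> {b. hadwiger_number (graph_union G (?R b)) < r} \<union>
        {b. \<not> three_colourable ?V {e \<in> all_pairs ?V. b e}}"
    proof
      fix b assume b: "b \<in> - {b. ?R b \<in> ?good}"
      show "b \<in> {b. hadwiger_number (graph_union G (?R b)) < r} \<union> {b. \<not> three_colourable ?V {e \<in> all_pairs ?V. b e}}"
      proof (rule ccontr)
        assume "\<not> ?thesis"
        then have "r \<le> hadwiger_number (graph_union G (?R b))" and 3: "three_colourable ?V {e \<in> all_pairs ?V. b e}"
          by auto
        then show False using chromatic_number_union_le[OF c 3] qr b by simp
      qed
    qed
    then have "measure_pmf.prob ?M (- {b. ?R b \<in> ?good}) \<le>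
        measure_pmf.prob ?M ({b. hadwiger_number (graph_union G (?R b)) < r} \<union>
          {b. \<not> three_colourable ?V {e \<in> all_pairs ?V. b e}})"
      by (intro measure_pmf.finite_measure_mono) auto
    also have "\<dots> \<le> measure_pmf.prob ?M {b. hadwiger_number (graph_union G (?R b)) < r} +
        measure_pmf.prob ?M {b. \<not> three_colourable ?V {e \<in> all_pairs ?V. b e}}"
      by (rule measure_Un_le) auto
    also have "\<dots> \<le> (1 / ln ?n + 2 / ?n ^ 2) + K * ?p"
      using pr K[OF V p0 p1 np] by linarith
    also have "K * ?p \<le> \<bar>K\<bar> * (1 / ?n)" using pn p0 by (intro mult_mono) auto
    finally have bad: "measure_pmf.prob ?M (- {b. ?R b \<in> ?good}) \<le> 1 / ln ?n + 2 / ?n ^ 2 + \<bar>K\<bar> / ?n" by simp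
    have "measure_pmf.prob ?M {b. ?R b \<in> ?good} = 1 - measure_pmf.prob ?M (- {b. ?R b \<in> ?good})"
      using measure_pmf.prob_compl[of "- {b. ?R b \<in> ?good}" ?M] by (simp add: Compl_eq_Diff_UNIV double_diff)
    moreover have "measure_pmf.prob (binomial_random_graph ?V ?p) ?good = measure_pmf.prob ?M {b. ?R b \<in> ?good}"
      by (simp add: binomial_random_graph_def vimage_def)
    ultimately show "1 - (1 / ln ?n + 2 / ?n ^ 2 + \<bar>K\<bar> / ?n) \<le> measure_pmf.prob (binomial_random_graph ?V ?p) ?good"
      using bad by linarith
  qed
qed

theorem proposition1p3:
  fixes k :: "nat \<Rightarrow> nat"
  assumes "\<forall>n. 8 < k n"
  shows "\<exists>c1 > (0::real). \<exists>c2 > (0::real). \<forall>G :: nat \<Rightarrow> nat ugraph.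
    ((\<lambda>n. measure_pmf.prob
            (binomial_random_graph (verts (G n)) (8 / (real n * real (k n))))
            {R. hadwiger_number (graph_union (G n) R) \<ge> chromatic_number (graph_union (G n) R)})
      \<longlongrightarrow> 1)
    (inf sequentially (principal {n.
        simple_graph (G n) \<and> card (verts (G n)) = n \<and> vertex_transitive (G n) \<and>
        c1 * real (k n) ^ 2 * ln (real n) ^ 3 \<le> real (independence_number (G n)) \<and>
        real (independence_number (G n)) \<le> c2 * real n / real (k n)}))"
proof -
  obtain K where K: "\<And>(G :: nat ugraph) k. simple_graph G \<Longrightarrow> vertex_transitive G \<Longrightarrow> 8 < k \<Longrightarrow>
    1 \<le> ln (real (card (verts G))) \<Longrightarrow>
    1000000000000 * real k ^ 2 * ln (real (card (verts G))) ^ 3 \<le> real (independence_number G) \<Longrightarrow>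
    real (independence_number G) \<le> 1 / 100000000 * real (card (verts G)) / real k \<Longrightarrow>
    1 - (1 / ln (real (card (verts G))) + 2 / real (card (verts G)) ^ 2 + K / real (card (verts G))) \<le>
    measure_pmf.prob (binomial_random_graph (verts G) (8 / (real (card (verts G)) * real k)))
      {R. hadwiger_number (graph_union G R) \<ge> chromatic_number (graph_union G R)}"
    using prob_hadwiger_ge_chromatic by blast
  have ev: "eventually (\<lambda>n. 1 \<le> ln (real n)) sequentially" by real_asymp
  have lim: "(\<lambda>n. 1 - (1 / ln (real n) + 2 / real n ^ 2 + K / real n)) \<longlonglongrightarrow> 1" by real_asymp
  show ?thesis
  proof (rule exI[of _ "1000000000000"], rule conjI, simp, rule exI[of _ "1 / 100000000"], rule conjI, simp, rule allI)
    fix G :: "nat \<Rightarrow> nat ugraph"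
    let ?S = "{n. simple_graph (G n) \<and> card (verts (G n)) = n \<and> vertex_transitive (G n) \<and>
        1000000000000 * real (k n) ^ 2 * ln (real n) ^ 3 \<le> real (independence_number (G n)) \<and>
        real (independence_number (G n)) \<le> 1 / 100000000 * real n / real (k n)}"
    let ?F = "inf sequentially (principal ?S)"
    show "((\<lambda>n. measure_pmf.prob
            (binomial_random_graph (verts (G n)) (8 / (real n * real (k n))))
            {R. hadwiger_number (graph_union (G n) R) \<ge> chromatic_number (graph_union (G n) R)}) \<longlongrightarrow> 1) ?F"
    proof (rule tendsto_sandwich)
      show "((\<lambda>n. 1 - (1 / ln (real n) + 2 / real n ^ 2 + K / real n)) \<longlongrightarrow> 1) ?F"
        by (rule tendsto_mono[OF inf_le1 lim])
      show "((\<lambda>n. 1) \<longlongrightarrow> (1 :: real)) ?F" by (rule tendsto_const)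
      show "eventually (\<lambda>n. measure_pmf.prob (binomial_random_graph (verts (G n)) (8 / (real n * real (k n))))
            {R. hadwiger_number (graph_union (G n) R) \<ge> chromatic_number (graph_union (G n) R)} \<le> 1) ?F"
        by (intro always_eventually allI measure_pmf.prob_le_1)
      \<comment> \<open>Along \<open>?F\<close> the bound is needed only for large \<open>n\<close>
        at which \<open>G n\<close> satisfies the hypotheses; there the uniform estimate applies
        with \<open>k n\<close> in place of \<open>k\<close>.\<close>
      show "eventually (\<lambda>n. 1 - (1 / ln (real n) + 2 / real n ^ 2 + K / real n) \<le>
          measure_pmf.prob (binomial_random_graph (verts (G n)) (8 / (real n * real (k n))))
            {R. hadwiger_number (graph_union (G n) R) \<ge> chromatic_number (graph_union (G n) R)}) ?F"
        unfolding eventually_inf_principal using ev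
      proof eventually_elim
        case (elim n)
        show ?case
        proof
          assume "n \<in> ?S"
          then show "1 - (1 / ln (real n) + 2 / real n ^ 2 + K / real n) \<le>
              measure_pmf.prob (binomial_random_graph (verts (G n)) (8 / (real n * real (k n))))
                {R. hadwiger_number (graph_union (G n) R) \<ge> chromatic_number (graph_union (G n) R)}"
            using K[of "G n" "k n"] elim assms by auto
        qed
      qed
    qed
  qed
qed

end
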